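(* Let $M,N\geq 2$, and fix some $\epsilon>0$. Let $f$ be any multiplicative function such that $0\leq f(p)\leq 1$ and $f(p^m)\leq f(p)$ for all primes $p$ and all $m\geq 2$. Suppose also that there exists an $0<\alpha\leq 1$ such that for all $X\geq 2$ we have $$\sum_{p\leq X}\frac{f(p)}{p}=\alpha\log\log X+O(1),$$ the sum being over primes $p\leq X$. Then for any complex sequences $a_n$, $b_m$ which are supported on the odd integers such that $|a_n|\leq 1$ and $|b_m|\leq 1$ we have $$\mathop{\sum\sum}_{n\leq N,\;m\leq M}a_nb_mf(m)\left(\frac{n}{m}\right)\ll_{\epsilon}\frac{MN^{1/2}(\log N)}{(\log M)^{(1-\alpha)}}+\frac{M^{1/2+\epsilon}N^{3/2}(\log N)^{1/2}}{(\log M)^{(1-\alpha)/2}},$$ where the implied constant depends at most on $\epsilon$.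
   Context: The sums are over positive integers $n$ and $m$, and $\left(\frac{n}{m}\right)$ is the Jacobi symbol for odd positive $m$. The notation $A\ll B$ means $|A|\leq CB$ for a constant $C>0$ with the stated dependence.
   Formalization: The formal statement also assumes f(p^m) ≥ 0 for all primes p and m ≥ 2 (the claim fails if f(p^m) may be arbitrarily negative), and the implied constant depends on ε and on a bound K for the O(1) term in the prime sum. *)

theory Defs
  imports "HOL-Analysis.Analysis" "HOL-Number_Theory.Number_Theory"
begin

definition multiplicative :: "(nat \<Rightarrow> real) \<Rightarrow> bool" where
  "multiplicative f \<longleftrightarrow> f 1 = 1 \<and> (\<forall>m n. coprime m n \<longrightarrow> f (m * n) = f m * f n)"

(* Only meaningful for odd positive m: for even m the factor Legendre n 2 is not the
   Kronecker extension. The empty product gives the value 1 at m = 1. *)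
definition jacobi_symbol :: "int \<Rightarrow> nat \<Rightarrow> int" where
  "jacobi_symbol n m = (\<Prod>p\<in>#prime_factorization m. Legendre n (int p))"

end

theory Submission
  imports
    Defs
    "HOL-Computational_Algebra.Nth_Powers"
    "HOL-Computational_Algebra.Squarefree"
begin

text \<open>
  Write \<open>A m\<close> for the sum of \<open>a n\<close> times the symbol \<open>(n / m)\<close> over \<open>n \<le> N\<close>
  (\<open>jacobi_sum\<close>) and \<open>h m\<close> for the product of \<open>f p\<close> over the primes dividing \<open>m\<close>. The
  hypotheses give \<open>0 \<le> f \<le> h \<le> 1\<close>, so by Cauchy--Schwarz the square of the bilinear form is
  at most \<open>\<Sum> h m\<close> times \<open>\<Sum> h m \<bar>A m\<bar>\<^sup>2\<close>, both over \<open>m \<le> M\<close>, the second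
  over odd \<open>m\<close>. The first factor and the main term of the second have to gain
  \<open>(ln M) powr (\<alpha> - 1)\<close> over a bound that only uses \<open>h \<le> 1\<close>. For \<open>\<Sum> h m\<close> this is the
  classical argument that inserts \<open>ln m\<close>, written as a sum of the von
  Mangoldt function over the divisors of \<open>m\<close>, and uses Chebyshev's bound and the Euler product.

  If \<open>h\<close> is replaced by \<open>1\<close>, expanding the square of \<open>A m\<close> gives a diagonal of
  \<open>O(N ln N)\<close> pairs with \<open>n1 * n2\<close> a square, and character sums
  \<open>\<Sum> (n1 * n2 / m)\<close> for the other pairs. Quadratic reciprocity turns the latter into
  sums of a nonprincipal character modulo \<open>n1 * n2\<close> over intervals, to which the
  Polya--Vinogradov inequality applies. This is \<open>quadratic_large_sieve\<close>, with bound
  \<open>M N ln N + N\<^sup>3 ln N\<close> up to a constant; it suffices when \<open>N\<close> exceeds a fixed power of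
  \<open>M\<close>, because then one factor \<open>ln N\<close> may be traded for \<open>ln M\<close>.

  For smaller \<open>N\<close> the factor \<open>ln m\<close> is inserted again. After splitting \<open>m = d * r\<close> with
  \<open>d\<close> a prime power, \<open>h (d * r) \<le> h r\<close> and there are two main ranges. For \<open>d \<le> N ^ 16\<close>
  the large sieve over \<open>r\<close> and Mertens' estimate lose only a factor \<open>ln N\<close>, which is the
  reason for the extra logarithm in the theorem. For primes \<open>d = p > N ^ 16\<close> the variable \<open>r\<close>
  is kept outside, and the sum over \<open>p\<close> is long compared with \<open>N\<close>; majorising the primes by
  the square of a Selberg sieve and expanding as before shows that \<open>\<bar>A\<bar>\<^sup>2\<close> is on average over
  primes as small as its diagonal (\<open>prime_second_moment\<close>). The remaining sum \<open>\<Sum> h r / r\<close> is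
  \<open>O((ln M) powr \<alpha>)\<close> by the Euler product. Dividing by \<open>ln M\<close> gives
  \<open>weighted_second_moment_bound\<close>, and with it the theorem.
\<close>

section \<open>The Jacobi symbol and its reciprocity law\<close>

lemma legendre_values: "Legendre a p \<in> {-1, 0, 1}"
  by (simp add: Legendre_def)

lemma legendre_cong:
  assumes "[a = b] (mod p)"
  shows "Legendre a p = Legendre b p"
proof -
  have "[a = 0] (mod p) \<longleftrightarrow> [b = 0] (mod p)"
    using assms cong_trans cong_sym by blast
  moreover have "QuadRes p a \<longleftrightarrow> QuadRes p b"
    unfolding QuadRes_def using assms cong_trans cong_sym by blast
  ultimately show ?thesis by (simp add: Legendre_def)
qed

text \<open>
  Euler's criterion makes the two sides congruent modulo \<open>p\<close>; both lie in
  \<open>{-1, 0, 1}\<close>, so for \<open>p > 2\<close> they are equal.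
\<close>
lemma legendre_mult:
  assumes "prime (p::nat)" "p > 2"
  shows "Legendre (a * b) (int p) = Legendre a (int p) * Legendre b (int p)"
proof -
  let ?e = "(p - 1) div 2"
  have e: "[Legendre c (int p) = c ^ ?e] (mod int p)" for c
    using euler_criterion[OF assms] .
  have "[Legendre a p * Legendre b p = a ^ ?e * b ^ ?e] (mod int p)"
    by (intro cong_mult e)
  moreover have "[Legendre (a * b) p = a ^ ?e * b ^ ?e] (mod int p)"
    using e[of "a * b"] by (simp add: power_mult_distrib)
  ultimately have "[Legendre (a * b) p = Legendre a p * Legendre b p] (mod int p)"
    using cong_trans cong_sym by blast
  hence dv: "int p dvd Legendre (a * b) p - Legendre a p * Legendre b p"
    by (simp add: cong_iff_dvd_diff)
  let ?d = "Legendre (a * b) p - Legendre a p * Legendre b p"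
  have bd: "\<bar>?d\<bar> \<le> 2"
    using legendre_values[of "a*b" p] legendre_values[of a p] legendre_values[of b p] by auto
  have "?d = 0"
  proof (rule ccontr)
    assume "?d \<noteq> 0"
    hence "int p \<le> \<bar>?d\<bar>" using dvd_imp_le_int[OF _ dv] by simp
    thus False using bd assms(2) by linarith
  qed
  thus ?thesis by simp
qed

lemma jacobi_symbol_1 [simp]: "jacobi_symbol n (Suc 0) = 1"
  by (simp add: jacobi_symbol_def)

lemma jacobi_symbol_prime: "prime p \<Longrightarrow> jacobi_symbol n p = Legendre n (int p)"
  by (simp add: jacobi_symbol_def prime_factorization_prime)

lemma jacobi_symbol_mult_bottom:
  "a > 0 \<Longrightarrow> b > 0 \<Longrightarrow> jacobi_symbol n (a * b) = jacobi_symbol n a * jacobi_symbol n b"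
  by (simp add: jacobi_symbol_def prime_factorization_mult)

lemma jacobi_symbol_power_bottom:
  "a > 0 \<Longrightarrow> jacobi_symbol n (a ^ k) = jacobi_symbol n a ^ k"
  by (induction k) (simp_all add: jacobi_symbol_mult_bottom)

lemma odd_prime_factor_gt_2:
  assumes "odd (m::nat)" "p \<in># prime_factorization m"
  shows "prime p" "p > 2" 
proof -
  show pr: "prime p" using assms(2) by (rule in_prime_factors_imp_prime)
  have "p dvd m" using assms(2) by (rule in_prime_factors_imp_dvd)
  hence "p \<noteq> 2" using assms(1) by auto
  thus "p > 2" using prime_ge_2_nat[OF pr] by linarith
qed

lemma jacobi_symbol_mult_top:
  assumes "odd m"
  shows "jacobi_symbol (a * b) m = jacobi_symbol a m * jacobi_symbol b m"
proof -
  have "jacobi_symbol (a * b) m = (\<Prod>p\<in>#prime_factorization m. Legendre a (int p) * Legendre b (int p))"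
    unfolding jacobi_symbol_def
    using odd_prime_factor_gt_2[OF assms] legendre_mult
    by (intro arg_cong[where f = prod_mset] image_mset_cong) blast
  thus ?thesis by (simp add: jacobi_symbol_def prod_mset.distrib)
qed

lemma jacobi_symbol_cong:
  assumes "[a = b] (mod int m)"
  shows "jacobi_symbol a m = jacobi_symbol b m"
proof -
  have "Legendre a (int p) = Legendre b (int p)" if "p \<in># prime_factorization m" for p
  proof -
    have "int p dvd int m" using in_prime_factors_imp_dvd[OF that] by simp
    thus ?thesis using assms by (intro legendre_cong) (rule cong_dvd_modulus)
  qed
  thus ?thesis unfolding jacobi_symbol_def
    by (intro arg_cong[where f = prod_mset] image_mset_cong) blast
qed

lemma jacobi_symbol_values: "jacobi_symbol n m \<in> {-1, 0, 1}"
proof -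
  have "(\<Prod>p\<in>#A. Legendre n (int p)) \<in> {-1, 0, 1}" for A
  proof (induction A)
    case (add p A)
    thus ?case using legendre_values[of n "int p"] by force
  qed simp
  thus ?thesis by (simp add: jacobi_symbol_def)
qed

lemma jacobi_symbol_eq_0_iff:
  assumes "m > 0"
  shows "jacobi_symbol n m = 0 \<longleftrightarrow> \<not> coprime n (int m)"
proof -
  have "jacobi_symbol n m = 0 \<longleftrightarrow> (\<exists>p\<in>#prime_factorization m. int p dvd n)"
    by (auto simp: jacobi_symbol_def Legendre_def cong_0_iff)
  also have "\<dots> \<longleftrightarrow> \<not> coprime n (int m)"
  proof
    assume "\<exists>p\<in>#prime_factorization m. int p dvd n"
    then obtain p where p: "p \<in># prime_factorization m" "int p dvd n" by blast
    have "int p dvd int m" using in_prime_factors_imp_dvd[OF p(1)] by simp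
    moreover have "\<not> is_unit (int p)"
      using in_prime_factors_imp_prime[OF p(1)] by auto
    ultimately show "\<not> coprime n (int m)" using p(2) not_coprimeI by blast
  next
    assume "\<not> coprime n (int m)"
    hence "\<not> coprime (nat \<bar>n\<bar>) m"
      by (metis coprime_commute coprime_int_iff coprime_abs_left_iff nat_0_le abs_ge_zero)
    hence "gcd (nat \<bar>n\<bar>) m \<noteq> 1" by (simp add: coprime_iff_gcd_eq_1)
    then obtain p where p': "prime p" "p dvd gcd (nat \<bar>n\<bar>) m"
      using prime_factor_nat by blast
    hence p: "prime p" "p dvd nat \<bar>n\<bar>" "p dvd m"
      using dvd_trans[OF p'(2) gcd_dvd1] dvd_trans[OF p'(2) gcd_dvd2] by blast+
    have "int p dvd int (nat \<bar>n\<bar>)" using p(2) by (simp only: int_dvd_int_iff)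
    hence "int p dvd n" by simp
    moreover have "p \<in># prime_factorization m" using p assms by (simp add: in_prime_factors_iff)
    ultimately show "\<exists>p\<in>#prime_factorization m. int p dvd n" by blast
  qed
  finally show ?thesis .
qed

lemma jacobi_symbol_square_top:
  assumes "odd m" "coprime a (int m)"
  shows "jacobi_symbol (a * a) m = 1"
proof -
  have "jacobi_symbol a m \<noteq> 0"
    using assms jacobi_symbol_eq_0_iff[of m a] by (cases "m = 0") simp_all
  hence "jacobi_symbol a m = 1 \<or> jacobi_symbol a m = -1"
    using jacobi_symbol_values[of a m] by blast
  thus ?thesis unfolding jacobi_symbol_mult_top[OF assms(1)] by (elim disjE) simp_all
qed

text \<open>
  The usual sign \<open>(-1) ^ ((m - 1) div 2 * ((k - 1) div 2))\<close> for odd \<open>m\<close> and \<open>k\<close>, in a form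
  that visibly depends on the residues modulo 4 only.
\<close>
definition reciprocity_sign :: "nat \<Rightarrow> nat \<Rightarrow> int" where
  "reciprocity_sign m k = (if m mod 4 = 3 \<and> k mod 4 = 3 then -1 else 1)"

lemma reciprocity_sign_commute: "reciprocity_sign m k = reciprocity_sign k m"
  by (auto simp: reciprocity_sign_def)

lemma odd_mod_4:
  assumes "odd (m::nat)" shows "m mod 4 = 1 \<or> m mod 4 = 3"
  using assms by presburger

lemma reciprocity_sign_mult:
  assumes "odd a" "odd b"
  shows "reciprocity_sign (a * b) k = reciprocity_sign a k * reciprocity_sign b k"
proof -
  have "(a * b) mod 4 = ((a mod 4) * (b mod 4)) mod 4" by (simp add: mod_mult_eq)
  thus ?thesis using odd_mod_4[OF assms(1)] odd_mod_4[OF assms(2)]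
    by (elim disjE) (simp_all add: reciprocity_sign_def)
qed

lemma legendre_reciprocity:
  assumes "prime p" "odd p" "prime q" "odd q"
  shows "Legendre (int p) (int q) = reciprocity_sign p q * Legendre (int q) (int p)"
proof (cases "p = q")
  case True
  thus ?thesis by (simp add: Legendre_def cong_def)
next
  case False
  have p2: "p > 2" "q > 2"
    using assms prime_ge_2_nat[of p] prime_ge_2_nat[of q] by (auto simp: order.strict_iff_order)
  have QR: "Legendre p q * Legendre q p = (-1::int) ^ ((p - 1) div 2 * ((q - 1) div 2))"
    by (rule Quadratic_Reciprocity) (use assms p2 False in auto)
  have sgn: "(-1::int) ^ ((p - 1) div 2 * ((q - 1) div 2)) = reciprocity_sign p q"
  proof -
    have "even ((p - 1) div 2) \<longleftrightarrow> p mod 4 = 1" using assms(2) by presburger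
    moreover have "even ((q - 1) div 2) \<longleftrightarrow> q mod 4 = 1" using assms(4) by presburger
    ultimately show ?thesis using odd_mod_4[OF assms(2)] odd_mod_4[OF assms(4)]
      by (auto simp: reciprocity_sign_def)
  qed
  have "reciprocity_sign p q \<noteq> 0" by (simp add: reciprocity_sign_def)
  thus ?thesis using QR unfolding sgn
    using legendre_values[of p q] legendre_values[of q p]
    by (auto simp: reciprocity_sign_def split: if_splits)
qed

text \<open>
  Both sides are multiplicative in each argument, so the law for primes extends prime factor by
  prime factor, first in \<open>m\<close> and then in \<open>k\<close>. If the arguments have a common factor, both
  symbols vanish.
\<close>
lemma jacobi_reciprocity:
  assumes "odd m" "odd k"
  shows "jacobi_symbol (int k) m = reciprocity_sign m k * jacobi_symbol (int m) k"
proof -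
  have 1: "jacobi_symbol (int p) m = reciprocity_sign m p * jacobi_symbol (int m) p"
    if "odd m" "prime p" "odd p" for p m :: nat
    using that(1)
  proof (induction m rule: prime_divisors_induct)
    case (factor q x)
    hence odd: "odd q" "odd x" by auto
    have pos: "q > 0" "x > 0" using odd by (auto intro: Nat.gr0I)
    have IH: "jacobi_symbol (int p) x = reciprocity_sign x p * jacobi_symbol (int x) p"
      using factor odd by blast
    have "jacobi_symbol (int p) (q * x) = Legendre (int p) (int q) * jacobi_symbol (int p) x"
      using factor(1) pos by (simp add: jacobi_symbol_mult_bottom jacobi_symbol_prime)
    also have "\<dots> = reciprocity_sign p q * Legendre (int q) (int p) * (reciprocity_sign x p * jacobi_symbol (int x) p)"
      using legendre_reciprocity[OF that(2,3) factor(1) odd(1)] IH by simp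
    also have "\<dots> = reciprocity_sign (q * x) p * jacobi_symbol (int q * int x) p"
      using reciprocity_sign_mult[OF odd, of p] jacobi_symbol_mult_top[OF that(3)] that(2)
      by (simp add: reciprocity_sign_commute jacobi_symbol_prime)
    finally show ?case by simp
  next
    case (unit x)
    have "jacobi_symbol 1 p = 1"
      using jacobi_symbol_square_top[OF that(3), of 1] by simp
    thus ?case using unit by (simp add: reciprocity_sign_def)
  qed simp
  show ?thesis using assms(2)
  proof (induction k rule: prime_divisors_induct)
    case (factor q x)
    hence odd: "odd q" "odd x" by auto
    have pos: "q > 0" "x > 0" using odd by (auto intro: Nat.gr0I)
    have IH: "jacobi_symbol (int x) m = reciprocity_sign m x * jacobi_symbol (int m) x"
      using factor odd by blast
    have "jacobi_symbol (int (q * x)) m = jacobi_symbol (int q) m * jacobi_symbol (int x) m"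
      using jacobi_symbol_mult_top[OF assms(1)] by simp
    also have "\<dots> = reciprocity_sign m q * jacobi_symbol (int m) q * (reciprocity_sign m x * jacobi_symbol (int m) x)"
      using 1[OF assms(1) factor(1) odd(1)] IH by simp
    also have "\<dots> = reciprocity_sign m (q * x) * jacobi_symbol (int m) (q * x)"
      using reciprocity_sign_mult[OF odd, of m] pos
      by (simp add: reciprocity_sign_commute jacobi_symbol_mult_bottom)
    finally show ?case .
  next
    case (unit x)
    have "jacobi_symbol 1 m = 1"
      using jacobi_symbol_square_top[OF assms(1), of 1] by simp
    thus ?case using unit by (simp add: reciprocity_sign_def)
  qed simp
qed

text \<open>
  Squaring is not injective on the nonzero residues, since \<open>1\<close> and \<open>p - 1\<close> have the same
  square, and hence it is not surjective.
\<close>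
lemma exists_quadratic_nonresidue:
  assumes "prime (p::nat)" "p > 2"
  shows "\<exists>u. Legendre (int u) (int p) = -1"
proof -
  let ?A = "{1..<p}"
  let ?f = "\<lambda>x. (x * x) mod p"
  have "?f ` ?A \<noteq> ?A"
  proof
    assume eq: "?f ` ?A = ?A"
    have "inj_on ?f ?A" by (rule eq_card_imp_inj_on) (simp, simp only: eq)
    moreover have "?f 1 = ?f (p - 1)"
    proof -
      obtain q where q: "p = q + 2" using assms(2) by (metis less_imp_add_positive add.commute)
      have "(p - 1) * (p - 1) = 1 + q * p" unfolding q by (simp add: algebra_simps)
      hence "?f (p - 1) = (1 + q * p) mod p" by simp
      also have "\<dots> = 1 mod p" by (rule mod_mult_self1)
      finally show ?thesis by simp
    qed
    moreover have "1 \<in> ?A" "p - 1 \<in> ?A" using assms(2) by simp_all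
    ultimately have "1 = p - 1" by (blast dest: inj_onD)
    thus False using assms(2) by simp
  qed
  moreover have "?f ` ?A \<subseteq> ?A"
  proof
    fix y assume "y \<in> ?f ` ?A"
    then obtain x where x: "x \<in> ?A" "y = (x * x) mod p" by blast
    have "\<not> p dvd x" using x(1) by (auto dest: dvd_imp_le)
    hence "\<not> p dvd x * x" using assms(1) prime_dvd_mult_iff by blast
    thus "y \<in> ?A" using x(2) assms(2) by (auto simp: dvd_eq_mod_eq_0)
  qed
  ultimately obtain u where u: "u \<in> ?A" "u \<notin> ?f ` ?A" by blast
  have n0: "\<not> [int u = 0] (mod int p)"
    using u(1) by (simp add: cong_def)
  have "\<not> QuadRes (int p) (int u)"
  proof
    assume "QuadRes (int p) (int u)"
    then obtain y where y: "[y ^ 2 = int u] (mod int p)" by (auto simp: QuadRes_def)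
    define x where "x = nat (y mod int p)"
    have x: "int x = y mod int p" using assms(2) by (simp add: x_def)
    have "[int x * int x = int u] (mod int p)"
      using y unfolding x power2_eq_square by (simp add: cong_def mod_mult_eq)
    hence xx: "[x * x = u] (mod p)" by (metis cong_int_iff of_nat_mult)
    hence "?f x = u" using u(1) by (simp add: cong_def)
    moreover have "x \<in> ?A"
    proof -
      have "x < p" using x assms(2) by (simp add: x_def nat_less_iff)
      moreover have "x \<noteq> 0"
      proof
        assume "x = 0"
        hence "u mod p = 0" using xx by (simp add: cong_def)
        thus False using u(1) by simp
      qed
      ultimately show ?thesis by simp
    qed
    ultimately show False using u(2) by blast
  qed
  thus ?thesis using n0 by (auto simp: Legendre_def)
qed

text \<open>
  This makes \<open>x \<mapsto> (x / k)\<close> a nonprincipal character. Some prime \<open>p\<close> has odd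
  multiplicity in \<open>k\<close>; the Chinese remainder theorem yields a \<open>u\<close> that is a nonresidue
  modulo \<open>p\<close> and congruent to 1 modulo the part of \<open>k\<close> prime to \<open>p\<close>.
\<close>
lemma jacobi_symbol_exists_minus_1:
  assumes "odd k" "\<not> is_square k"
  shows "\<exists>u. jacobi_symbol (int u) k = -1"
proof -
  have k0: "k > 0" using assms(1) by (auto intro: Nat.gr0I)
  obtain p where p: "prime p" "odd (multiplicity p k)"
    using assms(2) k0 by (auto simp: is_nth_power_conv_multiplicity_nat)
  define e where "e = multiplicity p k"
  obtain r where r: "k = p ^ e * r" "\<not> p dvd r"
    using multiplicity_decompose'[of k p] k0 p(1) unfolding e_def by (metis not_prime_unit less_numeral_extra(3))
  have e0: "e > 0" using p(2) e_def by (auto intro: Nat.gr0I)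
  have pk: "p dvd k" using r e0 by (simp add: dvd_power)
  have podd: "odd p" using pk assms(1) by auto
  have p2: "p > 2" using podd prime_ge_2_nat[OF p(1)] by (auto simp: order.strict_iff_order)
  have r0: "r > 0" using r(1) k0 by (auto intro: Nat.gr0I)
  have rodd: "odd r" using r(1) assms(1) by auto
  obtain v where v: "Legendre (int v) (int p) = -1" using exists_quadratic_nonresidue[OF p(1) p2] by blast
  have "coprime p r" using r(2) p(1) by (simp add: prime_imp_coprime)
  then obtain u where u: "[u = v] (mod p)" "[u = 1] (mod r)"
    using binary_chinese_remainder_nat by blast
  have "jacobi_symbol (int u) k = jacobi_symbol (int u) p ^ e * jacobi_symbol (int u) r"
    using r(1) r0 p2 by (simp add: jacobi_symbol_mult_bottom jacobi_symbol_power_bottom)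
  also have "jacobi_symbol (int u) p = -1"
    using v legendre_cong[of "int u" "int v" "int p"] u(1) jacobi_symbol_prime[OF p(1)]
    by (simp add: cong_int_iff)
  also have "jacobi_symbol (int u) r = jacobi_symbol 1 r"
    using u(2) by (intro jacobi_symbol_cong) (metis cong_int_iff of_nat_1)
  also have "\<dots> = 1" using jacobi_symbol_square_top[OF rodd, of 1] by simp
  finally show ?thesis using p(2) e_def by auto
qed

section \<open>Additive characters and Gauss sums\<close>

definition unity_character :: "nat \<Rightarrow> int \<Rightarrow> complex" where
  "unity_character k m = cis (2 * pi * real_of_int m / real k)"

lemma norm_unity_character [simp]: "norm (unity_character k m) = 1"
  by (simp add: unity_character_def)

lemma unity_character_add: "unity_character k (m + n) = unity_character k m * unity_character k n"
  by (simp add: unity_character_def cis_mult add_divide_distrib distrib_left)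

lemma cnj_unity_character: "cnj (unity_character k m) = unity_character k (- m)"
  by (simp add: unity_character_def cis_cnj)

lemma unity_character_diff: "unity_character k (m - n) = unity_character k m * cnj (unity_character k n)"
  using unity_character_add[of k m "-n"] by (simp add: cnj_unity_character)

lemma unity_character_power: "unity_character k m ^ n = unity_character k (int n * m)"
  unfolding unity_character_def by (subst Complex.DeMoivre) (rule arg_cong[where f = cis], simp)

lemma unity_character_eq_1_iff:
  assumes "k > 0"
  shows "unity_character k m = 1 \<longleftrightarrow> int k dvd m"
proof
  assume "int k dvd m"
  then obtain r where "m = int k * r" by blast
  thus "unity_character k m = 1" using assms cis_multiple_2pi[of "of_int r"]
    by (simp add: unity_character_def mult.assoc)
next
  assume "unity_character k m = 1"
  hence "cos (2 * pi * real_of_int m / real k) = 1"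
    unfolding unity_character_def by (metis cis.sel(1) one_complex.sel(1))
  then obtain r :: int where "2 * pi * real_of_int m / real k = r * 2 * pi"
    by (auto simp: cos_one_2pi_int)
  hence "real_of_int m = real_of_int (r * int k)"
    using assms by (simp add: field_simps)
  hence "m = r * int k" by linarith
  thus "int k dvd m" by simp
qed

lemma unity_character_cong:
  assumes "k > 0" "[m = n] (mod int k)"
  shows "unity_character k m = unity_character k n"
proof -
  have "unity_character k (m - n) = 1"
    using assms by (simp add: unity_character_eq_1_iff cong_iff_dvd_diff)
  thus ?thesis using unity_character_add[of k "m - n" n] by simp
qed

lemma unity_character_orthogonality:
  assumes "k > 0"
  shows "(\<Sum>u<k. unity_character k (int u * m)) = (if int k dvd m then of_nat k else 0)"
proof -
  have sum: "(\<Sum>u<k. unity_character k (int u * m)) = (\<Sum>u<k. unity_character k m ^ u)"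
    by (simp add: unity_character_power)
  show ?thesis
  proof (cases "int k dvd m")
    case True
    hence "unity_character k m = 1" using assms by (simp add: unity_character_eq_1_iff)
    thus ?thesis using True unfolding sum by simp
  next
    case False
    hence "unity_character k m \<noteq> 1" using assms by (simp add: unity_character_eq_1_iff)
    moreover have "unity_character k m ^ k = 1"
      using assms by (simp add: unity_character_power unity_character_eq_1_iff)
    ultimately show ?thesis using False unfolding sum by (simp add: geometric_sum)
  qed
qed

text \<open>
  Jordan's inequality: the sine is concave on \<open>[0, \<pi>/2]\<close> and lies above its chord.
\<close>
lemma two_over_pi_le_sin:
  assumes "0 \<le> x" "x \<le> pi / 2"
  shows "2 * x / pi \<le> sin x"
proof -
  have cvx: "convex_on {0..pi/2} (\<lambda>x. - sin x)"
  proof (rule convex_on_realI)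
    show "((\<lambda>x. - sin x) has_real_derivative - cos x) (at x)" for x :: real
      by (auto intro!: derivative_eq_intros)
    show "- cos x \<le> - cos y" if "x \<in> {0..pi/2}" "y \<in> {0..pi/2}" "x \<le> y" for x y :: real
      using that cos_monotone_0_pi_le[of x y] by simp
  qed simp
  define t where "t = 2 * x / pi"
  have t: "0 \<le> t" "t \<le> 1" using assms by (auto simp: t_def field_simps)
  have xt: "x = t * (pi / 2)" by (simp add: t_def)
  have "- sin ((1 - t) *\<^sub>R 0 + t *\<^sub>R (pi / 2)) \<le> (1 - t) * (- sin 0) + t * (- sin (pi / 2))"
    by (rule convex_onD[OF cvx]) (use t in auto)
  also have "(1 - t) *\<^sub>R 0 + t *\<^sub>R (pi / 2) = x" using xt by simp
  finally have "t \<le> sin x" by simp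
  thus ?thesis by (simp only: t_def)
qed

lemma norm_one_minus_cis: "norm (1 - cis x) = 2 * \<bar>sin (x / 2)\<bar>"
proof -
  have "(norm (1 - cis x))\<^sup>2 = (1 - cos x)\<^sup>2 + (sin x)\<^sup>2"
    by (simp add: cmod_power2)
  also have "\<dots> = 2 - 2 * cos x"
    using sin_cos_squared_add[of x] by (simp add: power2_eq_square algebra_simps)
  also have "\<dots> = (2 * \<bar>sin (x / 2)\<bar>)\<^sup>2"
    using cos_double_sin[of "x / 2"] by (simp add: power_mult_distrib)
  finally show ?thesis by (rule power2_eq_imp_eq) auto
qed

text \<open>
  The reciprocal of the distance from \<open>a / k\<close> to the nearest integer is estimated by the sum
  over the two candidates \<open>0\<close> and \<open>1\<close>; the symmetric form in \<open>a\<close> and \<open>k - a\<close> saves a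
  case distinction later.
\<close>
lemma norm_one_minus_unity_character_ge:
  assumes "0 < a" "a < k"
  shows "inverse (norm (1 - unity_character k (int a))) \<le> (real k / 4) * (1 / real a + 1 / real (k - a))"
proof -
  have k: "real k > 0" "real a > 0" "real (k - a) > 0" using assms by auto
  have eq: "norm (1 - unity_character k (int a)) = 2 * \<bar>sin (pi * real a / real k)\<bar>"
    unfolding unity_character_def norm_one_minus_cis by simp
  show ?thesis
  proof (cases "2 * a \<le> k")
    case True
    have "real (2 * a) \<le> real k" using True by (simp only: of_nat_le_iff)
    hence "2 * (pi * real a / real k) / pi \<le> sin (pi * real a / real k)"
      using k by (intro two_over_pi_le_sin) (auto simp: field_simps)
    hence "4 * real a / real k \<le> norm (1 - unity_character k (int a))"
      unfolding eq by simp
    moreover have "4 * real a / real k > 0" using k by simp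
    ultimately have "inverse (norm (1 - unity_character k (int a))) \<le> inverse (4 * real a / real k)"
      by (rule le_imp_inverse_le)
    also have "\<dots> = (real k / 4) * (1 / real a)" by (simp add: field_simps)
    also have "\<dots> \<le> (real k / 4) * (1 / real a + 1 / real (k - a))"
      using k by (intro mult_left_mono) auto
    finally show ?thesis .
  next
    case False
    have ka: "real (k - a) = real k - real a" using assms by simp
    have "real k \<le> real (2 * a)" using False by (simp only: of_nat_le_iff)
    hence "2 * (pi * real (k - a) / real k) / pi \<le> sin (pi * real (k - a) / real k)"
      using k unfolding ka by (intro two_over_pi_le_sin) (auto simp: field_simps)
    also have "pi * real (k - a) / real k = pi - pi * real a / real k"
      using k unfolding ka by (simp add: field_simps)
    also have "sin (pi - pi * real a / real k) = sin (pi * real a / real k)" by simp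
    finally have "2 * (pi - pi * real a / real k) / pi \<le> sin (pi * real a / real k)" .
    moreover have "pi * real (k - a) / real k = pi - pi * real a / real k"
      using k unfolding ka by (simp add: field_simps)
    ultimately have "2 * (pi * real (k - a) / real k) / pi \<le> sin (pi * real a / real k)"
      by (simp only:)
    moreover have "2 * (pi * real (k - a) / real k) / pi = 2 * real (k - a) / real k" by simp
    ultimately have "4 * real (k - a) / real k \<le> norm (1 - unity_character k (int a))"
      unfolding eq by linarith
    moreover have "4 * real (k - a) / real k > 0" using k by simp
    ultimately have "inverse (norm (1 - unity_character k (int a))) \<le> inverse (4 * real (k - a) / real k)"
      by (rule le_imp_inverse_le)
    also have "\<dots> = (real k / 4) * (1 / real (k - a))" by (simp add: field_simps)
    also have "\<dots> \<le> (real k / 4) * (1 / real a + 1 / real (k - a))"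
      using k by (intro mult_left_mono) auto
    finally show ?thesis .
  qed
qed

definition gauss_sum :: "nat \<Rightarrow> nat \<Rightarrow> complex" where
  "gauss_sum k a = (\<Sum>x<k. of_int (jacobi_symbol (int x) k) * unity_character k (int a * int x))"

lemma bij_betw_mult_mod:
  assumes "coprime u k" "k > (0::nat)"
  shows "bij_betw (\<lambda>x. (u * x) mod k) {..<k} {..<k}"
proof -
  have inj: "inj_on (\<lambda>x. (u * x) mod k) {..<k}"
  proof (rule inj_onI)
    fix x y assume xy: "x \<in> {..<k}" "y \<in> {..<k}" "(u * x) mod k = (u * y) mod k"
    hence "[u * x = u * y] (mod k)" by (simp add: cong_def)
    hence "[x = y] (mod k)" using assms(1) cong_mult_lcancel_nat by blast
    thus "x = y" using xy by (simp add: cong_def)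
  qed
  have "(\<lambda>x. (u * x) mod k) ` {..<k} \<subseteq> {..<k}" using assms(2) by auto
  hence "(\<lambda>x. (u * x) mod k) ` {..<k} = {..<k}"
    using endo_inj_surj[OF _ _ inj] by simp
  thus ?thesis using inj by (simp add: bij_betw_def)
qed

text \<open>
  Multiplication by the unit \<open>u\<close> permutes the residues modulo \<open>k\<close>.
\<close>
lemma gauss_sum_twist:
  assumes "odd k" "coprime u k"
  shows "gauss_sum k a = of_int (jacobi_symbol (int u) k) * gauss_sum k (u * a)"
proof -
  have k: "k > 0" using assms(1) by (auto intro: Nat.gr0I)
  define F where "F = (\<lambda>x. of_int (jacobi_symbol (int x) k) * unity_character k (int a * int x))"
  have "gauss_sum k a = (\<Sum>x<k. F ((u * x) mod k))"
    unfolding gauss_sum_def F_def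
    by (rule sum.reindex_bij_betw[OF bij_betw_mult_mod[OF assms(2) k], symmetric])
  also have "\<dots> = (\<Sum>x<k. of_int (jacobi_symbol (int u) k) *
      (of_int (jacobi_symbol (int x) k) * unity_character k (int (u * a) * int x)))"
  proof (rule sum.cong[OF refl])
    fix x
    have c: "[int ((u * x) mod k) = int u * int x] (mod int k)"
      by (simp add: cong_def zmod_int)
    have "jacobi_symbol (int ((u * x) mod k)) k = jacobi_symbol (int u) k * jacobi_symbol (int x) k"
      using jacobi_symbol_cong[OF c] jacobi_symbol_mult_top[OF assms(1)] by simp
    moreover have "unity_character k (int a * int ((u * x) mod k)) = unity_character k (int (u * a) * int x)"
    proof (rule unity_character_cong[OF k])
      have "[int a * int ((u * x) mod k) = int a * (int u * int x)] (mod int k)"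
        by (intro cong_mult cong_refl c)
      thus "[int a * int ((u * x) mod k) = int (u * a) * int x] (mod int k)"
        by (simp add: mult_ac)
    qed
    ultimately show "F ((u * x) mod k) = of_int (jacobi_symbol (int u) k) *
      (of_int (jacobi_symbol (int x) k) * unity_character k (int (u * a) * int x))"
      by (simp add: F_def mult_ac)
  qed
  also have "\<dots> = of_int (jacobi_symbol (int u) k) * gauss_sum k (u * a)"
    by (simp add: gauss_sum_def sum_distrib_left)
  finally show ?thesis .
qed

text \<open>
  Twisting by a \<open>u\<close> with \<open>(u / k) = -1\<close> shows that this sum equals its own negative.
\<close>
lemma gauss_sum_0:
  assumes "odd k" "\<not> is_square k"
  shows "gauss_sum k 0 = 0"
proof -
  have k: "k > 0" using assms(1) by (auto intro: Nat.gr0I)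
  obtain u where u: "jacobi_symbol (int u) k = -1"
    using jacobi_symbol_exists_minus_1[OF assms] by blast
  hence "coprime u k" using jacobi_symbol_eq_0_iff[OF k, of "int u"] by (simp add: coprime_int_iff)
  from gauss_sum_twist[OF assms(1) this, of 0] u show ?thesis by (simp add: eq_neg_iff_add_eq_0)
qed

lemma norm_jacobi_le_1: "norm (of_int (jacobi_symbol n m) :: complex) \<le> 1"
  using jacobi_symbol_values[of n m] by auto

lemma abs_jacobi_le_1: "\<bar>real_of_int (jacobi_symbol n m)\<bar> \<le> 1"
  using jacobi_symbol_values[of n m] by auto

lemma norm_jacobi_coprime:
  assumes "k > 0" "coprime u k"
  shows "norm (of_int (jacobi_symbol (int u) k) :: complex) = 1"
proof -
  have "jacobi_symbol (int u) k \<noteq> 0"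
    using assms jacobi_symbol_eq_0_iff[OF assms(1), of "int u"] by (simp add: coprime_int_iff)
  thus ?thesis using jacobi_symbol_values[of "int u" k] by auto
qed

text \<open>
  With \<open>g = gcd a k\<close>, the congruence determines \<open>y\<close> modulo \<open>k div g\<close>.
\<close>
lemma card_cong_mult_le:
  assumes "k > 0"
  shows "card {y. y < k \<and> [a * y = a * x] (mod k)} \<le> gcd a k"
proof -
  define g where "g = gcd a k"
  have g: "g > 0" "g dvd k" "g dvd a" using assms by (auto simp: g_def)
  define k' where "k' = k div g"
  have kk: "k = g * k'" using g by (simp add: k'_def)
  have k'0: "k' > 0" using kk assms by (auto intro: Nat.gr0I)
  have "{y. y < k \<and> [a * y = a * x] (mod k)} \<subseteq> (\<lambda>j. x mod k' + j * k') ` {..<g}"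
  proof
    fix y assume "y \<in> {y. y < k \<and> [a * y = a * x] (mod k)}"
    hence y: "y < k" "[a * y = a * x] (mod k)" by auto
    obtain a' where a': "a = g * a'" using g(3) by blast
    have "[g * (a' * y) = g * (a' * x)] (mod (g * k'))" using y(2) unfolding a' kk by (simp add: mult_ac)
    hence "[a' * y = a' * x] (mod k')" using g(1) by (simp add: cong_def)
    moreover have "coprime a' k'"
    proof -
      have "g * gcd a' k' = gcd (g * a') (g * k')" by (simp add: gcd_mult_left)
      also have "\<dots> = g" using a' kk g_def by metis
      finally have "g * gcd a' k' = g * 1" by simp
      hence "gcd a' k' = 1" using g(1) by (subst (asm) mult_cancel1) simp
      thus ?thesis by (simp only: coprime_iff_gcd_eq_1)
    qed
    ultimately have "[y = x] (mod k')" using cong_mult_lcancel_nat by blast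
    hence "y mod k' = x mod k'" by (simp add: cong_def)
    hence "y = x mod k' + (y div k') * k'" using mod_div_mult_eq[of y k'] by simp
    moreover have "y div k' < g" using y(1) kk by (simp add: less_mult_imp_div_less)
    ultimately show "y \<in> (\<lambda>j. x mod k' + j * k') ` {..<g}" by blast
  qed
  hence "card {y. y < k \<and> [a * y = a * x] (mod k)} \<le> card ((\<lambda>j. x mod k' + j * k') ` {..<g})"
    by (intro card_mono) auto
  also have "\<dots> \<le> g" using card_image_le[of "{..<g}"] by (metis card_lessThan finite_lessThan)
  finally show ?thesis by (simp add: g_def)
qed

text \<open>
  The character need not be primitive, so its Gauss sums cannot be evaluated exactly. By
  \<open>gauss_sum_twist\<close> the norm of \<open>gauss_sum k (u * a)\<close> is the same for all units \<open>u\<close>.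
  Summing its square over the units and enlarging the range to all residues \<open>u\<close> makes
  orthogonality applicable: what remains is \<open>k\<close> times a signed count of the pairs of units
  \<open>x\<close>, \<open>y\<close> with \<open>a * x\<close> congruent to \<open>a * y\<close>, and each \<open>x\<close> admits at most
  \<open>gcd a k\<close> values of \<open>y\<close>. Since the number of units cancels, the bound for primitive
  characters deteriorates only by the square root of \<open>gcd a k\<close>.
\<close>
lemma norm_gauss_sum_le:
  assumes "odd k"
  shows "norm (gauss_sum k a) \<le> sqrt (real k * real (gcd a k))"
proof -
  have k: "k > 0" using assms(1) by (auto intro: Nat.gr0I)
  define U where "U = {u. u < k \<and> coprime u k}"
  have finU: "finite U" by (simp add: U_def)
  have U0: "card U > 0"
  proof -
    \<comment> \<open>for k = 1 the only residue is 0, and it counts as a unit\<close>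
    have "1 mod k \<in> U" using k by (cases "k = 1") (auto simp: U_def)
    thus ?thesis using finU by (auto simp: card_gt_0_iff)
  qed
  let ?J = "\<lambda>x. of_int (jacobi_symbol (int x) k) :: complex"
  have "real (card U) * (norm (gauss_sum k a))\<^sup>2 = (\<Sum>u\<in>U. (norm (gauss_sum k (u * a)))\<^sup>2)"
  proof -
    have "norm (gauss_sum k (u * a)) = norm (gauss_sum k a)" if "u \<in> U" for u
      using gauss_sum_twist[OF assms, of u a] norm_jacobi_coprime[OF k, of u] that
      by (simp add: U_def norm_mult)
    thus ?thesis by simp
  qed
  also have "\<dots> \<le> (\<Sum>u<k. (norm (gauss_sum k (u * a)))\<^sup>2)"
    by (intro sum_mono2) (auto simp: U_def)
  also have "\<dots> \<le> real k * (real (card U) * real (gcd a k))"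
  proof -
    have "complex_of_real (\<Sum>u<k. (norm (gauss_sum k (u * a)))\<^sup>2) =
        (\<Sum>u<k. gauss_sum k (u * a) * cnj (gauss_sum k (u * a)))"
      by (simp only: of_real_sum complex_norm_square)
    also have "\<dots> = (\<Sum>u<k. \<Sum>x<k. \<Sum>y<k. ?J x * ?J y * unity_character k (int u * (int a * int x - int a * int y)))"
    proof (rule sum.cong[OF refl])
      fix u
      have "unity_character k (int (u * a) * int x) * cnj (unity_character k (int (u * a) * int y))
        = unity_character k (int u * (int a * int x - int a * int y))" for x y
        unfolding unity_character_diff[symmetric] by (simp add: algebra_simps)
      thus "gauss_sum k (u * a) * cnj (gauss_sum k (u * a)) =
         (\<Sum>x<k. \<Sum>y<k. ?J x * ?J y * unity_character k (int u * (int a * int x - int a * int y)))"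
        unfolding gauss_sum_def cnj_sum sum_product
        by (intro sum.cong refl) (simp add: mult_ac)
    qed
    also have "\<dots> = (\<Sum>x<k. \<Sum>y<k. \<Sum>u<k. ?J x * ?J y * unity_character k (int u * (int a * int x - int a * int y)))"
      by (rule trans[OF sum.swap sum.cong[OF refl sum.swap]])
    also have "\<dots> = (\<Sum>x<k. \<Sum>y<k. ?J x * ?J y * (if [a * y = a * x] (mod k) then of_nat k else 0))"
    proof (intro sum.cong refl)
      fix x y
      have "int k dvd int a * int x - int a * int y \<longleftrightarrow> [int (a * x) = int (a * y)] (mod int k)"
        by (simp add: cong_iff_dvd_diff)
      also have "\<dots> \<longleftrightarrow> [a * y = a * x] (mod k)"
        by (simp only: cong_int_iff cong_sym_eq)
      finally have iff: "int k dvd int a * int x - int a * int y \<longleftrightarrow> [a * y = a * x] (mod k)" .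
      show "(\<Sum>u<k. ?J x * ?J y * unity_character k (int u * (int a * int x - int a * int y))) =
        ?J x * ?J y * (if [a * y = a * x] (mod k) then of_nat k else 0)"
        unfolding sum_distrib_left[symmetric] unity_character_orthogonality[OF k] iff ..
    qed
    finally have eq: "complex_of_real (\<Sum>u<k. (norm (gauss_sum k (u * a)))\<^sup>2) =
       (\<Sum>x<k. \<Sum>y<k. ?J x * ?J y * (if [a * y = a * x] (mod k) then of_nat k else 0))" .
    have "(\<Sum>u<k. (norm (gauss_sum k (u * a)))\<^sup>2) = norm (complex_of_real (\<Sum>u<k. (norm (gauss_sum k (u * a)))\<^sup>2))"
      by (simp only: norm_of_real abs_of_nonneg[OF sum_nonneg] zero_le_power2)
    also have "\<dots> \<le> (\<Sum>x<k. \<Sum>y<k. (if coprime x k then 1 else 0) * (if [a * y = a * x] (mod k) then real k else 0))"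
      unfolding eq
    proof (intro sum_norm_le)
      fix x y
      have 1: "norm (?J x) \<le> (if coprime x k then 1 else 0)"
        using norm_jacobi_le_1[of "int x" k] jacobi_symbol_eq_0_iff[OF k, of "int x"]
        by (simp add: coprime_int_iff)
      have "norm (?J x * ?J y) \<le> (if coprime x k then 1 else 0) * 1"
        unfolding norm_mult by (intro mult_mono 1 norm_jacobi_le_1) auto
      thus "norm (?J x * ?J y * (if [a * y = a * x] (mod k) then of_nat k else 0)) \<le>
        (if coprime x k then 1 else 0) * (if [a * y = a * x] (mod k) then real k else 0)"
        unfolding norm_mult by (simp add: mult_right_mono)
    qed
    also have "\<dots> = (\<Sum>x<k. (if coprime x k then 1 else 0) * (real k * real (card {y. y < k \<and> [a * y = a * x] (mod k)})))"
    proof (intro sum.cong refl)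
      fix x
      have "(\<Sum>y<k. if [a * y = a * x] (mod k) then real k else 0) = (\<Sum>y\<in>{y\<in>{..<k}. [a * y = a * x] (mod k)}. real k)"
        by (intro sum.inter_filter[symmetric]) simp
      also have "\<dots> = real k * real (card {y. y < k \<and> [a * y = a * x] (mod k)})"
        by simp
      finally show "(\<Sum>y<k. (if coprime x k then 1 else 0) * (if [a * y = a * x] (mod k) then real k else 0)) =
        (if coprime x k then 1 else 0) * (real k * real (card {y. y < k \<and> [a * y = a * x] (mod k)}))"
        by (simp only: sum_distrib_left[symmetric])
    qed
    also have "\<dots> \<le> (\<Sum>x<k. (if coprime x k then 1 else 0) * (real k * real (gcd a k)))"
      by (intro sum_mono mult_left_mono) (use card_cong_mult_le[OF k] in auto)
    also have "\<dots> = (\<Sum>x<k. if coprime x k then real k * real (gcd a k) else 0)"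
      by (intro sum.cong) auto
    also have "\<dots> = (\<Sum>x\<in>{x\<in>{..<k}. coprime x k}. real k * real (gcd a k))"
      by (intro sum.inter_filter[symmetric]) simp
    also have "\<dots> = real k * (real (card U) * real (gcd a k))"
      by (simp add: U_def)
    finally show ?thesis .
  qed
  finally have "real (card U) * (norm (gauss_sum k a))\<^sup>2 \<le> real (card U) * (real k * real (gcd a k))"
    by (simp add: mult_ac)
  hence "(norm (gauss_sum k a))\<^sup>2 \<le> real k * real (gcd a k)"
    using U0 by simp
  thus ?thesis by (rule real_le_rsqrt)
qed

section \<open>The Polya--Vinogradov inequality\<close>

text \<open>
  The divisor sum of order \<open>-1/2\<close>. It measures the loss from imprimitive characters, and it
  is bounded on average, so that no power of a logarithm is lost after summation over the moduli.
\<close>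
definition sigma_half :: "nat \<Rightarrow> real" where
  "sigma_half k = (\<Sum>g | g dvd k. 1 / sqrt (real g))"

lemma sigma_half_nonneg: "sigma_half k \<ge> 0"
  by (auto simp: sigma_half_def intro: sum_nonneg)

text \<open>
  Each term is at most the sum of \<open>sqrt g / a\<close> over the common divisors \<open>g\<close> of \<open>a\<close> and
  \<open>k\<close>; then \<open>a = g * b\<close> gives a harmonic sum over \<open>b\<close> for every \<open>g\<close>.
\<close>
lemma sum_sqrt_gcd_le:
  assumes "k > 0"
  shows "(\<Sum>a\<in>{1..<k}. sqrt (real (gcd a k)) / real a) \<le> sigma_half k * harm k"
proof -
  have fin: "finite {g. g dvd k}" using assms by simp
  have "(\<Sum>a\<in>{1..<k}. sqrt (real (gcd a k)) / real a)
      \<le> (\<Sum>a\<in>{1..<k}. \<Sum>g | g dvd k. if g dvd a then sqrt (real g) / real a else 0)"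
  proof (rule sum_mono)
    fix a
    have "sqrt (real (gcd a k)) / real a = (\<Sum>g\<in>{gcd a k}. if g dvd a then sqrt (real g) / real a else 0)"
      by simp
    also have "\<dots> \<le> (\<Sum>g | g dvd k. if g dvd a then sqrt (real g) / real a else 0)"
      by (rule sum_mono2[OF fin]) auto
    finally show "sqrt (real (gcd a k)) / real a
        \<le> (\<Sum>g | g dvd k. if g dvd a then sqrt (real g) / real a else 0)" .
  qed
  also have "\<dots> = (\<Sum>g | g dvd k. \<Sum>a\<in>{1..<k}. if g dvd a then sqrt (real g) / real a else 0)"
    by (rule sum.swap)
  also have "\<dots> \<le> (\<Sum>g | g dvd k. 1 / sqrt (real g) * harm k)"
  proof (rule sum_mono)
    fix g assume "g \<in> {g. g dvd k}"
    hence g0: "g > 0" using assms by (auto intro: Nat.gr0I)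
    have "(\<Sum>a\<in>{1..<k}. if g dvd a then sqrt (real g) / real a else 0)
        = (\<Sum>a\<in>{a\<in>{1..<k}. g dvd a}. sqrt (real g) / real a)"
      by (rule sum.inter_filter[symmetric]) simp
    also have "\<dots> \<le> (\<Sum>a\<in>(\<lambda>b. g * b) ` {1..k}. sqrt (real g) / real a)"
    proof (rule sum_mono2)
      show "{a \<in> {1..<k}. g dvd a} \<subseteq> (*) g ` {1..k}"
      proof
        fix a assume a: "a \<in> {a \<in> {1..<k}. g dvd a}"
        then obtain b where b: "a = g * b" by blast
        have "b \<ge> 1" using a b by (cases b) auto
        moreover have "b \<le> k"
        proof -
          have "1 * b \<le> g * b" using g0 by (intro mult_right_mono) auto
          moreover have "g * b < k" using a unfolding b by simp
          ultimately show ?thesis by linarith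
        qed
        ultimately show "a \<in> (*) g ` {1..k}" using b by auto
      qed
    qed auto
    also have "\<dots> = (\<Sum>b\<in>{1..k}. sqrt (real g) / real (g * b))"
      by (subst sum.reindex) (use g0 in \<open>auto simp: inj_on_def\<close>)
    also have "\<dots> = (\<Sum>b\<in>{1..k}. 1 / sqrt (real g) * inverse (real b))"
    proof (rule sum.cong[OF refl])
      fix b
      define s where "s = sqrt (real g)"
      have s: "s > 0" "real g = s * s" using g0 by (simp_all add: s_def)
      have "s / (s * s * real b) = 1 / s * inverse (real b)" using s(1) by (simp add: divide_inverse)
      thus "sqrt (real g) / real (g * b) = 1 / sqrt (real g) * inverse (real b)"
        unfolding of_nat_mult s(2)[symmetric] unfolding s_def by (simp only: s(2)[unfolded s_def, symmetric])
    qed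
    also have "\<dots> = 1 / sqrt (real g) * harm k"
      unfolding harm_def sum_distrib_left ..
    finally show "(\<Sum>a\<in>{1..<k}. if g dvd a then sqrt (real g) / real a else 0) \<le> 1 / sqrt (real g) * harm k" .
  qed
  also have "\<dots> = sigma_half k * harm k" by (simp add: sigma_half_def sum_distrib_right)
  finally show ?thesis .
qed

lemma jacobi_fourier_inversion:
  assumes "k > 0"
  shows "of_nat k * (of_int (jacobi_symbol (int y) k) :: complex) =
     (\<Sum>a<k. gauss_sum k a * cnj (unity_character k (int a * int y)))"
proof -
  have "(\<Sum>a<k. gauss_sum k a * cnj (unity_character k (int a * int y))) =
     (\<Sum>a<k. \<Sum>x<k. of_int (jacobi_symbol (int x) k) * unity_character k (int a * (int x - int y)))"
    unfolding gauss_sum_def sum_distrib_right right_diff_distrib unity_character_diff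
    by (simp only: mult.assoc)
  also have "\<dots> = (\<Sum>x<k. of_int (jacobi_symbol (int x) k) * (\<Sum>a<k. unity_character k (int a * (int x - int y))))"
    by (subst sum.swap) (simp only: sum_distrib_left)
  also have "\<dots> = (\<Sum>x<k. if x = y mod k then of_int (jacobi_symbol (int x) k) * of_nat k else 0)"
  proof (rule sum.cong[OF refl])
    fix x assume x: "x \<in> {..<k}"
    have "int k dvd int x - int y \<longleftrightarrow> [x = y] (mod k)"
      by (simp only: cong_iff_dvd_diff[symmetric] cong_int_iff)
    also have "\<dots> \<longleftrightarrow> x = y mod k" using x by (simp add: cong_def)
    finally show "of_int (jacobi_symbol (int x) k) * (\<Sum>a<k. unity_character k (int a * (int x - int y)))
      = (if x = y mod k then of_int (jacobi_symbol (int x) k) * of_nat k else 0)"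
      unfolding unity_character_orthogonality[OF assms] by simp
  qed
  also have "\<dots> = of_int (jacobi_symbol (int (y mod k)) k) * of_nat k"
    using assms by simp
  also have "jacobi_symbol (int (y mod k)) k = jacobi_symbol (int y) k"
    by (rule jacobi_symbol_cong) (simp add: cong_def zmod_int)
  finally show ?thesis by simp
qed

lemma norm_sum_unity_character_le:
  assumes "0 < a" "a < k"
  shows "norm (\<Sum>j<H. unity_character k (int a * int (j + c))) \<le> 2 * inverse (norm (1 - unity_character k (int a)))"
proof -
  let ?z = "unity_character k (int a)"
  have z1: "?z \<noteq> 1"
  proof
    assume "?z = 1"
    hence "int k dvd int a" using assms by (simp add: unity_character_eq_1_iff)
    thus False using assms by (auto dest: dvd_imp_le)
  qed
  have "unity_character k (int a * int (j + c)) = unity_character k (int a * int c) * ?z ^ j" for j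
    by (simp add: unity_character_power unity_character_add[symmetric] algebra_simps)
  hence "(\<Sum>j<H. unity_character k (int a * int (j + c))) = unity_character k (int a * int c) * ((?z ^ H - 1) / (?z - 1))"
    using z1 by (simp add: sum_distrib_left[symmetric] geometric_sum)
  hence "norm (\<Sum>j<H. unity_character k (int a * int (j + c))) = norm (?z ^ H - 1) / norm (?z - 1)"
    by (simp add: norm_mult norm_divide)
  also have "\<dots> \<le> 2 / norm (?z - 1)"
  proof (rule divide_right_mono)
    show "norm (?z ^ H - 1) \<le> 2"
      using norm_triangle_ineq4[of "?z ^ H" 1] by (simp add: norm_power)
  qed simp
  also have "\<dots> = 2 * inverse (norm (1 - ?z))" by (simp add: norm_minus_commute divide_inverse)
  finally show ?thesis .
qed

text \<open>
  Fourier inversion writes the symbol as a combination of additive characters. The trivial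
  frequency drops out because \<open>k\<close> is not a square, and for the others the sum over the interval is
  geometric.
\<close>
lemma polya_vinogradov_interval:
  assumes "odd k" "\<not> is_square k"
  shows "\<bar>\<Sum>j<H. real_of_int (jacobi_symbol (int (j + c)) k)\<bar> \<le> sqrt (real k) * sigma_half k * harm k"
proof -
  have k: "k > 0" using assms(1) by (auto intro: Nat.gr0I)
  let ?S = "\<Sum>j<H. real_of_int (jacobi_symbol (int (j + c)) k)"
  let ?E = "\<lambda>a. \<Sum>j<H. unity_character k (int a * int (j + c))"
  have "complex_of_real (real k * ?S) = (\<Sum>j<H. of_nat k * of_int (jacobi_symbol (int (j + c)) k))"
    by (simp add: sum_distrib_left)
  also have "\<dots> = (\<Sum>j<H. \<Sum>a<k. gauss_sum k a * cnj (unity_character k (int a * int (j + c))))"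
    by (simp only: jacobi_fourier_inversion[OF k])
  also have "\<dots> = (\<Sum>a<k. gauss_sum k a * cnj (?E a))"
    unfolding cnj_sum sum_distrib_left by (rule sum.swap)
  also have "\<dots> = (\<Sum>a\<in>{1..<k}. gauss_sum k a * cnj (?E a))"
  proof (rule sum.mono_neutral_right)
    show "\<forall>i\<in>{..<k} - {1..<k}. gauss_sum k i * cnj (?E i) = 0"
    proof
      fix i assume "i \<in> {..<k} - {1..<k}"
      hence "i = 0" by auto
      thus "gauss_sum k i * cnj (?E i) = 0" using gauss_sum_0[OF assms] by simp
    qed
  qed auto
  finally have eq: "complex_of_real (real k * ?S) = (\<Sum>a\<in>{1..<k}. gauss_sum k a * cnj (?E a))" .
  have "real k * \<bar>?S\<bar> = norm (complex_of_real (real k * ?S))"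
    by (simp only: norm_of_real abs_mult abs_of_nat)
  also have "\<dots> \<le> (\<Sum>a\<in>{1..<k}. (real k * sqrt (real k) / 2) * (sqrt (real (gcd a k)) / real a + sqrt (real (gcd a k)) / real (k - a)))"
    unfolding eq
  proof (rule sum_norm_le)
    fix a assume a: "a \<in> {1..<k}"
    have "norm (gauss_sum k a * cnj (?E a)) \<le> sqrt (real k * real (gcd a k)) * (2 * inverse (norm (1 - unity_character k (int a))))"
      unfolding norm_mult complex_mod_cnj
      by (intro mult_mono norm_gauss_sum_le[OF assms(1)] norm_sum_unity_character_le) (use a in auto)
    also have "\<dots> \<le> sqrt (real k * real (gcd a k)) * (2 * ((real k / 4) * (1 / real a + 1 / real (k - a))))"
      by (intro mult_left_mono norm_one_minus_unity_character_ge) (use a in auto)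
    also have "\<dots> = (real k * sqrt (real k) / 2) * (sqrt (real (gcd a k)) / real a + sqrt (real (gcd a k)) / real (k - a))"
      by (simp add: real_sqrt_mult algebra_simps)
    finally show "norm (gauss_sum k a * cnj (?E a)) \<le> (real k * sqrt (real k) / 2) * (sqrt (real (gcd a k)) / real a + sqrt (real (gcd a k)) / real (k - a))" .
  qed
  also have "\<dots> = (real k * sqrt (real k) / 2) * ((\<Sum>a\<in>{1..<k}. sqrt (real (gcd a k)) / real a) + (\<Sum>a\<in>{1..<k}. sqrt (real (gcd a k)) / real (k - a)))"
    by (simp only: sum_distrib_left[symmetric] sum.distrib)
  also have "(\<Sum>a\<in>{1..<k}. sqrt (real (gcd a k)) / real (k - a)) = (\<Sum>a\<in>{1..<k}. sqrt (real (gcd a k)) / real a)"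
    by (rule sum.reindex_bij_witness[where i = "\<lambda>a. k - a" and j = "\<lambda>a. k - a"]) (auto simp: gcd_diff2_nat)
  also have "(real k * sqrt (real k) / 2) * ((\<Sum>a\<in>{1..<k}. sqrt (real (gcd a k)) / real a) + (\<Sum>a\<in>{1..<k}. sqrt (real (gcd a k)) / real a))
     = (real k * sqrt (real k)) * (\<Sum>a\<in>{1..<k}. sqrt (real (gcd a k)) / real a)" by simp
  also have "\<dots> \<le> (real k * sqrt (real k)) * (sigma_half k * harm k)"
    by (intro mult_left_mono sum_sqrt_gcd_le k) auto
  finally have "real k * \<bar>?S\<bar> \<le> real k * (sqrt (real k) * sigma_half k * harm k)"
    by (simp add: mult_ac)
  thus ?thesis using k by simp
qed

text \<open>
  On a residue class modulo 4 the reciprocity sign is constant, so \<open>(k / m)\<close> may be replaced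
  by \<open>(m / k)\<close>. With \<open>4 * c\<close> congruent to \<open>r\<close> modulo \<open>k\<close>, the symbols
  \<open>((4 * j + r) / k)\<close> and \<open>((j + c) / k)\<close> agree, as \<open>4\<close> is a square; this leaves a sum
  over an interval.
\<close>
lemma polya_vinogradov_residue_class:
  assumes "odd k" "\<not> is_square k" "r = 1 \<or> r = 3"
  shows "\<bar>\<Sum>m | m \<in> {1..Y} \<and> m mod 4 = r. real_of_int (jacobi_symbol (int k) m)\<bar>
    \<le> sqrt (real k) * sigma_half k * harm k"
proof -
  have k: "k > 0" using assms(1) by (auto intro: Nat.gr0I)
  have cop: "coprime 4 k" using assms(1) coprime_power_left_iff[of 2 2 k] by (simp add: coprime_left_2_iff_odd)
  obtain c where c: "[4 * c = r] (mod k)"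
  proof -
    have "\<exists>c. [4 * c = r] (mod k)" using cop by (rule cong_solve)
    thus ?thesis using that by blast
  qed
  have r: "1 \<le> r" "r < 4" using assms(3) by auto
  define H where "H = (Y + 4 - r) div 4"
  have H: "j < H \<longleftrightarrow> 4 * j + r \<le> Y" for j
  proof -
    have "j < H \<longleftrightarrow> Suc j * 4 \<le> Y + 4 - r"
      unfolding H_def Suc_le_eq[symmetric] by (rule less_eq_div_iff_mult_less_eq) simp
    also have "\<dots> \<longleftrightarrow> 4 * j + r \<le> Y" using r by auto
    finally show ?thesis .
  qed
  have set: "{m. m \<in> {1..Y} \<and> m mod 4 = r} = (\<lambda>j. 4 * j + r) ` {..<H}"
  proof
    show "{m. m \<in> {1..Y} \<and> m mod 4 = r} \<subseteq> (\<lambda>j. 4 * j + r) ` {..<H}"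
    proof
      fix m assume m: "m \<in> {m. m \<in> {1..Y} \<and> m mod 4 = r}"
      have 1: "m = 4 * (m div 4) + r" using m mult_div_mod_eq[of 4 m] by simp
      have "m \<le> Y" using m by simp
      hence "m div 4 < H" using H[of "m div 4"] 1 by linarith
      thus "m \<in> (\<lambda>j. 4 * j + r) ` {..<H}" using 1 by blast
    qed
    show "(\<lambda>j. 4 * j + r) ` {..<H} \<subseteq> {m. m \<in> {1..Y} \<and> m mod 4 = r}"
    proof
      fix m assume "m \<in> (\<lambda>j. 4 * j + r) ` {..<H}"
      then obtain j where j: "j < H" "m = 4 * j + r" by blast
      have "m \<le> Y" using H[of j] j by simp
      moreover have "m mod 4 = r" unfolding j(2) using r by simp
      ultimately show "m \<in> {m. m \<in> {1..Y} \<and> m mod 4 = r}" using r j(2) by simp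
    qed
  qed
  define s where "s = reciprocity_sign r k"
  have J: "jacobi_symbol (int k) (4 * j + r) = s * jacobi_symbol (int (j + c)) k" for j
  proof -
    have odd: "odd (4 * j + r)" using assms(3) by auto
    have sgn: "reciprocity_sign (4 * j + r) k = s"
      using assms(3) by (auto simp: reciprocity_sign_def s_def)
    have "[4 * j + r = 4 * (j + c)] (mod k)"
      using cong_add[OF cong_refl[of "4 * j" k] cong_sym[OF c]] by (simp add: algebra_simps)
    hence "[int (4 * j + r) = int (4 * (j + c))] (mod int k)" by (simp only: cong_int_iff)
    also have "int (4 * (j + c)) = 2 * 2 * int (j + c)" by simp
    finally have "jacobi_symbol (int (4 * j + r)) k = jacobi_symbol (2 * 2) k * jacobi_symbol (int (j + c)) k"
      by (simp only: jacobi_symbol_cong jacobi_symbol_mult_top[OF assms(1)])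
    also have "jacobi_symbol (2 * 2) k = 1"
      using assms(1) by (intro jacobi_symbol_square_top) (simp_all add: coprime_left_2_iff_odd)
    finally show ?thesis using jacobi_reciprocity[OF odd assms(1)] sgn by simp
  qed
  have "(\<Sum>m | m \<in> {1..Y} \<and> m mod 4 = r. real_of_int (jacobi_symbol (int k) m))
      = (\<Sum>j<H. real_of_int (jacobi_symbol (int k) (4 * j + r)))"
    unfolding set by (subst sum.reindex) (auto simp: inj_on_def)
  also have "\<dots> = of_int s * (\<Sum>j<H. real_of_int (jacobi_symbol (int (j + c)) k))"
    unfolding J by (simp add: sum_distrib_left)
  finally have "\<bar>\<Sum>m | m \<in> {1..Y} \<and> m mod 4 = r. real_of_int (jacobi_symbol (int k) m)\<bar>
     = \<bar>\<Sum>j<H. real_of_int (jacobi_symbol (int (j + c)) k)\<bar>"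
    by (simp add: abs_mult s_def reciprocity_sign_def)
  thus ?thesis using polya_vinogradov_interval[OF assms(1,2), of c H] by simp
qed

lemma polya_vinogradov_odd:
  assumes "odd k" "\<not> is_square k"
  shows "\<bar>\<Sum>m | m \<in> {1..Y} \<and> odd m. real_of_int (jacobi_symbol (int k) m)\<bar>
    \<le> 2 * sqrt (real k) * sigma_half k * harm k"
proof -
  let ?F = "\<lambda>m. real_of_int (jacobi_symbol (int k) m)"
  have "odd m \<longleftrightarrow> m mod 4 = 1 \<or> m mod 4 = 3" for m :: nat by presburger
  hence "{m. m \<in> {1..Y} \<and> odd m} = {m. m \<in> {1..Y} \<and> m mod 4 = 1} \<union> {m. m \<in> {1..Y} \<and> m mod 4 = 3}"
    by blast
  moreover have "{m. m \<in> {1..Y} \<and> m mod 4 = 1} \<inter> {m. m \<in> {1..Y} \<and> m mod 4 = 3} = {}" by force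
  moreover have "finite {m. m \<in> {1..Y} \<and> m mod 4 = r}" for r by simp
  ultimately have "(\<Sum>m | m \<in> {1..Y} \<and> odd m. ?F m) = (\<Sum>m | m \<in> {1..Y} \<and> m mod 4 = 1. ?F m) + (\<Sum>m | m \<in> {1..Y} \<and> m mod 4 = 3. ?F m)"
    by (simp only: sum.union_disjoint)
  thus ?thesis
    using polya_vinogradov_residue_class[OF assms, of 1 Y] polya_vinogradov_residue_class[OF assms, of 3 Y] by simp
qed

section \<open>Second moments of Jacobi sums\<close>

lemma harm_le_ln: "n \<ge> 1 \<Longrightarrow> (harm n :: real) \<le> 1 + ln (real n)"
proof -
  assume "n \<ge> 1"
  then obtain m where m: "n = Suc m" by (cases n) auto
  have "harm (Suc m) - ln (real (Suc m)) \<le> harm (Suc 0) - ln (real (Suc 0))"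
    using decseqD[OF decseq_harm_diff_ln, of 0 m] by simp
  thus ?thesis unfolding m by (simp add: harm_def)
qed

lemma ln_ge_half: "real n \<ge> 2 \<Longrightarrow> ln (real n) \<ge> 1/2"
proof -
  assume "real n \<ge> 2"
  hence "ln 2 \<le> ln (real n)" by (subst ln_le_cancel_iff) auto
  thus ?thesis using ln2_ge_two_thirds by simp
qed

lemma harm_le_3_ln:
  assumes "n \<ge> 2" shows "(harm n :: real) \<le> 3 * ln (real n)"
  using harm_le_ln[of n] ln_ge_half[of n] assms by simp

lemma sum_divisors_swap:
  "(\<Sum>n\<in>{1..N}. \<Sum>d | d dvd n. F d (n div d)) = (\<Sum>d\<in>{1..N::nat}. \<Sum>r\<in>{1..N div d}. F d r)"
proof -
  have "(\<Sum>n\<in>{1..N}. \<Sum>d | d dvd n. F d (n div d)) = (\<Sum>(n,d)\<in>Sigma {1..N} (\<lambda>n. {d. d dvd n}). F d (n div d))"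
    by (rule sum.Sigma) auto
  also have "\<dots> = (\<Sum>(d,r)\<in>Sigma {1..N} (\<lambda>d. {1..N div d}). F d r)"
  proof (rule sum.reindex_bij_witness[where i = "\<lambda>(d,r). (d * r, d)" and j = "\<lambda>(n,d). (d, n div d)"])
    fix p assume "p \<in> Sigma {1..N} (\<lambda>n. {d. d dvd n})"
    then obtain n d where p: "p = (n, d)" "1 \<le> n" "n \<le> N" "d dvd n" by auto
    obtain r where r: "n = d * r" using p(4) by blast
    have dr: "d > 0" "r > 0" using r p(2) by (auto intro: Nat.gr0I)
    show "(case case p of (n, d) \<Rightarrow> (d, n div d) of (d, r) \<Rightarrow> (d * r, d)) = p"
      using p r by simp
    have "r \<le> N div d" using p(3) r dr(1) by (simp add: less_eq_div_iff_mult_less_eq mult.commute)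
    moreover have "d \<le> N" using dvd_imp_le[OF p(4)] p(2,3) by simp
    ultimately show "(case p of (n, d) \<Rightarrow> (d, n div d)) \<in> Sigma {1..N} (\<lambda>d. {1..N div d})"
      using p r dr by simp
    show "(case (case p of (n, d) \<Rightarrow> (d, n div d)) of (d, r) \<Rightarrow> F d r) = (case p of (n, d) \<Rightarrow> F d (n div d))"
      using p by simp
  next
    fix p assume "p \<in> Sigma {1..N} (\<lambda>d. {1..N div d})"
    then obtain d r where p: "p = (d, r)" "1 \<le> d" "d \<le> N" "1 \<le> r" "r \<le> N div d" by auto
    show "(case case p of (d, r) \<Rightarrow> (d * r, d) of (n, d) \<Rightarrow> (d, n div d)) = p"
      using p by simp
    have "d * r \<le> N" using p by (simp add: less_eq_div_iff_mult_less_eq mult.commute)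
    moreover have "1 \<le> d * r" using p by simp
    ultimately show "(case p of (d, r) \<Rightarrow> (d * r, d)) \<in> Sigma {1..N} (\<lambda>n. {d. d dvd n})"
      using p by simp
  qed
  also have "\<dots> = (\<Sum>d\<in>{1..N}. \<Sum>r\<in>{1..N div d}. F d r)"
    by (rule sum.Sigma[symmetric]) auto
  finally show ?thesis .
qed

text \<open>
  Every divisor of \<open>m * n\<close> is a product of a divisor of \<open>m\<close> and a divisor of \<open>n\<close>.
\<close>
lemma sigma_half_mult_le:
  assumes "m > 0" "n > 0"
  shows "sigma_half (m * n) \<le> sigma_half m * sigma_half n"
proof -
  have "sigma_half (m * n) \<le> (\<Sum>g\<in>(\<lambda>(a, b). a * b) ` ({a. a dvd m} \<times> {b. b dvd n}). 1 / sqrt (real g))"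
    unfolding sigma_half_def
  proof (rule sum_mono2)
    show "{g. g dvd m * n} \<subseteq> (\<lambda>(a, b). a * b) ` ({a. a dvd m} \<times> {b. b dvd n})"
    proof
      fix g assume "g \<in> {g. g dvd m * n}"
      then obtain a b where "g = a * b" "a dvd m" "b dvd n" using division_decomp[of g m n] by blast
      thus "g \<in> (\<lambda>(a, b). a * b) ` ({a. a dvd m} \<times> {b. b dvd n})" by auto
    qed
  qed (use assms in auto)
  also have "\<dots> \<le> (\<Sum>p\<in>{a. a dvd m} \<times> {b. b dvd n}. ((\<lambda>g. 1 / sqrt (real g)) \<circ> (\<lambda>(a, b). a * b)) p)"
    by (rule sum_image_le) (use assms in auto)
  also have "\<dots> = (\<Sum>(a,b)\<in>{a. a dvd m} \<times> {b. b dvd n}. (1 / sqrt (real a)) * (1 / sqrt (real b)))"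
    by (intro sum.cong refl) (auto simp: real_sqrt_mult)
  also have "\<dots> = sigma_half m * sigma_half n"
    unfolding sigma_half_def sum_product by (rule sum.cartesian_product[symmetric])
  finally show ?thesis .
qed

lemma sum_sigma_half_bound: "\<exists>c>0. \<forall>N. (\<Sum>n\<in>{1..N}. sigma_half n) \<le> c * real N"
proof -
  have sm: "summable (\<lambda>n::nat. real n powr (-3/2))" by (simp add: summable_real_powr_iff)
  define c where "c = (\<Sum>n::nat. real n powr (-3/2))"
  have "1 \<le> c"
  proof -
    have "(\<Sum>n\<in>{1}. real n powr (-3/2)) \<le> c" unfolding c_def
      by (rule sum_le_suminf[OF sm]) auto
    thus ?thesis by simp
  qed
  moreover have "(\<Sum>n\<in>{1..N}. sigma_half n) \<le> c * real N" for N
  proof -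
    have "(\<Sum>n\<in>{1..N}. sigma_half n) = (\<Sum>d\<in>{1..N}. \<Sum>r\<in>{1..N div d}. 1 / sqrt (real d))"
      unfolding sigma_half_def by (rule sum_divisors_swap)
    also have "\<dots> \<le> (\<Sum>d\<in>{1..N}. real N * real d powr (-3/2))"
    proof (rule sum_mono)
      fix d assume d: "d \<in> {1..N}"
      have "(\<Sum>r\<in>{1..N div d}. 1 / sqrt (real d)) = real (N div d) * (1 / sqrt (real d))" by simp
      also have "\<dots> \<le> real N / real d * (1 / sqrt (real d))"
        by (intro mult_right_mono) (auto simp: of_nat_div_le_of_nat)
      also have "\<dots> = real N * real d powr (-3/2)"
      proof -
        have "real d powr (-3/2) = real d powr (-1) * real d powr (-1/2)"
          by (subst powr_add[symmetric]) simp
        also have "\<dots> = 1 / real d * (1 / sqrt (real d))"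
        proof -
          have "real d powr (-1) = 1 / real d" using d by (simp add: powr_minus_divide)
          moreover have "real d powr (-1/2) = 1 / sqrt (real d)"
            using powr_minus_divide[of "real d" "1/2"] by (simp add: powr_half_sqrt)
          ultimately show ?thesis by (simp only:)
        qed
        finally show ?thesis by (simp only: times_divide_eq_left times_divide_eq_right mult_1_left mult_1_right divide_divide_eq_left)
      qed
      finally show "(\<Sum>r\<in>{1..N div d}. 1 / sqrt (real d)) \<le> real N * real d powr (-3/2)" .
    qed
    also have "\<dots> = real N * (\<Sum>d\<in>{1..N}. real d powr (-3/2))" by (simp add: sum_distrib_left)
    also have "\<dots> \<le> real N * c" unfolding c_def
      by (intro mult_left_mono sum_le_suminf[OF sm]) auto
    finally show ?thesis by (simp add: mult.commute)
  qed
  ultimately show ?thesis by (intro exI[of _ c]) auto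
qed

definition square_pairs :: "nat \<Rightarrow> (nat \<times> nat) set" where
  "square_pairs N = {(m, n). m \<in> {1..N} \<and> n \<in> {1..N} \<and> is_square (m * n)}"

definition odd_nonsquare_pairs :: "nat \<Rightarrow> (nat \<times> nat) set" where
  "odd_nonsquare_pairs N = {(m, n). m \<in> {1..N} \<and> n \<in> {1..N} \<and> odd m \<and> odd n \<and> \<not> is_square (m * n)}"

lemma finite_pairs [simp]: "finite (square_pairs N)" "finite (odd_nonsquare_pairs N)"
  by (rule finite_subset[of _ "{1..N} \<times> {1..N}"]; force simp: square_pairs_def odd_nonsquare_pairs_def)+

lemma square_pair_decompose:
  fixes m n :: nat
  assumes "m > 0" "n > 0" "is_square (m * n)"
  shows "\<exists>x y. m = gcd m n * x\<^sup>2 \<and> n = gcd m n * y\<^sup>2"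
proof -
  define g where "g = gcd m n"
  have g0: "g > 0" unfolding g_def using assms(1) by simp
  obtain a b where ab: "m = a * g" "n = b * g" "coprime a b"
    using gcd_coprime_exists[of m n] assms unfolding g_def by auto
  obtain z where z: "m * n = z\<^sup>2" using assms(3) by (auto simp: is_nth_power_def)
  have eq: "g\<^sup>2 * (a * b) = z\<^sup>2" using z unfolding ab(1,2) by (simp add: power2_eq_square mult_ac)
  hence "g\<^sup>2 dvd z\<^sup>2" by (metis dvd_triv_left)
  hence "g dvd z" by simp
  then obtain w where w: "z = g * w" by blast
  have "g\<^sup>2 * (a * b) = g\<^sup>2 * w\<^sup>2" using eq unfolding w by (simp add: power_mult_distrib)
  hence "a * b = w\<^sup>2" using g0 by simp
  hence "is_square (a * b)" by (auto simp: is_nth_power_def)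
  hence "is_square a" "is_square b" using is_nth_power_mult_coprime_nat_iff[OF ab(3)] by auto
  then obtain x y where "a = x\<^sup>2" "b = y\<^sup>2" by (auto simp: is_nth_power_def)
  thus ?thesis using ab(1,2) unfolding g_def by (auto simp: mult.commute)
qed

text \<open>
  A pair with square product has the form \<open>(g * x\<^sup>2, g * y\<^sup>2)\<close> with \<open>g\<close> its greatest
  common divisor, and for given \<open>g\<close> there are at most \<open>N / g\<close> choices of \<open>(x, y)\<close>.
\<close>
lemma card_square_pairs_le: "real (card (square_pairs N)) \<le> real N * harm N"
proof -
  define X where "X = (\<lambda>g. {x. 1 \<le> x \<and> g * x\<^sup>2 \<le> N})"
  have cardX: "finite (X g) \<and> real (card (X g)) \<le> sqrt (real N / real g)" if "g \<in> {1..N}" for g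
  proof -
    have sub: "X g \<subseteq> {1..nat \<lfloor>sqrt (real N / real g)\<rfloor>}"
    proof
      fix x assume "x \<in> X g"
      hence x: "1 \<le> x" "g * x\<^sup>2 \<le> N" by (auto simp: X_def)
      have "real g * (real x)\<^sup>2 \<le> real N" using x(2) by (metis of_nat_le_iff of_nat_mult of_nat_power)
      hence "(real x)\<^sup>2 \<le> real N / real g" using that by (simp add: field_simps)
      hence "real x \<le> sqrt (real N / real g)" by (rule real_le_rsqrt)
      thus "x \<in> {1..nat \<lfloor>sqrt (real N / real g)\<rfloor>}" using x(1) by (simp add: le_nat_floor)
    qed
    hence fin: "finite (X g)" by (rule finite_subset) simp
    have "card (X g) \<le> nat \<lfloor>sqrt (real N / real g)\<rfloor>" using card_mono[OF _ sub] by simp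
    hence "real (card (X g)) \<le> real (nat \<lfloor>sqrt (real N / real g)\<rfloor>)" by (simp only: of_nat_le_iff)
    also have "\<dots> \<le> sqrt (real N / real g)" by (intro of_nat_floor) simp
    finally show ?thesis using fin by simp
  qed
  have "square_pairs N \<subseteq> (\<Union>g\<in>{1..N}. (\<lambda>(x, y). (g * x\<^sup>2, g * y\<^sup>2)) ` (X g \<times> X g))"
  proof
    fix p assume "p \<in> square_pairs N"
    then obtain m n where p: "p = (m, n)" "m \<in> {1..N}" "n \<in> {1..N}" "is_square (m * n)"
      by (auto simp: square_pairs_def)
    obtain x y where xy: "m = gcd m n * x\<^sup>2" "n = gcd m n * y\<^sup>2"
      using square_pair_decompose[of m n] p by auto
    have "x \<noteq> 0"
    proof
      assume "x = 0"
      hence "m = 0" using xy(1) by (metis mult_0_right zero_power2)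
      thus False using p(2) by simp
    qed
    moreover have "y \<noteq> 0"
    proof
      assume "y = 0"
      hence "n = 0" using xy(2) by (metis mult_0_right zero_power2)
      thus False using p(3) by simp
    qed
    ultimately have "x \<in> X (gcd m n)" "y \<in> X (gcd m n)" using xy p(2,3) by (auto simp: X_def)
    moreover have "gcd m n \<in> {1..N}"
    proof -
      have "gcd m n \<le> m" using p(2) by (intro gcd_le1_nat) simp
      moreover have "gcd m n > 0" using p(2) by simp
      ultimately show ?thesis using p(2) unfolding atLeastAtMost_iff by linarith
    qed
    moreover have "p = (\<lambda>(x, y). (gcd m n * x\<^sup>2, gcd m n * y\<^sup>2)) (x, y)" using p(1) xy by simp
    ultimately show "p \<in> (\<Union>g\<in>{1..N}. (\<lambda>(x, y). (g * x\<^sup>2, g * y\<^sup>2)) ` (X g \<times> X g))" by blast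
  qed
  hence "card (square_pairs N) \<le> card (\<Union>g\<in>{1..N}. (\<lambda>(x, y). (g * x\<^sup>2, g * y\<^sup>2)) ` (X g \<times> X g))"
    by (intro card_mono) (use cardX in auto)
  also have "\<dots> \<le> (\<Sum>g\<in>{1..N}. card ((\<lambda>(x, y). (g * x\<^sup>2, g * y\<^sup>2)) ` (X g \<times> X g)))"
    by (rule card_UN_le) simp
  also have "\<dots> \<le> (\<Sum>g\<in>{1..N}. card (X g) * card (X g))"
  proof (rule sum_mono)
    fix g assume g: "g \<in> {1..N}"
    have "card ((\<lambda>(x, y). (g * x\<^sup>2, g * y\<^sup>2)) ` (X g \<times> X g)) \<le> card (X g \<times> X g)"
      by (rule card_image_le) (use cardX[OF g] in auto)
    thus "card ((\<lambda>(x, y). (g * x\<^sup>2, g * y\<^sup>2)) ` (X g \<times> X g)) \<le> card (X g) * card (X g)"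
      by (simp add: card_cartesian_product)
  qed
  finally have "real (card (square_pairs N)) \<le> real (\<Sum>g\<in>{1..N}. card (X g) * card (X g))"
    by (simp only: of_nat_le_iff)
  also have "\<dots> = (\<Sum>g\<in>{1..N}. real (card (X g)) * real (card (X g)))" by simp
  also have "\<dots> \<le> (\<Sum>g\<in>{1..N}. sqrt (real N / real g) * sqrt (real N / real g))"
    by (intro sum_mono mult_mono) (use cardX in auto)
  also have "\<dots> = (\<Sum>g\<in>{1..N}. real N * inverse (real g))"
    by (intro sum.cong refl) (simp add: divide_inverse)
  also have "\<dots> = real N * harm N" by (simp add: harm_def sum_distrib_left)
  finally show ?thesis .
qed

text \<open>
  The total of the Polya--Vinogradov bounds over all off-diagonal pairs. The submultiplicativity
  of \<open>sigma_half\<close> separates the variables, and its boundedness on average leaves a single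
  logarithm.
\<close>
lemma nonsquare_pairs_bound:
  "\<exists>C>0. \<forall>N\<ge>2. (\<Sum>(m,n)\<in>odd_nonsquare_pairs N. sqrt (real (m * n)) * sigma_half (m * n) * harm (m * n))
     \<le> C * real N ^ 3 * ln (real N)"
proof -
  obtain c where c: "c > 0" "\<And>N. (\<Sum>n\<in>{1..N}. sigma_half n) \<le> c * real N"
    using sum_sigma_half_bound by blast
  have "(\<Sum>(m,n)\<in>odd_nonsquare_pairs N. sqrt (real (m * n)) * sigma_half (m * n) * harm (m * n))
     \<le> (4 * c\<^sup>2) * real N ^ 3 * ln (real N)" if N: "N \<ge> 2" for N
  proof -
    have lnN: "ln (real N) \<ge> 1/2" using ln_ge_half N by simp
    have "(\<Sum>(m,n)\<in>odd_nonsquare_pairs N. sqrt (real (m * n)) * sigma_half (m * n) * harm (m * n))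
       \<le> (\<Sum>(m,n)\<in>odd_nonsquare_pairs N. real N * (sigma_half m * sigma_half n) * (4 * ln (real N)))"
    proof (rule sum_mono, clarify)
      fix m n assume "(m, n) \<in> odd_nonsquare_pairs N"
      hence mn: "1 \<le> m" "m \<le> N" "1 \<le> n" "n \<le> N" by (auto simp: odd_nonsquare_pairs_def)
      have mnN: "m * n \<le> N * N" "1 \<le> m * n" using mn by (auto intro: mult_mono)
      have "sqrt (real (m * n)) \<le> sqrt (real (N * N))" using mnN(1) by (intro real_sqrt_le_mono) (simp only: of_nat_le_iff)
      hence 1: "sqrt (real (m * n)) \<le> real N" by simp
      have 2: "sigma_half (m * n) \<le> sigma_half m * sigma_half n" using mn by (intro sigma_half_mult_le) auto
      have "harm (m * n) \<le> 1 + ln (real (m * n))" using mnN(2) by (rule harm_le_ln)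
      also have "ln (real (m * n)) \<le> ln (real (N * N))"
      proof (subst ln_le_cancel_iff)
        show "real (m * n) > 0" using mnN(2) by (simp only: of_nat_0_less_iff)
        show "real (N * N) > 0" using N by simp
        show "real (m * n) \<le> real (N * N)" using mnN(1) by (simp only: of_nat_le_iff)
      qed
      also have "ln (real (N * N)) = 2 * ln (real N)" using N by (simp add: ln_mult)
      finally have 3: "harm (m * n) \<le> 4 * ln (real N)" using lnN by simp
      show "sqrt (real (m * n)) * sigma_half (m * n) * harm (m * n) \<le> real N * (sigma_half m * sigma_half n) * (4 * ln (real N))"
        by (intro mult_mono 1 2 3 mult_nonneg_nonneg sigma_half_nonneg harm_nonneg) auto
    qed
    also have "\<dots> \<le> (\<Sum>(m,n)\<in>{1..N} \<times> {1..N}. real N * (sigma_half m * sigma_half n) * (4 * ln (real N)))"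
      by (rule sum_mono2) (use lnN in \<open>auto simp: odd_nonsquare_pairs_def intro!: mult_nonneg_nonneg sigma_half_nonneg\<close>)
    also have "\<dots> = real N * (4 * ln (real N)) * ((\<Sum>m\<in>{1..N}. sigma_half m) * (\<Sum>n\<in>{1..N}. sigma_half n))"
    proof -
      have prod: "(\<Sum>m\<in>{1..N}. sigma_half m) * (\<Sum>n\<in>{1..N}. sigma_half n) = (\<Sum>(m,n)\<in>{1..N} \<times> {1..N}. sigma_half m * sigma_half n)"
        by (simp only: sum_product sum.cartesian_product)
      show ?thesis unfolding prod unfolding sum_distrib_left by (intro sum.cong refl) auto
    qed
    also have "\<dots> \<le> real N * (4 * ln (real N)) * ((c * real N) * (c * real N))"
      by (intro mult_left_mono mult_mono c(2) sum_nonneg sigma_half_nonneg mult_nonneg_nonneg) (use lnN c(1) in auto)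
    also have "\<dots> = (4 * c\<^sup>2) * real N ^ 3 * ln (real N)"
      by (simp add: power2_eq_square power3_eq_cube)
    finally show ?thesis .
  qed
  thus ?thesis using c(1) by (intro exI[of _ "4 * c\<^sup>2"]) auto
qed

definition admissible :: "(nat \<Rightarrow> complex) \<Rightarrow> bool" where
  "admissible a \<longleftrightarrow> (\<forall>n. a n \<noteq> 0 \<longrightarrow> odd n) \<and> (\<forall>n. norm (a n) \<le> 1)"

definition jacobi_sum :: "(nat \<Rightarrow> complex) \<Rightarrow> nat \<Rightarrow> nat \<Rightarrow> complex" where
  "jacobi_sum a N m = (\<Sum>n\<in>{1..N}. a n * of_int (jacobi_symbol (int n) m))"

text \<open>
  Fixing a factor \<open>d\<close> of \<open>m\<close> replaces the coefficients by their twists, which are again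
  admissible; bounds that are uniform in the coefficients can therefore be applied to the cofactor.
\<close>
definition twist :: "nat \<Rightarrow> (nat \<Rightarrow> complex) \<Rightarrow> nat \<Rightarrow> complex" where
  "twist d a n = a n * of_int (jacobi_symbol (int n) d)"

lemma admissible_twist: "admissible a \<Longrightarrow> admissible (twist d a)"
  unfolding admissible_def twist_def norm_mult
  using norm_jacobi_le_1 by (blast intro: mult_le_one norm_ge_zero mult_eq_0_iff[THEN iffD2])

lemma jacobi_sum_mult:
  "d > 0 \<Longrightarrow> r > 0 \<Longrightarrow> jacobi_sum a N (d * r) = jacobi_sum (twist d a) N r"
  by (simp add: jacobi_sum_def twist_def jacobi_symbol_mult_bottom mult_ac)

lemma norm_jacobi_sum_le:
  assumes "admissible a"
  shows "norm (jacobi_sum a N m) \<le> real N"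
proof -
  have "norm (jacobi_sum a N m) \<le> (\<Sum>n\<in>{1..N}. 1)"
    unfolding jacobi_sum_def
    by (rule sum_norm_le)
       (use assms in \<open>auto simp: admissible_def norm_mult abs_jacobi_le_1 intro!: mult_le_one\<close>)
  thus ?thesis by simp
qed

text \<open>
  The square is expanded into a double sum over \<open>n1\<close> and \<open>n2\<close>. When \<open>n1 * n2\<close> is a
  square, the sum over \<open>m\<close> is bounded by the total weight; this is the diagonal.
\<close>
lemma weighted_second_moment:
  assumes adm: "admissible a" and fin: "finite S" and odd: "\<And>m. m \<in> S \<Longrightarrow> odd m"
    and w: "\<And>m. m \<in> S \<Longrightarrow> w m \<ge> 0"
  shows "(\<Sum>m\<in>S. w m * (norm (jacobi_sum a N m))\<^sup>2)
    \<le> real (card (square_pairs N)) * (\<Sum>m\<in>S. w m) +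
       (\<Sum>(n1,n2)\<in>odd_nonsquare_pairs N. \<bar>\<Sum>m\<in>S. w m * of_int (jacobi_symbol (int (n1 * n2)) m)\<bar>)"
proof -
  let ?J = "\<lambda>n m. of_int (jacobi_symbol (int n) m) :: complex"
  let ?W = "\<lambda>n1 n2. \<Sum>m\<in>S. w m * of_int (jacobi_symbol (int (n1 * n2)) m)"
  define P where "P = {(n1, n2). n1 \<in> {1..N} \<and> n2 \<in> {1..N} \<and> odd n1 \<and> odd n2}"
  have finP: "finite P" by (rule finite_subset[of _ "{1..N} \<times> {1..N}"]) (auto simp: P_def)
  have "complex_of_real (\<Sum>m\<in>S. w m * (norm (jacobi_sum a N m))\<^sup>2)
     = (\<Sum>m\<in>S. of_real (w m) * (jacobi_sum a N m * cnj (jacobi_sum a N m)))"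
    by (simp only: of_real_sum of_real_mult complex_norm_square)
  also have "\<dots> = (\<Sum>m\<in>S. \<Sum>(n1,n2)\<in>{1..N} \<times> {1..N}. a n1 * cnj (a n2) * (of_real (w m) * (?J n1 m * ?J n2 m)))"
  proof (rule sum.cong[OF refl])
    fix m
    have prod: "jacobi_sum a N m * cnj (jacobi_sum a N m) = (\<Sum>(n1,n2)\<in>{1..N} \<times> {1..N}. (a n1 * ?J n1 m) * cnj (a n2 * ?J n2 m))"
      by (simp only: jacobi_sum_def cnj_sum sum_product sum.cartesian_product)
    show "of_real (w m) * (jacobi_sum a N m * cnj (jacobi_sum a N m)) =
      (\<Sum>(n1,n2)\<in>{1..N} \<times> {1..N}. a n1 * cnj (a n2) * (of_real (w m) * (?J n1 m * ?J n2 m)))"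
      unfolding prod unfolding sum_distrib_left by (intro sum.cong refl) auto
  qed
  also have "\<dots> = (\<Sum>p\<in>{1..N} \<times> {1..N}. \<Sum>m\<in>S. case p of (n1, n2) \<Rightarrow> a n1 * cnj (a n2) * (of_real (w m) * (?J n1 m * ?J n2 m)))"
    by (rule sum.swap)
  also have "\<dots> = (\<Sum>p\<in>P. \<Sum>m\<in>S. case p of (n1, n2) \<Rightarrow> a n1 * cnj (a n2) * (of_real (w m) * (?J n1 m * ?J n2 m)))"
  proof (rule sum.mono_neutral_right)
    show "\<forall>p\<in>{1..N} \<times> {1..N} - P. (\<Sum>m\<in>S. case p of (n1, n2) \<Rightarrow> a n1 * cnj (a n2) * (of_real (w m) * (?J n1 m * ?J n2 m))) = 0"
    proof
      fix p assume p: "p \<in> {1..N} \<times> {1..N} - P"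
      obtain n1 n2 where n: "p = (n1, n2)" by (cases p)
      have "\<not> odd n1 \<or> \<not> odd n2" using p unfolding n P_def by blast
      hence "a n1 = 0 \<or> a n2 = 0" using adm unfolding admissible_def by blast
      thus "(\<Sum>m\<in>S. case p of (n1, n2) \<Rightarrow> a n1 * cnj (a n2) * (of_real (w m) * (?J n1 m * ?J n2 m))) = 0"
        unfolding n by auto
    qed
  qed (auto simp: P_def)
  also have "\<dots> = (\<Sum>(n1,n2)\<in>P. a n1 * cnj (a n2) * of_real (?W n1 n2))"
  proof (rule sum.cong[OF refl])
    fix p assume "p \<in> P"
    obtain n1 n2 where n: "p = (n1, n2)" by (cases p)
    have "(\<Sum>m\<in>S. a n1 * cnj (a n2) * (of_real (w m) * (?J n1 m * ?J n2 m))) = a n1 * cnj (a n2) * of_real (?W n1 n2)"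
      unfolding of_real_sum sum_distrib_left
      by (intro sum.cong refl) (use odd in \<open>simp add: jacobi_symbol_mult_top\<close>)
    thus "(\<Sum>m\<in>S. case p of (n1, n2) \<Rightarrow> a n1 * cnj (a n2) * (of_real (w m) * (?J n1 m * ?J n2 m))) =
      (case p of (n1, n2) \<Rightarrow> a n1 * cnj (a n2) * of_real (?W n1 n2))" unfolding n by simp
  qed
  finally have eq: "complex_of_real (\<Sum>m\<in>S. w m * (norm (jacobi_sum a N m))\<^sup>2) = (\<Sum>(n1,n2)\<in>P. a n1 * cnj (a n2) * of_real (?W n1 n2))" .
  have nn: "(\<Sum>m\<in>S. w m * (norm (jacobi_sum a N m))\<^sup>2) \<ge> 0"
    by (intro sum_nonneg mult_nonneg_nonneg w) auto
  have "(\<Sum>m\<in>S. w m * (norm (jacobi_sum a N m))\<^sup>2) = norm (complex_of_real (\<Sum>m\<in>S. w m * (norm (jacobi_sum a N m))\<^sup>2))"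
    by (simp only: norm_of_real abs_of_nonneg[OF nn])
  also have "\<dots> \<le> (\<Sum>(n1,n2)\<in>P. \<bar>?W n1 n2\<bar>)"
    unfolding eq
  proof (rule sum_norm_le)
    fix p assume "p \<in> P"
    obtain n1 n2 where n: "p = (n1, n2)" by (cases p)
    have "norm (a n1) * norm (a n2) \<le> 1"
      using adm by (intro mult_le_one) (auto simp: admissible_def)
    hence "norm (a n1 * cnj (a n2) * of_real (?W n1 n2)) \<le> 1 * \<bar>?W n1 n2\<bar>"
      unfolding norm_mult complex_mod_cnj norm_of_real by (intro mult_right_mono) auto
    thus "norm (case p of (n1, n2) \<Rightarrow> a n1 * cnj (a n2) * of_real (?W n1 n2)) \<le> (case p of (n1, n2) \<Rightarrow> \<bar>?W n1 n2\<bar>)"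
      unfolding n by simp
  qed
  also have "\<dots> \<le> (\<Sum>(n1,n2)\<in>square_pairs N \<union> odd_nonsquare_pairs N. \<bar>?W n1 n2\<bar>)"
  proof (rule sum_mono2)
    show "finite (square_pairs N \<union> odd_nonsquare_pairs N)" by simp
  qed (auto simp: P_def square_pairs_def odd_nonsquare_pairs_def)
  also have "\<dots> = (\<Sum>(n1,n2)\<in>square_pairs N. \<bar>?W n1 n2\<bar>) + (\<Sum>(n1,n2)\<in>odd_nonsquare_pairs N. \<bar>?W n1 n2\<bar>)"
  proof (rule sum.union_disjoint)
    show "square_pairs N \<inter> odd_nonsquare_pairs N = {}" by (auto simp: square_pairs_def odd_nonsquare_pairs_def)
  qed simp_all
  also have "(\<Sum>(n1,n2)\<in>square_pairs N. \<bar>?W n1 n2\<bar>) \<le> (\<Sum>p\<in>square_pairs N. (\<Sum>m\<in>S. w m))"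
  proof (rule sum_mono)
    fix p assume "p \<in> square_pairs N"
    obtain n1 n2 where n: "p = (n1, n2)" by (cases p)
    have "\<bar>?W n1 n2\<bar> \<le> (\<Sum>m\<in>S. \<bar>w m * of_int (jacobi_symbol (int (n1 * n2)) m)\<bar>)" by (rule sum_abs)
    also have "\<dots> \<le> (\<Sum>m\<in>S. w m)"
    proof (rule sum_mono)
      fix m assume m: "m \<in> S"
      have "\<bar>w m * of_int (jacobi_symbol (int (n1 * n2)) m)\<bar> \<le> w m * 1"
        unfolding abs_mult using w[OF m] abs_jacobi_le_1 by (intro mult_mono) auto
      thus "\<bar>w m * of_int (jacobi_symbol (int (n1 * n2)) m)\<bar> \<le> w m" by simp
    qed
    finally show "(case p of (n1, n2) \<Rightarrow> \<bar>?W n1 n2\<bar>) \<le> (\<Sum>m\<in>S. w m)" unfolding n by simp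
  qed
  also have "(\<Sum>p\<in>square_pairs N. (\<Sum>m\<in>S. w m)) = real (card (square_pairs N)) * (\<Sum>m\<in>S. w m)" by simp
  finally show ?thesis by simp
qed

lemma quadratic_large_sieve:
  "\<exists>C>0. \<forall>N\<ge>2. \<forall>Y a. admissible a \<longrightarrow>
     (\<Sum>m | m \<in> {1..Y} \<and> odd m. (norm (jacobi_sum a N m))\<^sup>2)
       \<le> C * (real Y * real N * ln (real N) + real N ^ 3 * ln (real N))"
proof -
  obtain C where C: "C > 0" "\<And>N. N \<ge> 2 \<Longrightarrow>
    (\<Sum>(m,n)\<in>odd_nonsquare_pairs N. sqrt (real (m * n)) * sigma_half (m * n) * harm (m * n)) \<le> C * real N ^ 3 * ln (real N)"
    using nonsquare_pairs_bound by blast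
  have "(\<Sum>m | m \<in> {1..Y} \<and> odd m. (norm (jacobi_sum a N m))\<^sup>2)
       \<le> (3 + 2 * C) * (real Y * real N * ln (real N) + real N ^ 3 * ln (real N))"
    if N: "N \<ge> 2" and adm: "admissible a" for N Y a
  proof -
    have lnN: "ln (real N) \<ge> 1/2" using ln_ge_half N by simp
    let ?S = "{m. m \<in> {1..Y} \<and> odd m}"
    have "(\<Sum>m\<in>?S. 1 * (norm (jacobi_sum a N m))\<^sup>2) \<le> real (card (square_pairs N)) * (\<Sum>m\<in>?S. 1) +
       (\<Sum>(n1,n2)\<in>odd_nonsquare_pairs N. \<bar>\<Sum>m\<in>?S. 1 * of_int (jacobi_symbol (int (n1 * n2)) m)\<bar>)"
      by (rule weighted_second_moment[OF adm]) auto
    also have "real (card (square_pairs N)) * (\<Sum>m\<in>?S. 1) \<le> (real N * (3 * ln (real N))) * real Y"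
    proof (rule mult_mono)
      have "real (card (square_pairs N)) \<le> real N * harm N" by (rule card_square_pairs_le)
      also have "\<dots> \<le> real N * (3 * ln (real N))" by (intro mult_left_mono harm_le_3_ln N) auto
      finally show "real (card (square_pairs N)) \<le> real N * (3 * ln (real N))" .
      have "card ?S \<le> card {1..Y}" by (intro card_mono) auto
      thus "(\<Sum>m\<in>?S. 1) \<le> real Y" by simp
    qed (use lnN in auto)
    also have "(\<Sum>(n1,n2)\<in>odd_nonsquare_pairs N. \<bar>\<Sum>m\<in>?S. 1 * of_int (jacobi_symbol (int (n1 * n2)) m)\<bar>)
      \<le> (\<Sum>(n1,n2)\<in>odd_nonsquare_pairs N. 2 * (sqrt (real (n1 * n2)) * sigma_half (n1 * n2) * harm (n1 * n2)))"
    proof (rule sum_mono, clarify)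
      fix n1 n2 assume "(n1, n2) \<in> odd_nonsquare_pairs N"
      hence "odd (n1 * n2)" "\<not> is_square (n1 * n2)" by (auto simp: odd_nonsquare_pairs_def)
      from polya_vinogradov_odd[OF this, of Y]
      show "\<bar>\<Sum>m\<in>?S. 1 * of_int (jacobi_symbol (int (n1 * n2)) m)\<bar> \<le> 2 * (sqrt (real (n1 * n2)) * sigma_half (n1 * n2) * harm (n1 * n2))"
        by (simp add: mult_ac)
    qed
    also have "\<dots> = 2 * (\<Sum>(n1,n2)\<in>odd_nonsquare_pairs N. sqrt (real (n1 * n2)) * sigma_half (n1 * n2) * harm (n1 * n2))"
      unfolding sum_distrib_left by (intro sum.cong refl) auto
    also have "\<dots> \<le> 2 * (C * real N ^ 3 * ln (real N))" by (intro mult_left_mono C(2) N) auto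
    finally have "(\<Sum>m\<in>?S. (norm (jacobi_sum a N m))\<^sup>2) \<le> 3 * (real Y * real N * ln (real N)) + (2 * C) * (real N ^ 3 * ln (real N))"
      by (simp add: mult_ac)
    also have "\<dots> \<le> (3 + 2 * C) * (real Y * real N * ln (real N)) + (3 + 2 * C) * (real N ^ 3 * ln (real N))"
      using C(1) lnN by (intro add_mono mult_right_mono mult_nonneg_nonneg) auto
    finally show ?thesis by (simp only: distrib_left)
  qed
  thus ?thesis using C(1) by (intro exI[of _ "3 + 2 * C"]) auto
qed

section \<open>The von Mangoldt function\<close>

abbreviation von_mangoldt :: "nat \<Rightarrow> real" where "von_mangoldt \<equiv> mangoldt"

definition chebyshev_psi :: "nat \<Rightarrow> real" where
  "chebyshev_psi N = (\<Sum>d\<in>{1..N}. von_mangoldt d)"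

lemma sum_mangoldt_div:
  "(\<Sum>d\<in>{1..N}. von_mangoldt d * real (N div d)) = ln (fact N)"
proof -
  have "(\<Sum>d\<in>{1..N}. von_mangoldt d * real (N div d)) = (\<Sum>d\<in>{1..N}. \<Sum>r\<in>{1..N div d}. von_mangoldt d)"
    by (simp add: mult.commute)
  also have "\<dots> = (\<Sum>n\<in>{1..N}. \<Sum>d | d dvd n. von_mangoldt d)"
    by (rule sum_divisors_swap[symmetric])
  also have "\<dots> = (\<Sum>n\<in>{1..N}. ln (real n))"
    by (intro sum.cong refl) (use mangoldt_sum[where 'a = real] in auto)
  also have "\<dots> = ln (fact N)"
    by (induction N) (simp_all add: ln_mult)
  finally show ?thesis .
qed

lemma chebyshev_psi_mono: "m \<le> n \<Longrightarrow> chebyshev_psi m \<le> chebyshev_psi n"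
  unfolding chebyshev_psi_def by (rule sum_mono2) (auto simp: mangoldt_nonneg)

text \<open>
  In the expansion of the logarithm of the central binomial coefficient, the coefficient of
  \<open>mangoldt d\<close> is \<open>(2 * n) div d - 2 * (n div d)\<close>. It is never negative, and it is 1 for
  \<open>n < d \<le> 2 * n\<close>.
\<close>
lemma chebyshev_psi_double: "chebyshev_psi (2 * n) \<le> chebyshev_psi n + 2 * real n * ln 2"
proof -
  have ext: "(\<Sum>d\<in>{1..n}. von_mangoldt d * real (n div d)) = (\<Sum>d\<in>{1..2 * n}. von_mangoldt d * real (n div d))"
    by (rule sum.mono_neutral_left) auto
  have "chebyshev_psi (2 * n) - chebyshev_psi n = (\<Sum>d\<in>{1..2 * n} - {1..n}. von_mangoldt d)"
    unfolding chebyshev_psi_def by (rule sum_diff[symmetric]) auto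
  also have "\<dots> \<le> (\<Sum>d\<in>{1..2 * n} - {1..n}. von_mangoldt d * (real ((2 * n) div d) - 2 * real (n div d)))"
  proof (rule sum_mono)
    fix d assume d: "d \<in> {1..2 * n} - {1..n}"
    hence "n div d = 0" "(2 * n) div d \<ge> 1" by (auto simp: div_greater_zero_iff Suc_le_eq)
    hence "1 \<le> real ((2 * n) div d) - 2 * real (n div d)" by simp
    thus "von_mangoldt d \<le> von_mangoldt d * (real ((2 * n) div d) - 2 * real (n div d))"
      using mult_left_mono[OF _ mangoldt_nonneg[of d]] by fastforce
  qed
  also have "\<dots> \<le> (\<Sum>d\<in>{1..2 * n}. von_mangoldt d * (real ((2 * n) div d) - 2 * real (n div d)))"
  proof (rule sum_mono2)
    fix d
    have "2 * (n div d) \<le> (2 * n) div d"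
    proof (cases "d = 0")
      case False
      have "2 * (n div d) * d \<le> 2 * n" using div_times_less_eq_dividend[of n d] by linarith
      thus ?thesis using False by (simp add: less_eq_div_iff_mult_less_eq)
    qed simp
    hence "2 * real (n div d) \<le> real ((2 * n) div d)" by linarith
    thus "0 \<le> von_mangoldt d * (real ((2 * n) div d) - 2 * real (n div d))"
      by (intro mult_nonneg_nonneg mangoldt_nonneg) simp
  qed auto
  also have "\<dots> = ln (fact (2 * n)) - 2 * ln (fact n)"
  proof -
    have "von_mangoldt d * (real ((2 * n) div d) - 2 * real (n div d))
        = von_mangoldt d * real ((2 * n) div d) - 2 * (von_mangoldt d * real (n div d))" for d
      by (simp add: right_diff_distrib)
    hence "(\<Sum>d\<in>{1..2 * n}. von_mangoldt d * (real ((2 * n) div d) - 2 * real (n div d)))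
        = (\<Sum>d\<in>{1..2 * n}. von_mangoldt d * real ((2 * n) div d)) - 2 * (\<Sum>d\<in>{1..2 * n}. von_mangoldt d * real (n div d))"
      by (simp only: sum_subtractf sum_distrib_left)
    thus ?thesis by (simp only: ext[symmetric] sum_mangoldt_div)
  qed
  also have "\<dots> = ln (real ((2 * n) choose n))"
  proof -
    have "real ((2 * n) choose n) = fact (2 * n) / (fact n * fact (2 * n - n))"
      by (rule binomial_fact) simp
    also have "2 * n - n = n" by simp
    finally have "ln (real ((2 * n) choose n)) = ln (fact (2 * n)) - ln (fact n * fact n)"
      by (simp add: ln_div)
    thus ?thesis by (simp only: ln_mult_pos fact_gt_zero)
  qed
  also have "\<dots> \<le> ln (2 ^ (2 * n))"
  proof (subst ln_le_cancel_iff)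
    have "(2 * n) choose n \<le> 2 ^ (2 * n)" by (rule binomial_le_pow2)
    thus "real ((2 * n) choose n) \<le> 2 ^ (2 * n)" by (metis of_nat_le_iff of_nat_numeral of_nat_power)
  qed auto
  also have "\<dots> = 2 * real n * ln 2" by (simp add: ln_realpow)
  finally show ?thesis by simp
qed

lemma chebyshev_upper: "chebyshev_psi n \<le> 4 * real n"
proof (induction n rule: less_induct)
  case (less n)
  consider "n = 0" | "n = 1" | "n \<ge> 2" by linarith
  thus ?case
  proof cases
    case 3
    define m where "m = (n + 1) div 2"
    have m: "m < n" "n \<le> 2 * m" "2 * m \<le> n + 1" using 3 unfolding m_def by auto
    have "chebyshev_psi n \<le> chebyshev_psi (2 * m)" by (rule chebyshev_psi_mono[OF m(2)])
    also have "\<dots> \<le> chebyshev_psi m + 2 * real m * ln 2" by (rule chebyshev_psi_double)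
    also have "\<dots> \<le> 4 * real m + 2 * real m * (25/36)"
      using less.IH[OF m(1)] ln2_le_25_over_36 by (intro add_mono mult_left_mono) auto
    also have "\<dots> \<le> 4 * real n"
    proof (cases "n = 3")
      case True
      hence "m = 2" by (simp add: m_def)
      thus ?thesis using True by simp
    next
      case False
      hence "n = 2 \<or> n \<ge> 4" using 3 by auto
      thus ?thesis
      proof
        assume "n = 2"
        hence "m = 1" by (simp add: m_def)
        thus ?thesis using \<open>n = 2\<close> by simp
      next
        assume "n \<ge> 4"
        moreover have "2 * real m \<le> real n + 1" using m(3) by linarith
        ultimately show ?thesis by simp
      qed
    qed
    finally show ?thesis .
  qed (simp_all add: chebyshev_psi_def)
qed

text \<open>
  Replacing \<open>N div d\<close> by \<open>N / d\<close> in the formula for \<open>ln (fact N)\<close> costs at most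
  \<open>chebyshev_psi N\<close>.
\<close>
lemma mertens_upper:
  assumes "N \<ge> 2"
  shows "(\<Sum>d\<in>{1..N}. von_mangoldt d / real d) \<le> 9 * ln (real N)"
proof -
  have N: "real N > 0" using assms by simp
  have "real N * (\<Sum>d\<in>{1..N}. von_mangoldt d / real d) = (\<Sum>d\<in>{1..N}. von_mangoldt d * (real N / real d))"
    unfolding sum_distrib_left by (intro sum.cong refl) simp
  also have "\<dots> \<le> (\<Sum>d\<in>{1..N}. von_mangoldt d * (real (N div d) + 1))"
  proof (intro sum_mono mult_left_mono mangoldt_nonneg)
    fix d assume d: "d \<in> {1..N}"
    have "\<lfloor>real N / real d\<rfloor> = int (N div d)" by (rule floor_divide_of_nat_eq)
    thus "real N / real d \<le> real (N div d) + 1"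
      using real_of_int_floor_add_one_ge[of "real N / real d"] by simp
  qed
  also have "\<dots> = ln (fact N) + chebyshev_psi N"
    using sum_mangoldt_div[of N] by (simp add: distrib_left sum.distrib chebyshev_psi_def)
  also have "ln (fact N :: real) \<le> ln (real N ^ N)"
  proof (subst ln_le_cancel_iff)
    show "(fact N :: real) \<le> real N ^ N" using fact_le_power[of N, where 'a = real] by simp
  qed (use N in auto)
  also have "\<dots> = real N * ln (real N)" using N by (simp add: ln_realpow)
  also have "chebyshev_psi N \<le> 4 * real N" by (rule chebyshev_upper)
  also have "real N * ln (real N) + 4 * real N \<le> real N * (9 * ln (real N))"
  proof -
    have "4 \<le> 8 * ln (real N)" using ln_ge_half[of N] assms by simp
    hence "real N * 4 \<le> real N * (8 * ln (real N))" by (intro mult_left_mono) auto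
    thus ?thesis by simp
  qed
  finally show ?thesis using N by simp
qed

lemma sum_power_from_2_le:
  assumes "0 \<le> (x::real)" "x \<le> 3/4"
  shows "(\<Sum>k\<in>{2..n}. x ^ k) \<le> 4 * x\<^sup>2"
proof -
  have "(1 - x) * (\<Sum>k\<in>{2..n}. x ^ k) \<le> x\<^sup>2"
  proof (cases "n \<ge> 2")
    case True
    thus ?thesis using sum_gp_multiplied[of 2 n x] assms by simp
  qed (use assms in simp)
  moreover have "(1/4) * (\<Sum>k\<in>{2..n}. x ^ k) \<le> (1 - x) * (\<Sum>k\<in>{2..n}. x ^ k)"
    using assms by (intro mult_right_mono sum_nonneg) auto
  ultimately show ?thesis by linarith
qed

text \<open>
  Proper prime powers are sparse: the sum would converge for every exponent below \<open>-1/2\<close>. The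
  value \<open>-3/4\<close> leaves room to extract a power of the smallest \<open>d\<close> from \<open>1 / d\<close>.
\<close>
lemma sum_nonprime_mangoldt_bound:
  "\<exists>C>0. \<forall>N. (\<Sum>d | d \<in> {1..N} \<and> \<not> prime d. von_mangoldt d * real d powr (-3/4)) \<le> C"
proof -
  have sm: "summable (\<lambda>n::nat. real n powr (-5/4))" by (simp add: summable_real_powr_iff)
  define C where "C = 16 * (\<Sum>n::nat. real n powr (-5/4)) + 1"
  have nn: "(\<Sum>n::nat. real n powr (-5/4)) \<ge> 0" by (intro suminf_nonneg sm) auto
  have "(\<Sum>d | d \<in> {1..N} \<and> \<not> prime d. von_mangoldt d * real d powr (-3/4)) \<le> C" for N
  proof -
    let ?F = "\<lambda>d. von_mangoldt d * real d powr (-3/4)"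
    let ?P = "{p \<in> {2..N}. prime p}"
    have "(\<Sum>d | d \<in> {1..N} \<and> \<not> prime d. ?F d) = (\<Sum>d | d \<in> {1..N} \<and> \<not> prime d \<and> primepow d. ?F d)"
      by (rule sum.mono_neutral_right) (auto simp: mangoldt_def)
    also have "\<dots> \<le> (\<Sum>d\<in>(\<lambda>(p, k). p ^ k) ` (?P \<times> {2..N}). ?F d)"
    proof (rule sum_mono2)
      show "{d. d \<in> {1..N} \<and> \<not> prime d \<and> primepow d} \<subseteq> (\<lambda>(p, k). p ^ k) ` (?P \<times> {2..N})"
      proof
        fix d assume d: "d \<in> {d. d \<in> {1..N} \<and> \<not> prime d \<and> primepow d}"
        then obtain p k where pk: "prime p" "k > 0" "d = p ^ k" by (auto simp: primepow_def)
        have "k \<noteq> 1" using d pk by auto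
        hence k2: "k \<ge> 2" using pk(2) by simp
        have p2: "p \<ge> 2" using pk(1) by (rule prime_ge_2_nat)
        have "p ^ 1 \<le> p ^ k" using p2 k2 by (intro power_increasing) auto
        hence "p \<le> N" using d pk(3) by simp
        moreover have "k < p ^ k" using p2 by (intro power_gt_expt) auto
        hence "k \<le> N" using d pk(3) by simp
        ultimately show "d \<in> (\<lambda>(p, k). p ^ k) ` (?P \<times> {2..N})"
          using pk(1,3) k2 p2 by (auto intro!: image_eqI[of _ _ "(p, k)"])
      qed
    qed (auto simp: mangoldt_nonneg)
    also have "\<dots> \<le> (\<Sum>q\<in>?P \<times> {2..N}. (?F \<circ> (\<lambda>(p, k). p ^ k)) q)"
      by (rule sum_image_le) (auto simp: mangoldt_nonneg)
    also have "\<dots> = (\<Sum>p\<in>?P. \<Sum>k\<in>{2..N}. ?F (p ^ k))"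
      unfolding sum.cartesian_product by (intro sum.cong refl) auto
    also have "\<dots> \<le> (\<Sum>p\<in>?P. 16 * real p powr (-5/4))"
    proof (rule sum_mono)
      fix p assume p: "p \<in> ?P"
      hence pr: "prime p" "real p \<ge> 2" by auto
      define x where "x = real p powr (-3/4)"
      have x0: "x \<ge> 0" by (simp add: x_def)
      have x1: "x \<le> 3/4"
      proof -
        have "x \<le> real p powr (-1/2)" unfolding x_def using pr by (intro powr_mono) auto
        also have "\<dots> \<le> 2 powr (-1/2)" using pr(2) by (intro powr_mono2') auto
        also have "\<dots> = 1 / sqrt 2" using powr_minus_divide[of 2 "1/2 :: real"] by (simp add: powr_half_sqrt)
        also have "\<dots> \<le> 3/4"
        proof -
          have "4/3 \<le> sqrt (2::real)" by (rule real_le_rsqrt) (simp add: power2_eq_square)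
          thus ?thesis by (simp add: field_simps)
        qed
        finally show ?thesis .
      qed
      have "(\<Sum>k\<in>{2..N}. ?F (p ^ k)) = (\<Sum>k\<in>{2..N}. ln (real p) * x ^ k)"
      proof (rule sum.cong[OF refl])
        fix k assume k: "k \<in> {2..N}"
        have "von_mangoldt (p ^ k) = ln (real p)" using pr(1) k by simp
        moreover have "real (p ^ k) powr (-3/4) = x ^ k"
        proof -
          have "real (p ^ k) powr (-3/4) = (real p powr real k) powr (-3/4)"
            using pr(2) by (simp add: powr_realpow)
          also have "\<dots> = (real p powr (-3/4)) powr real k" by (simp only: powr_powr mult.commute)
          also have "\<dots> = x ^ k" unfolding x_def using pr(2) by (subst powr_realpow) auto
          finally show ?thesis .
        qed
        ultimately show "?F (p ^ k) = ln (real p) * x ^ k" by simp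
      qed
      also have "\<dots> = ln (real p) * (\<Sum>k\<in>{2..N}. x ^ k)" by (simp only: sum_distrib_left)
      also have "\<dots> \<le> ln (real p) * (4 * x\<^sup>2)"
        using pr(2) by (intro mult_left_mono sum_power_from_2_le x0 x1) auto
      also have "\<dots> \<le> (4 * real p powr (1/4)) * (4 * x\<^sup>2)"
      proof (rule mult_right_mono)
        have "ln (real p) = 4 * ln (real p powr (1/4))" using pr(2) by (simp add: ln_powr)
        also have "\<dots> \<le> 4 * real p powr (1/4)"
          using pr(2) ln_le_minus_one[of "real p powr (1/4)"] by simp
        finally show "ln (real p) \<le> 4 * real p powr (1/4)" .
      qed simp
      also have "\<dots> = 16 * (real p powr (1/4) * x\<^sup>2)" by simp
      also have "real p powr (1/4) * x\<^sup>2 = real p powr (-5/4)"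
        unfolding x_def power2_eq_square by (simp add: powr_add[symmetric])
      finally show "(\<Sum>k\<in>{2..N}. ?F (p ^ k)) \<le> 16 * real p powr (-5/4)" .
    qed
    also have "\<dots> = 16 * (\<Sum>p\<in>?P. real p powr (-5/4))" by (simp only: sum_distrib_left)
    also have "\<dots> \<le> 16 * (\<Sum>n::nat. real n powr (-5/4))"
      by (intro mult_left_mono sum_le_suminf[OF sm]) auto
    also have "\<dots> \<le> C" by (simp add: C_def)
    finally show ?thesis .
  qed
  thus ?thesis using nn by (intro exI[of _ C]) (auto simp: C_def)
qed

section \<open>Selberg weights\<close>

definition mobius :: "nat \<Rightarrow> real" where
  "mobius n = (if squarefree n then (-1) ^ card (prime_factors n) else 0)"

lemma abs_mobius_le_1: "\<bar>mobius n\<bar> \<le> 1"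
  by (simp add: mobius_def power_abs)

lemma mobius_1 [simp]: "mobius (Suc 0) = 1"
  using squarefree_1[where 'a = nat] by (simp add: mobius_def)

lemma mobius_prime_mult:
  assumes "prime p" "\<not> p dvd d" "squarefree (d::nat)"
  shows "mobius (p * d) = - mobius d"
proof -
  have d0: "d \<noteq> 0" using assms(3) by (metis not_squarefree_0)
  have sf: "squarefree (p * d)"
    by (rule squarefree_mult_coprime[OF prime_imp_coprime[OF assms(1,2)] squarefree_prime[OF assms(1)] assms(3)])
  have "prime_factors (p * d) = insert p (prime_factors d)"
    using assms(1) d0 by (simp add: prime_factors_product prime_prime_factors)
  moreover have "p \<notin> prime_factors d" using assms(2) by (auto dest: in_prime_factors_imp_dvd)
  ultimately show ?thesis using sf assms(3) by (simp add: mobius_def)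
qed

text \<open>
  If \<open>t \<noteq> q\<close>, take a prime \<open>p\<close> dividing \<open>t div q\<close>. Multiplication by \<open>p\<close> pairs the
  divisors not divisible by \<open>p\<close> with those divisible by \<open>p\<close>, reversing the sign of
  \<open>mobius\<close>.
\<close>
lemma sum_mobius_between:
  assumes t: "squarefree (t::nat)"
  shows "(\<Sum>d | d dvd t \<and> q dvd d. mobius d) = (if t = q then mobius q else 0)"
proof (cases "q dvd t \<and> t \<noteq> q")
  case False
  show ?thesis
  proof (cases "t = q")
    case True
    hence "{d. d dvd t \<and> q dvd d} = {q}" by (auto intro: dvd_antisym)
    thus ?thesis using True by simp
  next
    case ne: False
    hence empty: "{d. d dvd t \<and> q dvd d} = {}" using False dvd_trans by blast
    show ?thesis unfolding empty using ne by simp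
  qed
next
  case True
  have t0: "t > 0" using t by (metis not_squarefree_0 neq0_conv)
  obtain s where s: "t = q * s" using True by blast
  have "s \<noteq> 1" using s True by auto
  then obtain p where p: "prime p" "p dvd s" using prime_factor_nat by blast
  have pt: "p dvd t" using p(2) s by simp
  have pq: "\<not> p dvd q"
  proof
    assume "p dvd q"
    hence "p ^ 2 dvd t" using p(2) unfolding s power2_eq_square by (intro mult_dvd_mono)
    hence "p dvd 1" using t squarefreeD by blast
    thus False using p(1) by simp
  qed
  define A where "A = {d. d dvd t \<and> q dvd d \<and> \<not> p dvd d}"
  define B where "B = {d. d dvd t \<and> q dvd d \<and> p dvd d}"
  have fin: "finite A" "finite B"
    unfolding A_def B_def by (rule finite_subset[of _ "{d. d dvd t}"]; use t0 in auto)+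
  have "{d. d dvd t \<and> q dvd d} = A \<union> B" by (auto simp: A_def B_def)
  hence "(\<Sum>d | d dvd t \<and> q dvd d. mobius d) = (\<Sum>d\<in>A. mobius d) + (\<Sum>d\<in>B. mobius d)"
    using fin by (simp only:, intro sum.union_disjoint) (auto simp: A_def B_def)
  also have "(\<Sum>d\<in>B. mobius d) = (\<Sum>d\<in>A. - mobius d)"
  proof (rule sum.reindex_bij_witness[where i = "\<lambda>d. p * d" and j = "\<lambda>d. d div p"])
    fix d assume "d \<in> B"
    hence d: "d dvd t" "q dvd d" "p dvd d" by (auto simp: B_def)
    obtain e where e: "d = p * e" using d(3) by blast
    have p0: "p > 0" using p(1) prime_gt_0_nat by blast
    have dp: "d div p = e" using e p0 by simp
    show "p * (d div p) = d" using e p0 by simp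
    have sd: "squarefree d" using d(1) t squarefree_mono by blast
    have pe: "\<not> p dvd e"
    proof
      assume "p dvd e"
      hence "p ^ 2 dvd d" unfolding e power2_eq_square by (intro mult_dvd_mono) auto
      hence "p dvd 1" using sd squarefreeD by blast
      thus False using p(1) by simp
    qed
    have "coprime q p" using prime_imp_coprime[OF p(1) pq] by (simp add: coprime_commute)
    hence "q dvd e" using d(2) unfolding e by (simp add: coprime_dvd_mult_right_iff)
    moreover have "e dvd t" using d(1) e dvd_trans[of e d t] by simp
    ultimately show "d div p \<in> A" unfolding dp using pe by (simp add: A_def)
    have "squarefree e" using sd e squarefree_mono[of e d] by simp
    from mobius_prime_mult[OF p(1) pe this]
    show "- mobius (d div p) = mobius d" unfolding dp unfolding e by simp
  next
    fix d assume "d \<in> A"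
    hence d: "d dvd t" "q dvd d" "\<not> p dvd d" by (auto simp: A_def)
    show "(p * d) div p = d" using p(1) prime_gt_0_nat by simp
    have "coprime p d" using prime_imp_coprime[OF p(1) d(3)] .
    hence "p * d dvd t" using pt d(1) by (intro divides_mult) auto
    thus "p * d \<in> B" using d(2) by (simp add: B_def)
  qed
  finally have "(\<Sum>d | d dvd t \<and> q dvd d. mobius d) = 0" by (simp add: sum_negf)
  thus ?thesis using True by simp
qed

definition squarefrees_upto :: "nat \<Rightarrow> nat set" where
  "squarefrees_upto D = {t \<in> {1..D}. squarefree t}"

definition squarefree_harmonic :: "nat \<Rightarrow> real" where
  "squarefree_harmonic D = (\<Sum>t\<in>squarefrees_upto D. 1 / real t)"

text \<open>
  Selberg's optimal weights have \<open>1 / totient t\<close> in place of \<open>1 / t\<close>. With \<open>1 / t\<close> the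
  quadratic form is still at most the reciprocal of \<open>squarefree_harmonic D\<close>, which is at most
  a constant over \<open>ln D\<close>; only the constant is worse.
\<close>
definition selberg_weight :: "nat \<Rightarrow> nat \<Rightarrow> real" where
  "selberg_weight D d = mobius d * real d / squarefree_harmonic D *
     (\<Sum>t | t \<in> squarefrees_upto D \<and> d dvd t. 1 / real t)"

lemma finite_squarefrees_upto [simp]: "finite (squarefrees_upto D)"
  by (simp add: squarefrees_upto_def)

lemma squarefree_harmonic_ge_1: "D \<ge> 1 \<Longrightarrow> squarefree_harmonic D \<ge> 1"
proof -
  assume "D \<ge> 1"
  hence "(\<Sum>t\<in>{1}. 1 / real t) \<le> squarefree_harmonic D"
    unfolding squarefree_harmonic_def using squarefree_1[where 'a = nat]
    by (intro sum_mono2) (auto simp: squarefrees_upto_def)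
  thus ?thesis by simp
qed

lemma sum_inverse_squares_le: "(\<Sum>s\<in>{1..n}. 1 / (real s)\<^sup>2) \<le> 2"
proof -
  have "(\<Sum>s\<in>{1..Suc n}. 1 / (real s)\<^sup>2) \<le> 2 - 1 / real (Suc n)" for n
  proof (induction n)
    case (Suc n)
    have "1 / (real (Suc (Suc n)))\<^sup>2 \<le> 1 / (real (Suc n) * real (Suc (Suc n)))"
      unfolding power2_eq_square by (intro divide_left_mono mult_right_mono) auto
    also have "\<dots> = 1 / real (Suc n) - 1 / real (Suc (Suc n))" by (simp add: field_simps)
    finally show ?case using Suc.IH by simp
  qed simp
  from this[of "n - 1"] show ?thesis
    by (cases n) (auto intro: order.trans simp: divide_nonneg_nonneg)
qed

text \<open>
  Every \<open>n\<close> is a squarefree number times a square, so the harmonic sum is at most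
  \<open>squarefree_harmonic D\<close> times the sum of the reciprocal squares.
\<close>
lemma ln_le_squarefree_harmonic:
  assumes "D \<ge> 1"
  shows "ln (real D) \<le> 2 * squarefree_harmonic D"
proof -
  have "ln (real D) \<le> ln (real D + 1)" using assms by simp
  also have "\<dots> \<le> harm D" by (rule ln_le_harm)
  also have "\<dots> = (\<Sum>n\<in>{1..D}. 1 / real n)" by (simp add: harm_def divide_inverse)
  also have "\<dots> \<le> (\<Sum>n\<in>(\<lambda>(t, s). t * s\<^sup>2) ` (squarefrees_upto D \<times> {1..D}). 1 / real n)"
  proof (rule sum_mono2)
    show "{1..D} \<subseteq> (\<lambda>(t, s). t * s\<^sup>2) ` (squarefrees_upto D \<times> {1..D})"
    proof
      fix n assume n: "n \<in> {1..D}"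
      define t where "t = squarefree_part n"
      define s where "s = square_part n"
      have nts: "n = t * s\<^sup>2" unfolding t_def s_def by (rule squarefree_decompose)
      have sft: "squarefree t" unfolding t_def by (rule squarefree_squarefree_part)
      have t0: "t \<ge> 1" using nts n by (cases t) auto
      have s0: "s \<ge> 1" using nts n by (cases s) auto
      have "t * 1 \<le> t * s\<^sup>2" using s0 by (intro mult_left_mono) auto
      hence "t \<le> n" by (simp only: nts[symmetric] mult_1_right)
      hence "t \<le> D" using n by simp
      moreover have "1 * s \<le> t * (s * s)" using t0 s0 by (intro mult_mono) auto
      hence "s \<le> n" by (simp only: nts[symmetric] power2_eq_square[symmetric] mult_1_left)
      hence "s \<le> D" using n by simp
      ultimately have "(t, s) \<in> squarefrees_upto D \<times> {1..D}" using sft t0 s0 by (simp add: squarefrees_upto_def)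
      moreover have "n = (\<lambda>(t, s). t * s\<^sup>2) (t, s)" using nts by simp
      ultimately show "n \<in> (\<lambda>(t, s). t * s\<^sup>2) ` (squarefrees_upto D \<times> {1..D})" by (rule rev_image_eqI)
    qed
  qed auto
  also have "\<dots> \<le> (\<Sum>p\<in>squarefrees_upto D \<times> {1..D}. ((\<lambda>n. 1 / real n) \<circ> (\<lambda>(t, s). t * s\<^sup>2)) p)"
    by (rule sum_image_le) auto
  also have "\<dots> = (\<Sum>(t, s)\<in>squarefrees_upto D \<times> {1..D}. 1 / real t * (1 / (real s)\<^sup>2))"
    by (intro sum.cong refl) auto
  also have "\<dots> = squarefree_harmonic D * (\<Sum>s\<in>{1..D}. 1 / (real s)\<^sup>2)"
    unfolding squarefree_harmonic_def sum_product by (rule sum.cartesian_product[symmetric])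
  also have "\<dots> \<le> squarefree_harmonic D * 2"
    using squarefree_harmonic_ge_1[OF assms] by (intro mult_left_mono sum_inverse_squares_le) auto
  finally show ?thesis by simp
qed

lemma selberg_weight_1:
  assumes "D \<ge> 1"
  shows "selberg_weight D 1 = 1"
proof -
  have "{t. t \<in> squarefrees_upto D \<and> 1 dvd t} = squarefrees_upto D" by auto
  thus ?thesis using squarefree_harmonic_ge_1[OF assms]
    by (simp add: selberg_weight_def squarefree_harmonic_def)
qed

lemma abs_selberg_weight_le:
  assumes "D \<ge> 1"
  shows "\<bar>selberg_weight D d\<bar> \<le> real d"
proof -
  have G: "squarefree_harmonic D \<ge> 1" by (rule squarefree_harmonic_ge_1[OF assms])
  define T where "T = (\<Sum>t | t \<in> squarefrees_upto D \<and> d dvd t. 1 / real t)"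
  have T: "0 \<le> T" "T \<le> squarefree_harmonic D"
    unfolding T_def squarefree_harmonic_def by (intro sum_nonneg sum_mono2; auto)+
  have "\<bar>selberg_weight D d\<bar> = \<bar>mobius d\<bar> * real d * (T / squarefree_harmonic D)"
    unfolding selberg_weight_def T_def[symmetric] using T G by (simp add: abs_mult)
  also have "\<dots> \<le> 1 * real d * 1"
    using T G by (intro mult_mono abs_mobius_le_1) auto
  finally show ?thesis by simp
qed

text \<open>
  The change of variables that diagonalises the quadratic form: after interchanging the sums over
  \<open>d\<close> and \<open>t\<close>, the inner sum of \<open>mobius\<close> isolates \<open>t = q\<close>.
\<close>
lemma selberg_weight_dual:
  assumes "D \<ge> 1" "q \<ge> 1"
  shows "(\<Sum>d | d \<in> {1..D} \<and> q dvd d. selberg_weight D d / real d) =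
     (if q \<in> squarefrees_upto D then mobius q / (real q * squarefree_harmonic D) else 0)"
proof -
  let ?G = "squarefree_harmonic D" and ?S = "squarefrees_upto D"
  have "(\<Sum>d | d \<in> {1..D} \<and> q dvd d. selberg_weight D d / real d) =
     (\<Sum>d | d \<in> {1..D} \<and> q dvd d. \<Sum>t | t \<in> ?S \<and> d dvd t. mobius d * (1 / (?G * real t)))"
  proof (rule sum.cong[OF refl])
    fix d assume "d \<in> {d. d \<in> {1..D} \<and> q dvd d}"
    hence "real d > 0" by auto
    hence "selberg_weight D d / real d = (mobius d / ?G) * (\<Sum>t | t \<in> ?S \<and> d dvd t. 1 / real t)"
      by (simp add: selberg_weight_def)
    also have "\<dots> = (\<Sum>t | t \<in> ?S \<and> d dvd t. mobius d * (1 / (?G * real t)))"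
      unfolding sum_distrib_left by (intro sum.cong refl) simp
    finally show "selberg_weight D d / real d = (\<Sum>t | t \<in> ?S \<and> d dvd t. mobius d * (1 / (?G * real t)))" .
  qed
  also have "\<dots> = (\<Sum>(d,t)\<in>Sigma {d. d \<in> {1..D} \<and> q dvd d} (\<lambda>d. {t. t \<in> ?S \<and> d dvd t}). mobius d * (1 / (?G * real t)))"
    by (rule sum.Sigma) auto
  also have "\<dots> = (\<Sum>(t,d)\<in>Sigma ?S (\<lambda>t. {d. d dvd t \<and> q dvd d}). mobius d * (1 / (?G * real t)))"
  proof (rule sum.reindex_bij_witness[where i = "\<lambda>(t,d). (d,t)" and j = "\<lambda>(d,t). (t,d)"])
    fix p assume "p \<in> Sigma ?S (\<lambda>t. {d. d dvd t \<and> q dvd d})"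
    then obtain t d where p: "p = (t, d)" "t \<in> ?S" "d dvd t" "q dvd d" by auto
    have t: "1 \<le> t" "t \<le> D" using p(2) by (auto simp: squarefrees_upto_def)
    have "d \<le> t" "d \<ge> 1" using dvd_imp_le[OF p(3)] p(3) t(1) by (auto intro!: Suc_leI Nat.gr0I)
    thus "(case p of (t, d) \<Rightarrow> (d, t)) \<in> Sigma {d. d \<in> {1..D} \<and> q dvd d} (\<lambda>d. {t. t \<in> ?S \<and> d dvd t})"
      using p t by simp
  qed auto
  also have "\<dots> = (\<Sum>t\<in>?S. \<Sum>d | d dvd t \<and> q dvd d. mobius d * (1 / (?G * real t)))"
    by (rule sum.Sigma[symmetric]) (auto simp: squarefrees_upto_def)
  also have "\<dots> = (\<Sum>t\<in>?S. (if t = q then mobius q else 0) * (1 / (?G * real t)))"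
  proof (rule sum.cong[OF refl])
    fix t assume "t \<in> ?S"
    hence "squarefree t" by (simp add: squarefrees_upto_def)
    thus "(\<Sum>d | d dvd t \<and> q dvd d. mobius d * (1 / (?G * real t))) = (if t = q then mobius q else 0) * (1 / (?G * real t))"
      by (simp only: sum_distrib_right[symmetric] sum_mobius_between)
  qed
  also have "\<dots> = (\<Sum>t\<in>?S. if t = q then mobius q / (real q * ?G) else 0)"
    by (intro sum.cong refl) (auto simp: mult.commute)
  also have "\<dots> = (if q \<in> ?S then mobius q / (real q * ?G) else 0)" by simp
  finally show ?thesis .
qed

lemma gcd_eq_totient_sum:
  assumes "a \<in> {1..D}"
  shows "real (gcd a b) = (\<Sum>q\<in>{1..D::nat}. if q dvd a \<and> q dvd b then real (totient q) else 0)"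
proof -
  have sub: "{q. q dvd gcd a b} = {q \<in> {1..D}. q dvd a \<and> q dvd b}"
    using assms by (auto dest: dvd_imp_le intro!: Suc_leI Nat.gr0I)
  have "real (gcd a b) = real (\<Sum>q | q dvd gcd a b. totient q)"
    by (simp only: totient_divisor_sum)
  also have "\<dots> = (\<Sum>q\<in>{q \<in> {1..D}. q dvd a \<and> q dvd b}. real (totient q))"
    unfolding sub by simp
  also have "\<dots> = (\<Sum>q\<in>{1..D}. if q dvd a \<and> q dvd b then real (totient q) else 0)"
    by (rule sum.inter_filter) simp
  finally show ?thesis .
qed

text \<open>
  Writing \<open>1 / lcm d e\<close> as \<open>gcd d e / (d * e)\<close> and \<open>gcd d e\<close> as a sum of
  \<open>totient q\<close> over the common divisors \<open>q\<close> turns the form into a sum of squares, whose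
  terms are given by \<open>selberg_weight_dual\<close>.
\<close>
lemma selberg_quadratic_form_le:
  assumes "D \<ge> 1"
  shows "(\<Sum>d\<in>{1..D}. \<Sum>e\<in>{1..D}. selberg_weight D d * selberg_weight D e / real (lcm d e))
     \<le> 1 / squarefree_harmonic D"
proof -
  let ?r = "selberg_weight D" and ?G = "squarefree_harmonic D" and ?S = "squarefrees_upto D"
  have G: "?G \<ge> 1" by (rule squarefree_harmonic_ge_1[OF assms])
  have "(\<Sum>d\<in>{1..D}. \<Sum>e\<in>{1..D}. ?r d * ?r e / real (lcm d e)) =
    (\<Sum>d\<in>{1..D}. \<Sum>e\<in>{1..D}. \<Sum>q\<in>{1..D}. real (totient q) *
      ((if q dvd d then ?r d / real d else 0) * (if q dvd e then ?r e / real e else 0)))"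
  proof (intro sum.cong refl)
    fix d e assume d: "d \<in> {1..D}" and e: "e \<in> {1..D}"
    have "real (lcm d e) * real (gcd d e) = real d * real e"
      using prod_gcd_lcm_nat[of d e] by (metis mult.commute of_nat_mult)
    hence "1 / real (lcm d e) = real (gcd d e) / (real d * real e)"
      using d e by (simp add: field_simps)
    hence "?r d * ?r e / real (lcm d e) = real (gcd d e) * ((?r d / real d) * (?r e / real e))"
      by (simp add: divide_inverse mult_ac)
    also have "\<dots> = (\<Sum>q\<in>{1..D}. real (totient q) *
      ((if q dvd d then ?r d / real d else 0) * (if q dvd e then ?r e / real e else 0)))"
      unfolding gcd_eq_totient_sum[OF d] sum_distrib_right by (intro sum.cong refl) auto
    finally show "?r d * ?r e / real (lcm d e) = (\<Sum>q\<in>{1..D}. real (totient q) *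
      ((if q dvd d then ?r d / real d else 0) * (if q dvd e then ?r e / real e else 0)))" .
  qed
  also have "\<dots> = (\<Sum>q\<in>{1..D}. \<Sum>d\<in>{1..D}. \<Sum>e\<in>{1..D}. real (totient q) *
      ((if q dvd d then ?r d / real d else 0) * (if q dvd e then ?r e / real e else 0)))"
    by (rule trans[OF sum.cong[OF refl sum.swap] sum.swap])
  also have "\<dots> = (\<Sum>q\<in>{1..D}. real (totient q) * (\<Sum>d | d \<in> {1..D} \<and> q dvd d. ?r d / real d)\<^sup>2)"
  proof (rule sum.cong[OF refl])
    fix q
    have f: "(\<Sum>d | d \<in> {1..D} \<and> q dvd d. ?r d / real d) = (\<Sum>d\<in>{1..D}. if q dvd d then ?r d / real d else 0)"
      by (rule sum.inter_filter) simp
    show "(\<Sum>d\<in>{1..D}. \<Sum>e\<in>{1..D}. real (totient q) *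
      ((if q dvd d then ?r d / real d else 0) * (if q dvd e then ?r e / real e else 0))) =
      real (totient q) * (\<Sum>d | d \<in> {1..D} \<and> q dvd d. ?r d / real d)\<^sup>2"
      unfolding f power2_eq_square sum_product by (simp only: sum_distrib_left)
  qed
  also have "\<dots> = (\<Sum>q\<in>{1..D}. if q \<in> ?S then real (totient q) * (mobius q / (real q * ?G))\<^sup>2 else 0)"
    by (intro sum.cong refl) (use selberg_weight_dual[OF assms] in simp)
  also have "\<dots> = (\<Sum>q\<in>{q\<in>{1..D}. q \<in> ?S}. real (totient q) * (mobius q / (real q * ?G))\<^sup>2)"
    by (rule sum.inter_filter[symmetric]) simp
  also have "{q\<in>{1..D}. q \<in> ?S} = ?S" by (auto simp: squarefrees_upto_def)
  also have "(\<Sum>q\<in>?S. real (totient q) * (mobius q / (real q * ?G))\<^sup>2) \<le> (\<Sum>q\<in>?S. (1 / real q) * (1 / ?G\<^sup>2))"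
  proof (rule sum_mono)
    fix q assume "q \<in> ?S"
    hence q: "real q > 0" by (auto simp: squarefrees_upto_def)
    have "(mobius q)\<^sup>2 \<le> 1" using abs_mobius_le_1[of q] abs_square_le_1 by blast
    hence "real (totient q) * (mobius q)\<^sup>2 \<le> real q * 1"
      by (intro mult_mono) (auto simp: totient_le)
    hence "real (totient q) * (mobius q)\<^sup>2 / (real q * ?G)\<^sup>2 \<le> real q * 1 / (real q * ?G)\<^sup>2"
      by (rule divide_right_mono) simp
    also have "\<dots> = (1 / real q) * (1 / ?G\<^sup>2)" using q G by (simp add: power2_eq_square)
    finally show "real (totient q) * (mobius q / (real q * ?G))\<^sup>2 \<le> (1 / real q) * (1 / ?G\<^sup>2)"
      by (simp add: power_divide)
  qed
  also have "\<dots> = ?G * (1 / ?G\<^sup>2)" by (simp only: sum_distrib_right[symmetric] squarefree_harmonic_def[symmetric])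
  also have "\<dots> = 1 / ?G" using G by (simp add: power2_eq_square)
  finally show ?thesis .
qed

section \<open>Second moments over primes\<close>

lemma sum_multiples:
  assumes "l > (0::nat)"
  shows "(\<Sum>m\<in>{1..Y}. if l dvd m then F m else 0) = (\<Sum>r\<in>{1..Y div l}. F (l * r))"
proof -
  have "(\<Sum>m\<in>{1..Y}. if l dvd m then F m else 0) = (\<Sum>m\<in>{m\<in>{1..Y}. l dvd m}. F m)"
    by (rule sum.inter_filter[symmetric]) simp
  also have "\<dots> = (\<Sum>r\<in>{1..Y div l}. F (l * r))"
  proof (rule sum.reindex_bij_witness[where i = "\<lambda>r. l * r" and j = "\<lambda>m. m div l"])
    fix m assume "m \<in> {m\<in>{1..Y}. l dvd m}"
    hence m: "1 \<le> m" "m \<le> Y" "l dvd m" by auto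
    show "l * (m div l) = m" using m(3) by simp
    have "m div l \<le> Y div l" using m(2) by (rule div_le_mono)
    moreover have "1 \<le> m div l" using dvd_imp_le[OF m(3)] m(1) assms by (simp add: less_eq_div_iff_mult_less_eq)
    ultimately show "m div l \<in> {1..Y div l}" by simp
    show "F (l * (m div l)) = F m" using m(3) by simp
  next
    fix r assume r: "r \<in> {1..Y div l}"
    show "(l * r) div l = r" using assms by simp
    have "l * r \<le> Y" using r assms by (simp add: less_eq_div_iff_mult_less_eq mult.commute)
    moreover have "1 \<le> l * r" using r assms by simp
    ultimately show "l * r \<in> {m\<in>{1..Y}. l dvd m}" by simp
  qed
  finally show ?thesis .
qed

text \<open>
  A nonnegative function that is 1 at all primes above \<open>D\<close> (\<open>selberg_majorant_prime\<close>).
  Since it is a short divisor sum, its correlations with characters are as easy to bound as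
  plain character sums.
\<close>
definition selberg_majorant :: "nat \<Rightarrow> nat \<Rightarrow> real" where
  "selberg_majorant D m = (\<Sum>d\<in>{1..D}. if d dvd m then selberg_weight D d else 0)\<^sup>2"

lemma selberg_majorant_nonneg: "selberg_majorant D m \<ge> 0"
  by (simp add: selberg_majorant_def)

lemma selberg_majorant_prime:
  assumes "prime p" "p > D" "D \<ge> 1"
  shows "selberg_majorant D p = 1"
proof -
  have "(\<Sum>d\<in>{1..D}. if d dvd p then selberg_weight D d else 0) = (\<Sum>d\<in>{1}. selberg_weight D d)"
  proof (rule sum.mono_neutral_cong_right)
    show "\<forall>d\<in>{1..D} - {1}. (if d dvd p then selberg_weight D d else 0) = 0"
    proof
      fix d assume "d \<in> {1..D} - {1}"
      hence "d \<noteq> 1" "d \<noteq> p" using assms(2) by auto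
      hence "\<not> d dvd p" using assms(1) prime_nat_iff by blast
      thus "(if d dvd p then selberg_weight D d else 0) = 0" by simp
    qed
  qed (use assms in auto)
  thus ?thesis using selberg_weight_1[OF assms(3)] by (simp add: selberg_majorant_def)
qed

lemma selberg_majorant_expand:
  "selberg_majorant D m = (\<Sum>d\<in>{1..D}. \<Sum>e\<in>{1..D}.
     selberg_weight D d * selberg_weight D e * (if lcm d e dvd m then 1 else 0))"
  unfolding selberg_majorant_def power2_eq_square sum_product
  by (intro sum.cong refl) auto

lemma sum_selberg_majorant_times:
  "(\<Sum>m\<in>{1..Y}. selberg_majorant D m * F m) = (\<Sum>d\<in>{1..D}. \<Sum>e\<in>{1..D}.
     selberg_weight D d * selberg_weight D e * (\<Sum>r\<in>{1..Y div lcm d e}. F (lcm d e * r)))"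
proof -
  have "(\<Sum>m\<in>{1..Y}. selberg_majorant D m * F m) = (\<Sum>m\<in>{1..Y}. \<Sum>d\<in>{1..D}. \<Sum>e\<in>{1..D}.
     selberg_weight D d * selberg_weight D e * (if lcm d e dvd m then F m else 0))"
    unfolding selberg_majorant_expand sum_distrib_right by (intro sum.cong refl) auto
  also have "\<dots> = (\<Sum>d\<in>{1..D}. \<Sum>e\<in>{1..D}. \<Sum>m\<in>{1..Y}.
     selberg_weight D d * selberg_weight D e * (if lcm d e dvd m then F m else 0))"
    by (rule trans[OF sum.swap sum.cong[OF refl sum.swap]])
  also have "\<dots> = (\<Sum>d\<in>{1..D}. \<Sum>e\<in>{1..D}.
     selberg_weight D d * selberg_weight D e * (\<Sum>r\<in>{1..Y div lcm d e}. F (lcm d e * r)))"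
  proof (intro sum.cong refl)
    fix d e assume "d \<in> {1..D}" "e \<in> {1..D}"
    hence "lcm d e > 0" by (simp add: lcm_pos_nat)
    thus "(\<Sum>m\<in>{1..Y}. selberg_weight D d * selberg_weight D e * (if lcm d e dvd m then F m else 0)) =
      selberg_weight D d * selberg_weight D e * (\<Sum>r\<in>{1..Y div lcm d e}. F (lcm d e * r))"
      unfolding sum_distrib_left[symmetric] by (simp only: sum_multiples)
  qed
  finally show ?thesis .
qed

lemma abs_selberg_weight_prod_le:
  assumes "d \<in> {1..D}" "e \<in> {1..D}"
  shows "\<bar>selberg_weight D d * selberg_weight D e\<bar> \<le> real D * real D"
proof -
  have D: "D \<ge> 1" using assms by simp
  have "\<bar>selberg_weight D d\<bar> \<le> real D" "\<bar>selberg_weight D e\<bar> \<le> real D"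
    using abs_selberg_weight_le[OF D, of d] abs_selberg_weight_le[OF D, of e] assms by auto
  thus ?thesis unfolding abs_mult by (intro mult_mono) auto
qed

lemma sum_selberg_majorant_le:
  assumes "D \<ge> 1"
  shows "(\<Sum>m\<in>{1..Y}. selberg_majorant D m) \<le> real Y / squarefree_harmonic D + real D ^ 4"
proof -
  let ?r = "selberg_weight D"
  have "(\<Sum>m\<in>{1..Y}. selberg_majorant D m) = (\<Sum>d\<in>{1..D}. \<Sum>e\<in>{1..D}. ?r d * ?r e * real (Y div lcm d e))"
    using sum_selberg_majorant_times[of D "\<lambda>_. 1" Y] by simp
  also have "\<dots> \<le> (\<Sum>d\<in>{1..D}. \<Sum>e\<in>{1..D}. real Y * (?r d * ?r e / real (lcm d e)) + real D * real D)"
  proof (intro sum_mono)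
    fix d e assume de: "d \<in> {1..D}" "e \<in> {1..D}"
    let ?l = "lcm d e"
    have "\<lfloor>real Y / real ?l\<rfloor> = int (Y div ?l)" by (rule floor_divide_of_nat_eq)
    hence "\<bar>real (Y div ?l) - real Y / real ?l\<bar> \<le> 1"
      using real_of_int_floor_add_one_ge[of "real Y / real ?l"] of_int_floor_le[of "real Y / real ?l"] by simp
    hence "\<bar>?r d * ?r e\<bar> * \<bar>real (Y div ?l) - real Y / real ?l\<bar> \<le> (real D * real D) * 1"
      by (intro mult_mono abs_selberg_weight_prod_le de) auto
    hence "\<bar>?r d * ?r e * (real (Y div ?l) - real Y / real ?l)\<bar> \<le> real D * real D"
      by (simp only: abs_mult mult_1_right)
    hence "?r d * ?r e * (real (Y div ?l) - real Y / real ?l) \<le> real D * real D" by linarith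
    thus "?r d * ?r e * real (Y div ?l) \<le> real Y * (?r d * ?r e / real ?l) + real D * real D"
      by (simp add: right_diff_distrib mult.commute)
  qed
  also have "\<dots> = real Y * (\<Sum>d\<in>{1..D}. \<Sum>e\<in>{1..D}. ?r d * ?r e / real (lcm d e)) + real D ^ 4"
    by (simp add: sum.distrib sum_distrib_left power4_eq_xxxx)
  also have "\<dots> \<le> real Y * (1 / squarefree_harmonic D) + real D ^ 4"
    by (intro add_right_mono mult_left_mono selberg_quadratic_form_le assms) auto
  finally show ?thesis by simp
qed

lemma sum_selberg_majorant_jacobi_le:
  assumes "odd k" "\<not> is_square k"
  shows "\<bar>\<Sum>m | m \<in> {1..Y} \<and> odd m. selberg_majorant D m * of_int (jacobi_symbol (int k) m)\<bar>
     \<le> real D ^ 4 * (2 * sqrt (real k) * sigma_half k * harm k)"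
proof -
  let ?r = "selberg_weight D" and ?B = "2 * sqrt (real k) * sigma_half k * harm k"
  let ?J = "\<lambda>m. real_of_int (jacobi_symbol (int k) m)"
  let ?F = "\<lambda>m. if odd m then ?J m else 0"
  have B0: "?B \<ge> 0" by (intro mult_nonneg_nonneg sigma_half_nonneg harm_nonneg) auto
  have "(\<Sum>m | m \<in> {1..Y} \<and> odd m. selberg_majorant D m * ?J m) = (\<Sum>m\<in>{1..Y}. if odd m then selberg_majorant D m * ?J m else 0)"
    by (rule sum.inter_filter) simp
  also have "\<dots> = (\<Sum>m\<in>{1..Y}. selberg_majorant D m * ?F m)"
    by (intro sum.cong refl) auto
  also have "\<dots> = (\<Sum>d\<in>{1..D}. \<Sum>e\<in>{1..D}. ?r d * ?r e * (\<Sum>r\<in>{1..Y div lcm d e}. ?F (lcm d e * r)))"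
    by (rule sum_selberg_majorant_times)
  finally have eq: "(\<Sum>m | m \<in> {1..Y} \<and> odd m. selberg_majorant D m * ?J m) =
    (\<Sum>d\<in>{1..D}. \<Sum>e\<in>{1..D}. ?r d * ?r e * (\<Sum>r\<in>{1..Y div lcm d e}. ?F (lcm d e * r)))" .
  have inner: "\<bar>\<Sum>r\<in>{1..X}. ?F (l * r)\<bar> \<le> ?B" for l X
  proof (cases "odd l")
    case False
    hence "(\<Sum>r\<in>{1..X}. ?F (l * r)) = 0" by simp
    thus ?thesis using B0 by simp
  next
    case True
    have l0: "l > 0" using True by (auto intro: Nat.gr0I)
    have "(\<Sum>r\<in>{1..X}. ?F (l * r)) = (\<Sum>r\<in>{1..X}. ?J l * (if odd r then ?J r else 0))"
      using True l0 by (intro sum.cong refl) (auto simp: jacobi_symbol_mult_bottom)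
    also have "\<dots> = ?J l * (\<Sum>r\<in>{1..X}. if odd r then ?J r else 0)" by (simp only: sum_distrib_left)
    also have "(\<Sum>r\<in>{1..X}. if odd r then ?J r else 0) = (\<Sum>r | r \<in> {1..X} \<and> odd r. ?J r)"
      by (rule sum.inter_filter[symmetric]) simp
    finally have "\<bar>\<Sum>r\<in>{1..X}. ?F (l * r)\<bar> = \<bar>?J l\<bar> * \<bar>\<Sum>r | r \<in> {1..X} \<and> odd r. ?J r\<bar>"
      by (simp only: abs_mult)
    also have "\<dots> \<le> 1 * ?B"
      by (intro mult_mono abs_jacobi_le_1 polya_vinogradov_odd assms) auto
    finally show ?thesis by simp
  qed
  have "\<bar>\<Sum>m | m \<in> {1..Y} \<and> odd m. selberg_majorant D m * ?J m\<bar>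
     \<le> (\<Sum>d\<in>{1..D}. \<bar>\<Sum>e\<in>{1..D}. ?r d * ?r e * (\<Sum>r\<in>{1..Y div lcm d e}. ?F (lcm d e * r))\<bar>)"
    unfolding eq by (rule sum_abs)
  also have "\<dots> \<le> (\<Sum>d\<in>{1..D}. \<Sum>e\<in>{1..D}. \<bar>?r d * ?r e * (\<Sum>r\<in>{1..Y div lcm d e}. ?F (lcm d e * r))\<bar>)"
    by (intro sum_mono sum_abs)
  also have "\<dots> \<le> (\<Sum>d\<in>{1..D}. \<Sum>e\<in>{1..D}. (real D * real D) * ?B)"
  proof (intro sum_mono)
    fix d e assume de: "d \<in> {1..D}" "e \<in> {1..D}"
    show "\<bar>?r d * ?r e * (\<Sum>r\<in>{1..Y div lcm d e}. ?F (lcm d e * r))\<bar> \<le> (real D * real D) * ?B"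
      unfolding abs_mult[of "?r d * ?r e"]
      by (intro mult_mono abs_selberg_weight_prod_le de inner) auto
  qed
  also have "\<dots> = real D ^ 4 * ?B" by (simp add: power4_eq_xxxx)
  finally show ?thesis .
qed

text \<open>
  If \<open>D\<close> is the integer part of the sixteenth root of \<open>Y\<close>, then \<open>ln Y\<close> and \<open>ln D\<close>
  have the same order of magnitude.
\<close>
lemma ln_le_root_16:
  assumes "Y < (D + 1) ^ 16" "D \<ge> 2" "Y \<ge> 1"
  shows "ln (real Y) \<le> 32 * ln (real D)"
proof -
  have "D + 1 \<le> D ^ 2" 
  proof -
    have "2 * D \<le> D * D" using assms(2) by (rule mult_le_mono1)
    thus ?thesis using assms(2) unfolding power2_eq_square by linarith
  qed
  hence "(D + 1) ^ 16 \<le> (D ^ 2) ^ 16" by (rule power_mono) simp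
  hence "Y \<le> D ^ 32" using assms(1) by (simp add: power_mult[symmetric])
  hence "real Y \<le> real D ^ 32" by (metis of_nat_le_iff of_nat_power)
  hence "ln (real Y) \<le> ln (real D ^ 32)" using assms by (subst ln_le_cancel_iff) auto
  also have "\<dots> = 32 * ln (real D)" using assms by (simp add: ln_realpow)
  finally show ?thesis .
qed

text \<open>
  Primes up to \<open>D\<close>, about the sixteenth root of \<open>Y\<close>, are estimated trivially. The others
  are weighted by the Selberg majorant, whose total mass is \<open>O(Y / ln D)\<close>; this gains back the
  factor \<open>ln p \<le> ln Y\<close>. The condition \<open>Y \<ge> N ^ 16\<close> yields \<open>N \<le> D\<close>, and all error
  terms, being at most a constant times \<open>D ^ 7 N ln N\<close>, are absorbed by \<open>D ^ 16 \<le> Y\<close>.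
\<close>
lemma prime_second_moment:
  "\<exists>C>0. \<forall>N\<ge>2. \<forall>Y\<ge>N ^ 16. \<forall>a. admissible a \<longrightarrow>
     (\<Sum>p | p \<in> {1..Y} \<and> prime p \<and> odd p. ln (real p) * (norm (jacobi_sum a N p))\<^sup>2)
       \<le> C * (real Y * real N * ln (real N))"
proof -
  obtain C1 where C1: "C1 > 0" "\<And>N. N \<ge> 2 \<Longrightarrow>
    (\<Sum>(m,n)\<in>odd_nonsquare_pairs N. sqrt (real (m * n)) * sigma_half (m * n) * harm (m * n)) \<le> C1 * real N ^ 3 * ln (real N)"
    using nonsquare_pairs_bound by blast
  have "(\<Sum>p | p \<in> {1..Y} \<and> prime p \<and> odd p. ln (real p) * (norm (jacobi_sum a N p))\<^sup>2)
       \<le> (290 + 64 * C1) * (real Y * real N * ln (real N))"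
    if N: "N \<ge> 2" and Y: "Y \<ge> N ^ 16" and adm: "admissible a" for N Y a
  proof -
    define D where "D = nth_root_nat 16 Y"
    have D1: "D ^ 16 \<le> Y" unfolding D_def by (rule nth_root_nat_power_le) simp
    have DN: "N \<le> D" unfolding D_def using Y by (intro nth_root_nat_ge) auto
    have D2: "Y < (D + 1) ^ 16"
    proof (rule ccontr)
      assume "\<not> Y < (D + 1) ^ 16"
      hence "D + 1 \<le> D" using nth_root_nat_ge[of 16 "D + 1" Y] unfolding D_def by simp
      thus False by simp
    qed
    have D: "D \<ge> 2" "real D \<ge> 2" using DN N by auto
    have Y1: "Y \<ge> 1"
    proof -
      have "1 \<le> D ^ 16" using D(1) by (intro one_le_power) simp
      thus ?thesis using D1 by linarith
    qed
    have pow: "real D ^ j \<le> real Y" if "j \<le> 16" for j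
    proof -
      have "D ^ j \<le> D ^ 16" using D(1) that by (intro power_increasing) auto
      hence "D ^ j \<le> Y" using D1 by simp
      thus ?thesis by (metis of_nat_le_iff of_nat_power)
    qed
    have NDr: "real N \<le> real D" "real N \<ge> 2" using DN N by simp_all
    have lnN: "ln (real N) \<ge> 1/2" using ln_ge_half[of N] NDr by simp
    have NlnN: "1 \<le> real N * ln (real N)"
      using mult_mono[OF NDr(2) lnN] lnN NDr by simp
    have lnY: "ln (real Y) \<le> 32 * ln (real D)" "ln (real Y) \<ge> 0"
      using ln_le_root_16[OF D2 D(1) Y1] Y1 by auto
    define G where "G = squarefree_harmonic D"
    have G: "G \<ge> 1" "ln (real D) \<le> 2 * G"
      unfolding G_def using squarefree_harmonic_ge_1[of D] ln_le_squarefree_harmonic[of D] D by auto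
    have lnD: "ln (real D) \<le> real D" using ln_le_minus_one[of "real D"] D by simp
    have lnYD: "ln (real Y) \<le> 32 * real D" using lnY(1) lnD by linarith
    let ?B = "\<lambda>p. (norm (jacobi_sum a N p))\<^sup>2"
    let ?O = "{m. m \<in> {1..Y} \<and> odd m}"
    let ?w = "selberg_majorant D"
    have small: "(\<Sum>p\<in>{1..D}. real D * real D ^ 2) \<le> real Y * real N * ln (real N)"
    proof -
      have "(\<Sum>p\<in>{1..D}. real D * real D ^ 2) = real D ^ 4" by (simp add: power2_eq_square power4_eq_xxxx)
      also have "\<dots> \<le> real Y * 1" using pow[of 4] by simp
      also have "\<dots> \<le> real Y * (real N * ln (real N))" using NlnN by (intro mult_left_mono) auto
      finally show ?thesis by (simp add: mult.assoc)
    qed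
    have sieve: "(\<Sum>m\<in>?O. ?w m * ?B m) \<le> (3 * real N * ln (real N)) * (real Y / G + real D ^ 4)
       + 2 * real D ^ 4 * (C1 * real N ^ 3 * ln (real N))"
    proof -
      have "(\<Sum>m\<in>?O. ?w m * ?B m) \<le> real (card (square_pairs N)) * (\<Sum>m\<in>?O. ?w m) +
       (\<Sum>(n1,n2)\<in>odd_nonsquare_pairs N. \<bar>\<Sum>m\<in>?O. ?w m * of_int (jacobi_symbol (int (n1 * n2)) m)\<bar>)"
        by (rule weighted_second_moment[OF adm]) (auto simp: selberg_majorant_nonneg)
      also have "real (card (square_pairs N)) * (\<Sum>m\<in>?O. ?w m) \<le> (3 * real N * ln (real N)) * (real Y / G + real D ^ 4)"
      proof (rule mult_mono)
        have "real (card (square_pairs N)) \<le> real N * harm N" by (rule card_square_pairs_le)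
        also have "\<dots> \<le> real N * (3 * ln (real N))" by (intro mult_left_mono harm_le_3_ln N) auto
        finally show "real (card (square_pairs N)) \<le> 3 * real N * ln (real N)" by simp
        have "(\<Sum>m\<in>?O. ?w m) \<le> (\<Sum>m\<in>{1..Y}. ?w m)"
          by (intro sum_mono2) (auto simp: selberg_majorant_nonneg)
        also have "\<dots> \<le> real Y / G + real D ^ 4"
          unfolding G_def using D by (intro sum_selberg_majorant_le) auto
        finally show "(\<Sum>m\<in>?O. ?w m) \<le> real Y / G + real D ^ 4" .
        show "0 \<le> (\<Sum>m\<in>?O. ?w m)" by (intro sum_nonneg selberg_majorant_nonneg)
      qed (use lnN in auto)
      also have "(\<Sum>(n1,n2)\<in>odd_nonsquare_pairs N. \<bar>\<Sum>m\<in>?O. ?w m * of_int (jacobi_symbol (int (n1 * n2)) m)\<bar>)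
        \<le> (\<Sum>(n1,n2)\<in>odd_nonsquare_pairs N. 2 * real D ^ 4 * (sqrt (real (n1 * n2)) * sigma_half (n1 * n2) * harm (n1 * n2)))"
      proof (rule sum_mono, clarify)
        fix n1 n2 assume "(n1, n2) \<in> odd_nonsquare_pairs N"
        hence "odd (n1 * n2)" "\<not> is_square (n1 * n2)" by (auto simp: odd_nonsquare_pairs_def)
        from sum_selberg_majorant_jacobi_le[OF this, of D Y]
        show "\<bar>\<Sum>m\<in>?O. ?w m * of_int (jacobi_symbol (int (n1 * n2)) m)\<bar>
          \<le> 2 * real D ^ 4 * (sqrt (real (n1 * n2)) * sigma_half (n1 * n2) * harm (n1 * n2))"
          by (simp add: mult_ac)
      qed
      also have "\<dots> = 2 * real D ^ 4 * (\<Sum>(n1,n2)\<in>odd_nonsquare_pairs N. sqrt (real (n1 * n2)) * sigma_half (n1 * n2) * harm (n1 * n2))"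
        unfolding sum_distrib_left by (intro sum.cong refl) auto
      also have "\<dots> \<le> 2 * real D ^ 4 * (C1 * real N ^ 3 * ln (real N))"
        by (intro mult_left_mono C1(2) N) auto
      finally show ?thesis by simp
    qed
    have "(\<Sum>p | p \<in> {1..Y} \<and> prime p \<and> odd p. ln (real p) * ?B p)
      \<le> (\<Sum>p\<in>{1..D} \<union> {p. p \<in> {1..Y} \<and> prime p \<and> odd p \<and> p > D}. ln (real p) * ?B p)"
      by (rule sum_mono2) auto
    also have "\<dots> = (\<Sum>p\<in>{1..D}. ln (real p) * ?B p) + (\<Sum>p | p \<in> {1..Y} \<and> prime p \<and> odd p \<and> p > D. ln (real p) * ?B p)"
      by (rule sum.union_disjoint) auto
    also have "(\<Sum>p\<in>{1..D}. ln (real p) * ?B p) \<le> (\<Sum>p\<in>{1..D}. real D * real D ^ 2)"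
    proof (intro sum_mono mult_mono)
      fix p assume p: "p \<in> {1..D}"
      show "ln (real p) \<le> real D" using ln_le_minus_one[of "real p"] p by simp
      show "?B p \<le> real D ^ 2" using norm_jacobi_sum_le[OF adm, of N p] NDr by (intro power_mono) auto
    qed auto
    also note small
    also have "(\<Sum>p | p \<in> {1..Y} \<and> prime p \<and> odd p \<and> p > D. ln (real p) * ?B p)
       \<le> (\<Sum>m\<in>?O. ln (real Y) * (?w m * ?B m))"
    proof -
      have "(\<Sum>p | p \<in> {1..Y} \<and> prime p \<and> odd p \<and> p > D. ln (real p) * ?B p)
        \<le> (\<Sum>p | p \<in> {1..Y} \<and> prime p \<and> odd p \<and> p > D. ln (real Y) * (?w p * ?B p))"
      proof (rule sum_mono)
        fix p assume "p \<in> {p. p \<in> {1..Y} \<and> prime p \<and> odd p \<and> p > D}"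
        hence p: "1 \<le> p" "p \<le> Y" "prime p" "p > D" by auto
        have "?w p = 1" using selberg_majorant_prime[OF p(3,4)] D by simp
        thus "ln (real p) * ?B p \<le> ln (real Y) * (?w p * ?B p)"
          using p by (simp add: mult_right_mono)
      qed
      also have "\<dots> \<le> (\<Sum>m\<in>?O. ln (real Y) * (?w m * ?B m))"
        by (rule sum_mono2) (auto intro!: mult_nonneg_nonneg selberg_majorant_nonneg lnY(2))
      finally show ?thesis .
    qed
    also have "(\<Sum>m\<in>?O. ln (real Y) * (?w m * ?B m)) = ln (real Y) * (\<Sum>m\<in>?O. ?w m * ?B m)"
      by (simp only: sum_distrib_left)
    also have "\<dots> \<le> ln (real Y) * ((3 * real N * ln (real N)) * (real Y / G + real D ^ 4)
       + 2 * real D ^ 4 * (C1 * real N ^ 3 * ln (real N)))"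
      by (intro mult_left_mono sieve lnY(2))
    also have "\<dots> = (3 * real N * ln (real N)) * (ln (real Y) / G * real Y + ln (real Y) * real D ^ 4)
       + 2 * C1 * (ln (real Y) * real D ^ 4 * real N ^ 2) * (real N * ln (real N))"
      by (simp add: algebra_simps power2_eq_square power3_eq_cube)
    also have "\<dots> \<le> (3 * real N * ln (real N)) * (64 * real Y + 32 * real Y)
       + 2 * C1 * (32 * real Y) * (real N * ln (real N))"
    proof -
      have 1: "ln (real Y) / G * real Y \<le> 64 * real Y"
      proof (rule mult_right_mono)
        have "ln (real Y) \<le> 64 * G" using lnY(1) G(2) by linarith
        thus "ln (real Y) / G \<le> 64" using G(1) by (simp add: divide_le_eq)
      qed simp
      have "ln (real Y) * real D ^ 4 \<le> (32 * real D) * real D ^ 4" by (intro mult_right_mono lnYD) auto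
      also have "\<dots> = 32 * real D ^ 5" by (simp add: power_Suc[symmetric] mult.assoc del: power_Suc)
      also have "\<dots> \<le> 32 * real Y" using pow[of 5] by simp
      finally have 2: "ln (real Y) * real D ^ 4 \<le> 32 * real Y" .
      have "ln (real Y) * real D ^ 4 * real N ^ 2 \<le> (32 * real D) * real D ^ 4 * real D ^ 2"
        using NDr lnY D by (intro mult_mono mult_nonneg_nonneg power_mono lnYD) auto
      also have "\<dots> = 32 * real D ^ 7" by (simp add: eval_nat_numeral)
      also have "\<dots> \<le> 32 * real Y" using pow[of 7] by simp
      finally have 3: "ln (real Y) * real D ^ 4 * real N ^ 2 \<le> 32 * real Y" .
      show ?thesis
        by (rule add_mono[OF mult_left_mono[OF add_mono[OF 1 2]] mult_right_mono[OF mult_left_mono[OF 3]]])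
           (use lnN C1(1) in auto)
    qed
    also have "\<dots> = (288 + 64 * C1) * (real Y * real N * ln (real N))" by (simp add: algebra_simps)
    finally have "(\<Sum>p | p \<in> {1..Y} \<and> prime p \<and> odd p. ln (real p) * ?B p)
       \<le> real Y * real N * ln (real N) + (288 + 64 * C1) * (real Y * real N * ln (real N))" by simp
    also have "\<dots> \<le> (290 + 64 * C1) * (real Y * real N * ln (real N))"
    proof -
      have "0 \<le> real Y * real N * ln (real N)" using lnN by simp
      thus ?thesis by (simp add: algebra_simps)
    qed
    finally show ?thesis .
  qed
  thus ?thesis using C1(1) by (intro exI[of _ "290 + 64 * C1"]) auto
qed

section \<open>Mean values of multiplicative functions\<close>

text \<open>
  The largest function compatible with the hypotheses on \<open>f\<close>. Unlike \<open>f\<close> itself it can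
  only increase when factors of its argument are removed.
\<close>
definition prime_factor_product :: "(nat \<Rightarrow> real) \<Rightarrow> nat \<Rightarrow> real" where
  "prime_factor_product f m = (\<Prod>p\<in>prime_factors m. f p)"

lemma prime_factor_product_bounds:
  assumes f: "\<And>p. prime p \<Longrightarrow> 0 \<le> f p \<and> f p \<le> 1"
  shows "0 \<le> prime_factor_product f m" "prime_factor_product f m \<le> 1"
  unfolding prime_factor_product_def using f
  by (auto intro!: prod_nonneg prod_le_1 dest: in_prime_factors_imp_prime)

lemma prime_factor_product_mult_le:
  assumes f: "\<And>p. prime p \<Longrightarrow> 0 \<le> f p \<and> f p \<le> 1" and "d > 0" "r > 0"
  shows "prime_factor_product f (d * r) \<le> prime_factor_product f r"
proof -
  have "prime_factors (d * r) = prime_factors r \<union> (prime_factors d - prime_factors r)"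
    using assms by (auto simp: prime_factors_product)
  hence "prime_factor_product f (d * r) = prime_factor_product f r * (\<Prod>p\<in>prime_factors d - prime_factors r. f p)"
    unfolding prime_factor_product_def by (simp only:, intro prod.union_disjoint) auto
  also have "\<dots> \<le> prime_factor_product f r * 1"
    using f by (intro mult_left_mono prod_le_1 prime_factor_product_bounds) (auto dest: in_prime_factors_imp_prime)
  finally show ?thesis by simp
qed

lemma multiplicative_prod_prime_powers:
  assumes "multiplicative f" "finite A" "\<And>p. p \<in> A \<Longrightarrow> prime p"
  shows "f (\<Prod>p\<in>A. p ^ e p) = (\<Prod>p\<in>A. f (p ^ e p))"
  using assms(2,3)
proof (induction A rule: finite_induct)
  case (insert q A)
  have "coprime (q ^ e q) (\<Prod>p\<in>A. p ^ e p)"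
  proof (rule prod_coprime_right)
    fix p assume "p \<in> A"
    hence "coprime q p" using insert.prems[of p] insert.prems[of q] insert.hyps(2) by (intro primes_coprime) auto
    thus "coprime (q ^ e q) (p ^ e p)" by simp
  qed
  thus ?case using insert assms(1) by (simp add: multiplicative_def)
qed (use assms(1) in \<open>simp add: multiplicative_def\<close>)

text \<open>
  At every prime power occurring in \<open>m\<close>, \<open>f\<close> is nonnegative and at most its value at the prime.
\<close>
lemma multiplicative_le_prime_factor_product:
  assumes mult: "multiplicative f" and f: "\<And>p. prime p \<Longrightarrow> 0 \<le> f p \<and> f p \<le> 1"
    and fk: "\<And>p k. prime p \<Longrightarrow> k \<ge> 2 \<Longrightarrow> 0 \<le> f (p ^ k) \<and> f (p ^ k) \<le> f p"
    and "m > 0"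
  shows "0 \<le> f m" "f m \<le> prime_factor_product f m"
proof -
  have pp: "0 \<le> f (p ^ multiplicity p m) \<and> f (p ^ multiplicity p m) \<le> f p" if "p \<in> prime_factors m" for p
  proof -
    have pr: "prime p" using that by (rule in_prime_factors_imp_prime)
    have "multiplicity p m > 0" using that by (simp add: prime_factors_multiplicity)
    hence "multiplicity p m = 1 \<or> multiplicity p m \<ge> 2" by linarith
    thus ?thesis using f[OF pr] fk[OF pr] by auto
  qed
  have "m = (\<Prod>p\<in>prime_factors m. p ^ multiplicity p m)"
    using assms(4) prime_factorization_nat by blast
  hence "f m = f (\<Prod>p\<in>prime_factors m. p ^ multiplicity p m)" by (rule arg_cong)
  also have "\<dots> = (\<Prod>p\<in>prime_factors m. f (p ^ multiplicity p m))"
    by (rule multiplicative_prod_prime_powers[OF mult]) (auto dest: in_prime_factors_imp_prime)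
  finally have eq: "f m = (\<Prod>p\<in>prime_factors m. f (p ^ multiplicity p m))" .
  show "0 \<le> f m" unfolding eq using pp by (intro prod_nonneg) auto
  show "f m \<le> prime_factor_product f m" unfolding eq prime_factor_product_def
    using pp by (intro prod_mono) auto
qed

lemma sum_inverse_powers_le:
  assumes "q \<ge> (2::real)"
  shows "(\<Sum>k\<in>{1..n}. 1 / q ^ k) \<le> 1 / (q - 1)"
proof -
  have "(\<Sum>k\<in>{1..n}. 1 / q ^ k) = (1 - 1 / q ^ n) / (q - 1)"
  proof (induction n)
    case (Suc n)
    define x where "x = 1 / q ^ n"
    have x: "1 / q ^ Suc n = x / q" by (simp add: x_def)
    have "(1 - x) / (q - 1) + x / q = (1 - x / q) / (q - 1)"
      using assms by (simp add: field_simps)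
    moreover have "(\<Sum>k\<in>{1..Suc n}. 1 / q ^ k) = (\<Sum>k\<in>{1..n}. 1 / q ^ k) + 1 / q ^ Suc n"
      by simp
    ultimately show ?case using Suc.IH by (simp only: x x_def[symmetric])
  qed simp
  also have "\<dots> \<le> 1 / (q - 1)" using assms by (intro divide_right_mono) auto
  finally show ?thesis .
qed

text \<open>
  Induction on the set of primes. An argument composed of \<open>q\<close> and the primes in \<open>P\<close> is
  \<open>q ^ k * s\<close> with \<open>s\<close> composed of the primes in \<open>P\<close>, and the sum over \<open>k\<close> is at
  most the factor belonging to \<open>q\<close>.
\<close>
lemma euler_product_upper:
  assumes f: "\<And>p. prime p \<Longrightarrow> 0 \<le> f p \<and> f p \<le> 1"
    and "finite P" "\<And>p. p \<in> P \<Longrightarrow> prime p"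
  shows "(\<Sum>r | r \<in> {1..M} \<and> prime_factors r \<subseteq> P. prime_factor_product f r / real r)
      \<le> (\<Prod>p\<in>P. 1 + f p / (real p - 1))"
  using assms(2,3)
proof (induction P rule: finite_induct)
  case empty
  have "{r. r \<in> {1..M} \<and> prime_factors r \<subseteq> {}} \<subseteq> {1}"
    by (auto simp: prime_factorization_empty_iff)
  hence "(\<Sum>r | r \<in> {1..M} \<and> prime_factors r \<subseteq> {}. prime_factor_product f r / real r)
      \<le> (\<Sum>r\<in>{1}. prime_factor_product f r / real r)"
    by (intro sum_mono2) (auto simp: prime_factor_product_bounds f)
  thus ?case by (simp add: prime_factor_product_def)
next
  case (insert q P)
  let ?h = "prime_factor_product f"
  let ?S = "{r. r \<in> {1..M} \<and> prime_factors r \<subseteq> P}"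
  have q: "prime q" using insert.prems by simp
  have q2: "real q \<ge> 2" using prime_ge_2_nat[OF q] by simp
  have fq: "0 \<le> f q" "f q \<le> 1" using f[OF q] by auto
  let ?c = "\<lambda>k. if k = 0 then 1 else f q * (1 / real q ^ k)"
  have h0: "?h r \<ge> 0" for r using prime_factor_product_bounds[of f] f by blast
  have "(\<Sum>r | r \<in> {1..M} \<and> prime_factors r \<subseteq> insert q P. ?h r / real r)
     \<le> (\<Sum>r\<in>(\<lambda>(k, s). q ^ k * s) ` ({0..M} \<times> ?S). ?h r / real r)"
  proof (rule sum_mono2)
    show "{r. r \<in> {1..M} \<and> prime_factors r \<subseteq> insert q P} \<subseteq> (\<lambda>(k, s). q ^ k * s) ` ({0..M} \<times> ?S)"
    proof
      fix r assume "r \<in> {r. r \<in> {1..M} \<and> prime_factors r \<subseteq> insert q P}"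
      hence r: "1 \<le> r" "r \<le> M" "prime_factors r \<subseteq> insert q P" by auto
      define k where "k = multiplicity q r"
      have "\<not> is_unit q" "r \<noteq> 0" using q r by auto
      then obtain s where s: "r = q ^ k * s" "\<not> q dvd s"
        using multiplicity_decompose'[of r q] unfolding k_def by metis
      have s0: "s \<ge> 1" using s r by (cases s) auto
      have "q ^ k \<ge> 1" using prime_gt_0_nat[OF q] by (intro one_le_power) simp
      hence "1 * s \<le> q ^ k * s" by (intro mult_right_mono) auto
      hence "s \<le> r" unfolding s(1) by (simp only: mult_1_left)
      have "k < q ^ k" using prime_ge_2_nat[OF q] by (intro power_gt_expt) auto
 note kq = this
      have "q ^ k * 1 \<le> q ^ k * s" using s0 by (intro mult_left_mono) auto
      hence "q ^ k \<le> r" unfolding s(1) by (simp only: mult_1_right)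
      hence kM: "k \<in> {0..M}" using r kq by simp
      have "prime_factors s \<subseteq> P"
      proof
        fix p assume p: "p \<in> prime_factors s"
        hence "p dvd s" "prime p" by (auto dest: in_prime_factors_imp_dvd in_prime_factors_imp_prime)
        have "p dvd r" unfolding s(1) using \<open>p dvd s\<close> by (rule dvd_mult)
        hence "p \<in> prime_factors r" using r(1) \<open>prime p\<close> by (simp add: in_prime_factors_iff)
        hence "p \<in> insert q P" using r(3) by blast
        moreover have "p \<noteq> q" using \<open>p dvd s\<close> s(2) by auto
        ultimately show "p \<in> P" by blast
      qed
      hence "(k, s) \<in> {0..M} \<times> ?S" using kM s0 \<open>s \<le> r\<close> r(2) by simp
      moreover have "r = (\<lambda>(k, s). q ^ k * s) (k, s)" using s(1) by simp
      ultimately show "r \<in> (\<lambda>(k, s). q ^ k * s) ` ({0..M} \<times> ?S)" by (rule rev_image_eqI)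
    qed
  qed (use h0 in auto)
  also have "\<dots> \<le> (\<Sum>x\<in>{0..M} \<times> ?S. ((\<lambda>r. ?h r / real r) \<circ> (\<lambda>(k, s). q ^ k * s)) x)"
    by (rule sum_image_le) (use h0 in auto)
  also have "\<dots> = (\<Sum>(k, s)\<in>{0..M} \<times> ?S. ?c k * (?h s / real s))"
  proof (rule sum.cong[OF refl])
    fix x assume "x \<in> {0..M} \<times> ?S"
    then obtain k s where x: "x = (k, s)" "s \<ge> 1" "prime_factors s \<subseteq> P" by auto
    have "?h (q ^ k * s) = (if k = 0 then 1 else f q) * ?h s"
    proof (cases "k = 0")
      case False
      have "prime_factors (q ^ k * s) = insert q (prime_factors s)"
        using False q x(2) by (simp add: prime_factors_product prime_factors_power prime_prime_factors)
      moreover have "q \<notin> prime_factors s" using x(3) insert.hyps(2) by blast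
      ultimately show ?thesis using False by (simp add: prime_factor_product_def)
    qed simp
    thus "((\<lambda>r. ?h r / real r) \<circ> (\<lambda>(k, s). q ^ k * s)) x = (case x of (k, s) \<Rightarrow> ?c k * (?h s / real s))"
      unfolding x(1) by simp
  qed
  also have "\<dots> = (\<Sum>k\<in>{0..M}. ?c k) * (\<Sum>s\<in>?S. ?h s / real s)"
    unfolding sum_product by (rule sum.cartesian_product[symmetric])
  also have "\<dots> \<le> (1 + f q / (real q - 1)) * (\<Prod>p\<in>P. 1 + f p / (real p - 1))"
  proof (rule mult_mono)
    have "(\<Sum>k\<in>{0..M}. ?c k) = ?c 0 + (\<Sum>k\<in>{1..M}. ?c k)"
      by (simp add: sum.atLeast_Suc_atMost)
    also have "(\<Sum>k\<in>{1..M}. ?c k) = f q * (\<Sum>k\<in>{1..M}. 1 / real q ^ k)"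
      unfolding sum_distrib_left by (intro sum.cong) auto
    also have "\<dots> \<le> f q * (1 / (real q - 1))" by (intro mult_left_mono sum_inverse_powers_le q2 fq)
    finally show "(\<Sum>k\<in>{0..M}. ?c k) \<le> 1 + f q / (real q - 1)" by simp
    show "(\<Sum>s\<in>?S. ?h s / real s) \<le> (\<Prod>p\<in>P. 1 + f p / (real p - 1))"
      using insert by simp
    show "0 \<le> (\<Sum>s\<in>?S. ?h s / real s)" using h0 by (intro sum_nonneg) auto
    show "0 \<le> 1 + f q / (real q - 1)" using fq q2 by simp
  qed
  also have "\<dots> = (\<Prod>p\<in>insert q P. 1 + f p / (real p - 1))" using insert.hyps by simp
  finally show ?case .
qed

lemma sum_prime_factor_product_over_n:
  assumes f: "\<And>p. prime p \<Longrightarrow> 0 \<le> f p \<and> f p \<le> 1" and M: "M \<ge> 2"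
    and mertens: "(\<Sum>p | prime p \<and> p \<le> M. f p / real p) \<le> \<alpha> * ln (ln (real M)) + K"
  shows "(\<Sum>r\<in>{1..M}. prime_factor_product f r / real r) \<le> exp (K + 4) * ln (real M) powr \<alpha>"
proof -
  let ?P = "{p. prime p \<and> p \<le> M}"
  have fin: "finite ?P" by (rule finite_subset[of _ "{..M}"]) auto
  have "{r. r \<in> {1..M} \<and> prime_factors r \<subseteq> ?P} = {1..M}"
  proof -
    have "p \<le> M" if "r \<in> {1..M}" "p dvd r" for r p
      using dvd_imp_le[OF that(2)] that(1) by simp
    thus ?thesis by (auto simp: in_prime_factors_iff)
  qed
  hence "(\<Sum>r\<in>{1..M}. prime_factor_product f r / real r) =
      (\<Sum>r | r \<in> {1..M} \<and> prime_factors r \<subseteq> ?P. prime_factor_product f r / real r)"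
    by (simp only:)
  also have "\<dots> \<le> (\<Prod>p\<in>?P. 1 + f p / (real p - 1))"
    by (rule euler_product_upper[OF f fin]) simp_all
  also have "\<dots> \<le> (\<Prod>p\<in>?P. exp (f p / real p + 2 * (1 / (real p)\<^sup>2)))"
  proof (rule prod_mono)
    fix p assume "p \<in> ?P"
    hence p: "prime p" "real p \<ge> 2" using prime_ge_2_nat[of p] by auto
    have fp: "0 \<le> f p" "f p \<le> 1" using f[OF p(1)] by auto
    have "f p / (real p - 1) = f p / real p + f p * (1 / (real p * (real p - 1)))"
      using p(2) by (simp add: field_simps)
    also have "\<dots> \<le> f p / real p + 1 * (2 * (1 / (real p)\<^sup>2))"
    proof (intro add_left_mono mult_mono)
      have "(real p)\<^sup>2 \<le> 2 * (real p * (real p - 1))"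
        using mult_left_mono[OF p(2), of "real p"] by (simp add: power2_eq_square algebra_simps)
      hence le: "1 / (2 * (real p * (real p - 1))) \<le> 1 / (real p)\<^sup>2"
        using p(2) by (intro divide_left_mono mult_pos_pos) auto
      have "1 / (real p * (real p - 1)) = 2 * (1 / (2 * (real p * (real p - 1))))" by simp
      also have "\<dots> \<le> 2 * (1 / (real p)\<^sup>2)" by (intro mult_left_mono le) simp
      finally show "1 / (real p * (real p - 1)) \<le> 2 * (1 / (real p)\<^sup>2)" .
    qed (use fp p in auto)
    finally have "1 + f p / (real p - 1) \<le> 1 + (f p / real p + 2 * (1 / (real p)\<^sup>2))" by simp
    also have "\<dots> \<le> exp (f p / real p + 2 * (1 / (real p)\<^sup>2))" by (rule exp_ge_add_one_self)
    finally show "0 \<le> 1 + f p / (real p - 1) \<and> 1 + f p / (real p - 1) \<le> exp (f p / real p + 2 * (1 / (real p)\<^sup>2))"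
      using fp p by simp
  qed
  also have "\<dots> = exp ((\<Sum>p\<in>?P. f p / real p) + 2 * (\<Sum>p\<in>?P. 1 / (real p)\<^sup>2))"
    using fin by (simp only: exp_sum[symmetric] sum.distrib sum_distrib_left)
  also have "\<dots> \<le> exp ((\<alpha> * ln (ln (real M)) + K) + 2 * 2)"
  proof -
    have "(\<Sum>p\<in>?P. 1 / (real p)\<^sup>2) \<le> (\<Sum>p\<in>{1..M}. 1 / (real p)\<^sup>2)"
      by (rule sum_mono2) (auto dest: prime_gt_0_nat intro!: Suc_leI)
    also have "\<dots> \<le> 2" by (rule sum_inverse_squares_le)
    finally show ?thesis using mertens by simp
  qed
  also have "\<dots> = exp (K + 4) * ln (real M) powr \<alpha>"
  proof -
    have "ln (real M) > 0" using M by simp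
    thus ?thesis by (simp add: powr_def exp_add[symmetric] algebra_simps)
  qed
  finally show ?thesis .
qed

text \<open>
  Inserting a logarithm: \<open>ln m\<close> is at least half of \<open>ln M\<close> except for the at most
  \<open>sqrt M\<close> values \<open>m \<le> sqrt M\<close>.
\<close>
lemma sum_le_sum_ln:
  assumes M: "M \<ge> 2" and g: "\<And>m. m \<in> {1..M} \<Longrightarrow> 0 \<le> g m" "\<And>m. m \<in> {1..M} \<Longrightarrow> g m \<le> B"
  shows "(\<Sum>m\<in>{1..M}. g m) \<le> sqrt (real M) * B + 2 / ln (real M) * (\<Sum>m\<in>{1..M}. g m * ln (real m))"
proof -
  have L: "ln (real M) > 0" using M by simp
  have B: "B \<ge> 0" using g(1)[of 1] g(2)[of 1] M by simp
  have "(\<Sum>m\<in>{1..M}. g m) \<le> (\<Sum>m\<in>{1..M}. (if m\<^sup>2 \<le> M then B else 0) + 2 / ln (real M) * (g m * ln (real m)))"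
  proof (rule sum_mono)
    fix m assume m: "m \<in> {1..M}"
    show "g m \<le> (if m\<^sup>2 \<le> M then B else 0) + 2 / ln (real M) * (g m * ln (real m))"
    proof (cases "m\<^sup>2 \<le> M")
      case True
      have "0 \<le> 2 / ln (real M) * (g m * ln (real m))" using L g(1)[OF m] m by simp
      thus ?thesis using True g(2)[OF m] by simp
    next
      case False
      hence "real M \<le> real (m\<^sup>2)" by (simp only: of_nat_le_iff)
      hence "ln (real M) \<le> ln ((real m)\<^sup>2)" using m M by (subst ln_le_cancel_iff) auto
      also have "\<dots> = 2 * ln (real m)" using m by (simp add: ln_realpow)
      finally have "1 \<le> 2 / ln (real M) * ln (real m)" using L by (simp add: field_simps)
      hence "g m * 1 \<le> g m * (2 / ln (real M) * ln (real m))" using g(1)[OF m] by (intro mult_left_mono) auto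
      thus ?thesis using False by (simp add: mult_ac)
    qed
  qed
  also have "\<dots> = (\<Sum>m\<in>{1..M}. if m\<^sup>2 \<le> M then B else 0) + 2 / ln (real M) * (\<Sum>m\<in>{1..M}. g m * ln (real m))"
    by (simp only: sum.distrib sum_distrib_left)
  also have "(\<Sum>m\<in>{1..M}. if m\<^sup>2 \<le> M then B else 0) = (\<Sum>m\<in>{m\<in>{1..M}. m\<^sup>2 \<le> M}. B)"
    by (rule sum.inter_filter[symmetric]) simp
  also have "\<dots> = real (card {m\<in>{1..M}. m\<^sup>2 \<le> M}) * B" by simp
  also have "\<dots> \<le> sqrt (real M) * B"
  proof (rule mult_right_mono[OF _ B])
    have "{m\<in>{1..M}. m\<^sup>2 \<le> M} \<subseteq> {1..nat \<lfloor>sqrt (real M)\<rfloor>}"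
    proof
      fix m assume m: "m \<in> {m\<in>{1..M}. m\<^sup>2 \<le> M}"
      hence "real (m\<^sup>2) \<le> real M" by (simp only: of_nat_le_iff mem_Collect_eq)
      hence "real m \<le> sqrt (real M)" by (intro real_le_rsqrt) simp
      thus "m \<in> {1..nat \<lfloor>sqrt (real M)\<rfloor>}" using m by (simp add: le_nat_floor)
    qed
    hence "card {m\<in>{1..M}. m\<^sup>2 \<le> M} \<le> card {1..nat \<lfloor>sqrt (real M)\<rfloor>}" by (intro card_mono) auto
    hence "real (card {m\<in>{1..M}. m\<^sup>2 \<le> M}) \<le> real (nat \<lfloor>sqrt (real M)\<rfloor>)" by (simp only: card_atLeastAtMost of_nat_le_iff diff_Suc_1)
    also have "\<dots> \<le> sqrt (real M)" by (intro of_nat_floor) simp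
    finally show "real (card {m\<in>{1..M}. m\<^sup>2 \<le> M}) \<le> sqrt (real M)" .
  qed
  finally show ?thesis by simp
qed

lemma hyperbola_swap:
  "(\<Sum>d\<in>{1..M}. \<Sum>r\<in>{1..M div d}. F d r) = (\<Sum>r\<in>{1..M::nat}. \<Sum>d\<in>{1..M div r}. F d r)"
proof -
  have "(\<Sum>d\<in>{1..M}. \<Sum>r\<in>{1..M div d}. F d r) = (\<Sum>d\<in>{1..M}. \<Sum>r | r \<in> {1..M} \<and> d * r \<le> M. F d r)"
  proof (rule sum.cong[OF refl])
    fix d assume "d \<in> {1..M}"
    hence d: "d > 0" by simp
    have "r \<le> M div d \<longleftrightarrow> d * r \<le> M" for r
      using d by (simp add: less_eq_div_iff_mult_less_eq mult.commute)
    moreover have "r \<le> M" if "d * r \<le> M" for r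
    proof -
      have "1 * r \<le> d * r" using d by (intro mult_right_mono) auto
      thus ?thesis using that by linarith
    qed
    ultimately have "{1..M div d} = {r. r \<in> {1..M} \<and> d * r \<le> M}" by auto
    thus "(\<Sum>r\<in>{1..M div d}. F d r) = (\<Sum>r | r \<in> {1..M} \<and> d * r \<le> M. F d r)" by simp
  qed
  also have "\<dots> = (\<Sum>r\<in>{1..M}. \<Sum>d | d \<in> {1..M} \<and> d * r \<le> M. F d r)"
    by (rule sum.swap_restrict) auto
  also have "\<dots> = (\<Sum>r\<in>{1..M}. \<Sum>d\<in>{1..M div r}. F d r)"
  proof (rule sum.cong[OF refl])
    fix r assume "r \<in> {1..M}"
    hence r: "r > 0" by simp
    have "d \<le> M div r \<longleftrightarrow> d * r \<le> M" for d
      using r by (simp add: less_eq_div_iff_mult_less_eq)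
    moreover have "d \<le> M" if "d * r \<le> M" for d
    proof -
      have "d * 1 \<le> d * r" using r by (intro mult_left_mono) auto
      thus ?thesis using that by linarith
    qed
    ultimately have "{1..M div r} = {d. d \<in> {1..M} \<and> d * r \<le> M}" by auto
    thus "(\<Sum>d | d \<in> {1..M} \<and> d * r \<le> M. F d r) = (\<Sum>d\<in>{1..M div r}. F d r)" by simp
  qed
  finally show ?thesis .
qed

text \<open>
  This keeps the constants independent of \<open>\<alpha>\<close>.
\<close>
lemma inverse_le_powr:
  fixes L \<alpha> :: real
  assumes "L \<ge> 1/2" "0 < \<alpha>" "\<alpha> \<le> 1"
  shows "1 / L \<le> 2 * L powr (\<alpha> - 1)"
proof -
  have L: "L > 0" using assms by simp
  have "1/2 \<le> (1/2 :: real) powr \<alpha>"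
    using powr_mono'[of \<alpha> 1 "1/2 :: real"] assms by simp
  also have "\<dots> \<le> L powr \<alpha>" using assms by (intro powr_mono2) auto
  finally have "1 / L \<le> 2 * (L powr \<alpha> / L)" using L by (simp add: field_simps)
  also have "L powr \<alpha> / L = L powr (\<alpha> - 1)" using L by (simp add: powr_diff)
  finally show ?thesis .
qed

text \<open>
  After inserting \<open>ln m\<close> and writing it as a sum of \<open>mangoldt d\<close> over \<open>d dvd m\<close>, the
  sum over \<open>d \<le> M div r\<close> is \<open>O(M / r)\<close> by Chebyshev, and the Euler product bounds the
  remaining sum of \<open>prime_factor_product f r / r\<close>.
\<close>
lemma sum_prime_factor_product_le:
  assumes f: "\<And>p. prime p \<Longrightarrow> 0 \<le> f p \<and> f p \<le> 1" and M: "M \<ge> 2"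
    and \<alpha>: "0 < \<alpha>" "\<alpha> \<le> 1"
    and mertens: "(\<Sum>p | prime p \<and> p \<le> M. f p / real p) \<le> \<alpha> * ln (ln (real M)) + K"
  shows "(\<Sum>m\<in>{1..M}. prime_factor_product f m) \<le> (4 + 8 * exp (K + 4)) * (real M * ln (real M) powr (\<alpha> - 1))"
proof -
  let ?h = "prime_factor_product f" and ?L = "ln (real M)"
  have L: "?L \<ge> 1/2" using ln_ge_half[of M] M by simp
  have h: "0 \<le> ?h m" "?h m \<le> 1" for m using prime_factor_product_bounds[of f] f by blast+
  have "(\<Sum>m\<in>{1..M}. ?h m * ln (real m)) \<le> (\<Sum>m\<in>{1..M}. \<Sum>d | d dvd m. von_mangoldt d * ?h (m div d))"
  proof (rule sum_mono)
    fix m assume m: "m \<in> {1..M}"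
    have "?h m * ln (real m) = (\<Sum>d | d dvd m. von_mangoldt d * ?h m)"
      using mangoldt_sum[of m, where 'a = real] m by (simp add: sum_distrib_right[symmetric] mult.commute)
    also have "\<dots> \<le> (\<Sum>d | d dvd m. von_mangoldt d * ?h (m div d))"
    proof (intro sum_mono mult_left_mono mangoldt_nonneg)
      fix d assume "d \<in> {d. d dvd m}"
      then obtain r where r: "m = d * r" by blast
      have "d > 0" "r > 0" using r m by (auto intro: Nat.gr0I)
      thus "?h m \<le> ?h (m div d)" unfolding r using prime_factor_product_mult_le[of f d r] f by simp
    qed
    finally show "?h m * ln (real m) \<le> (\<Sum>d | d dvd m. von_mangoldt d * ?h (m div d))" .
  qed
  also have "\<dots> = (\<Sum>d\<in>{1..M}. \<Sum>r\<in>{1..M div d}. von_mangoldt d * ?h r)" by (rule sum_divisors_swap)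
  also have "\<dots> = (\<Sum>r\<in>{1..M}. \<Sum>d\<in>{1..M div r}. von_mangoldt d * ?h r)" by (rule hyperbola_swap)
  also have "\<dots> \<le> (\<Sum>r\<in>{1..M}. 4 * real M * (?h r / real r))"
  proof (rule sum_mono)
    fix r assume r: "r \<in> {1..M}"
    have "(\<Sum>d\<in>{1..M div r}. von_mangoldt d * ?h r) = chebyshev_psi (M div r) * ?h r"
      by (simp add: chebyshev_psi_def sum_distrib_right)
    also have "\<dots> \<le> (4 * (real M / real r)) * ?h r"
      using chebyshev_upper[of "M div r"] of_nat_div_le_of_nat[of M r, where 'a = real] h
      by (intro mult_right_mono) auto
    finally show "(\<Sum>d\<in>{1..M div r}. von_mangoldt d * ?h r) \<le> 4 * real M * (?h r / real r)" by simp
  qed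
  also have "\<dots> = 4 * real M * (\<Sum>r\<in>{1..M}. ?h r / real r)" by (simp only: sum_distrib_left)
  also have "\<dots> \<le> 4 * real M * (exp (K + 4) * ?L powr \<alpha>)"
    by (intro mult_left_mono sum_prime_factor_product_over_n f M mertens) auto
  finally have log: "(\<Sum>m\<in>{1..M}. ?h m * ln (real m)) \<le> 4 * real M * (exp (K + 4) * ?L powr \<alpha>)" .
  have "(\<Sum>m\<in>{1..M}. ?h m) \<le> sqrt (real M) * 1 + 2 / ?L * (\<Sum>m\<in>{1..M}. ?h m * ln (real m))"
    by (rule sum_le_sum_ln[OF M]) (use h in auto)
  also have "\<dots> \<le> 4 * (real M * ?L powr (\<alpha> - 1)) + 2 / ?L * (4 * real M * (exp (K + 4) * ?L powr \<alpha>))"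
  proof (intro add_mono mult_left_mono log)
    have "?L = 2 * ln (sqrt (real M))" using M by (simp add: ln_sqrt)
    also have "\<dots> \<le> 2 * sqrt (real M)" using ln_le_minus_one[of "sqrt (real M)"] M by simp
    finally have "sqrt (real M) * ?L \<le> sqrt (real M) * (2 * sqrt (real M))" by (intro mult_left_mono) auto
    also have "sqrt (real M) * (2 * sqrt (real M)) = 2 * real M" by (simp add: mult.left_commute[of "sqrt (real M)"])
    finally have "sqrt (real M) * ?L \<le> 2 * real M" .
    hence "sqrt (real M) \<le> 2 * real M * (1 / ?L)" using L by (simp add: field_simps)
    also have "\<dots> \<le> 2 * real M * (2 * ?L powr (\<alpha> - 1))"
      by (intro mult_left_mono inverse_le_powr L \<alpha>) auto
    finally show "sqrt (real M) * 1 \<le> 4 * (real M * ?L powr (\<alpha> - 1))" by simp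
    show "0 \<le> 2 / ?L" using L by simp
  qed
  also have "2 / ?L * (4 * real M * (exp (K + 4) * ?L powr \<alpha>)) = 8 * exp (K + 4) * (real M * (?L powr \<alpha> / ?L))"
    by simp
  also have "?L powr \<alpha> / ?L = ?L powr (\<alpha> - 1)" using L by (simp add: powr_diff)
  finally show ?thesis by (simp add: algebra_simps)
qed

section \<open>Splitting off a prime power\<close>

text \<open>
  The sum over \<open>r\<close> is moved outside. For given \<open>r\<close> the primes range up to \<open>M div r\<close>, and
  the range \<open>p > N ^ 16\<close> is empty unless \<open>M div r\<close> is large enough for the second moment over
  primes, which is applied with coefficients twisted by \<open>r\<close>.
\<close>
lemma sum_odd_prime_twisted_le:
  fixes C :: real
  assumes h: "\<And>r. 0 \<le> h r"
    and pm: "\<And>Y a. N ^ 16 \<le> Y \<Longrightarrow> admissible a \<Longrightarrow>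
       (\<Sum>p | p \<in> {1..Y} \<and> prime p \<and> odd p. ln (real p) * (norm (jacobi_sum a N p))\<^sup>2) \<le> C * (real Y * real N * ln (real N))"
    and C: "C > 0" and N: "N \<ge> 2" and adm: "admissible a"
  shows "(\<Sum>p | p \<in> {1..M} \<and> prime p \<and> p > N ^ 16. \<Sum>r\<in>{1..M div p}. ln (real p) * (if odd r then h r * (norm (jacobi_sum a N (p * r)))\<^sup>2 else 0))
    \<le> C * (real M * real N * ln (real N)) * (\<Sum>r\<in>{1..M}. h r / real r)"
proof -
  let ?F = "\<lambda>p r. if prime p \<and> p > N ^ 16 then ln (real p) * (if odd r then h r * (norm (jacobi_sum a N (p * r)))\<^sup>2 else 0) else 0"
  have lnN: "ln (real N) \<ge> 0" using N by simp
  have "(\<Sum>p | p \<in> {1..M} \<and> prime p \<and> p > N ^ 16. \<Sum>r\<in>{1..M div p}. ln (real p) * (if odd r then h r * (norm (jacobi_sum a N (p * r)))\<^sup>2 else 0))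
    = (\<Sum>p | p \<in> {1..M} \<and> (prime p \<and> p > N ^ 16). \<Sum>r\<in>{1..M div p}. ?F p r)"
    by (intro sum.cong refl) auto
  also have "\<dots> = (\<Sum>p\<in>{1..M}. \<Sum>r\<in>{1..M div p}. ?F p r)"
  proof (rule sum.mono_neutral_left)
    show "\<forall>p\<in>{1..M} - {p. p \<in> {1..M} \<and> (prime p \<and> p > N ^ 16)}. (\<Sum>r\<in>{1..M div p}. ?F p r) = 0"
    proof
      fix p assume "p \<in> {1..M} - {p. p \<in> {1..M} \<and> (prime p \<and> p > N ^ 16)}"
      hence "\<not> (prime p \<and> p > N ^ 16)" by blast
      thus "(\<Sum>r\<in>{1..M div p}. ?F p r) = 0" by (simp only: if_False sum.neutral_const)
    qed
  qed auto
  also have "\<dots> = (\<Sum>r\<in>{1..M}. \<Sum>p\<in>{1..M div r}. ?F p r)" by (rule hyperbola_swap)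
  also have "\<dots> \<le> (\<Sum>r\<in>{1..M}. C * (real M * real N * ln (real N)) * (h r / real r))"
  proof (rule sum_mono)
    fix r assume r: "r \<in> {1..M}"
    have nn: "0 \<le> C * (real M * real N * ln (real N)) * (h r / real r)"
      using C lnN h[of r] by simp
    show "(\<Sum>p\<in>{1..M div r}. ?F p r) \<le> C * (real M * real N * ln (real N)) * (h r / real r)"
    proof (cases "odd r \<and> N ^ 16 \<le> M div r")
      case False
      have "?F p r = 0" if "p \<in> {1..M div r}" for p using False that by auto
      hence "(\<Sum>p\<in>{1..M div r}. ?F p r) = 0" by (intro sum.neutral) blast
      thus ?thesis using nn by (simp only:)
    next
      case True
      have "(\<Sum>p\<in>{1..M div r}. ?F p r) \<le> (\<Sum>p\<in>{1..M div r}. if prime p \<and> odd p then h r * (ln (real p) * (norm (jacobi_sum (twist r a) N p))\<^sup>2) else 0)"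
      proof (rule sum_mono)
        fix p assume p: "p \<in> {1..M div r}"
        show "?F p r \<le> (if prime p \<and> odd p then h r * (ln (real p) * (norm (jacobi_sum (twist r a) N p))\<^sup>2) else 0)"
        proof (cases "prime p \<and> p > N ^ 16")
          case pr: True
          have "N ^ 1 \<le> N ^ 16" using N by (intro power_increasing) auto
          hence "p > 2" using pr N by simp
          hence "odd p" using pr prime_odd_nat by blast
          moreover have "jacobi_sum a N (p * r) = jacobi_sum (twist r a) N p"
            using jacobi_sum_mult[of r p a N] r p by (simp add: mult.commute)
          ultimately show ?thesis using pr True by simp
        next
          case nopr: False
          have "0 \<le> (if prime p \<and> odd p then h r * (ln (real p) * (norm (jacobi_sum (twist r a) N p))\<^sup>2) else 0)"
            using h[of r] p by (auto intro!: mult_nonneg_nonneg)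
          thus ?thesis using nopr by (simp only: if_False)
        qed
      qed
      also have "\<dots> = (\<Sum>p | p \<in> {1..M div r} \<and> (prime p \<and> odd p). h r * (ln (real p) * (norm (jacobi_sum (twist r a) N p))\<^sup>2))"
        by (rule sum.inter_filter[symmetric]) simp
      also have "\<dots> = h r * (\<Sum>p | p \<in> {1..M div r} \<and> prime p \<and> odd p. ln (real p) * (norm (jacobi_sum (twist r a) N p))\<^sup>2)"
        by (simp only: sum_distrib_left)
      also have "\<dots> \<le> h r * (C * (real (M div r) * real N * ln (real N)))"
        using True by (intro mult_left_mono pm admissible_twist adm h) auto
      also have "\<dots> \<le> h r * (C * ((real M / real r) * real N * ln (real N)))"
        using C lnN h[of r] by (intro mult_left_mono mult_right_mono of_nat_div_le_of_nat) auto
      also have "\<dots> = C * (real M * real N * ln (real N)) * (h r / real r)" by simp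
      finally show ?thesis .
    qed
  qed
  also have "\<dots> = C * (real M * real N * ln (real N)) * (\<Sum>r\<in>{1..M}. h r / real r)"
    by (simp only: sum_distrib_left)
  finally show ?thesis .
qed

text \<open>
  For every \<open>d\<close> the large sieve is applied to the twisted coefficients; Mertens' estimate over
  \<open>d \<le> N ^ 16\<close> costs a factor \<open>ln N\<close>. The condition \<open>N ^ 18 \<le> M\<close> makes the
  off-diagonal contribution, which is of order \<open>N ^ 16 * N ^ 3 * ln N\<close>, admissible.
\<close>
lemma sum_small_divisors_le:
  fixes C :: real
  assumes h: "\<And>r. 0 \<le> h r" "\<And>r. h r \<le> 1"
    and ls: "\<And>Y a. admissible a \<Longrightarrow>
       (\<Sum>m | m \<in> {1..Y} \<and> odd m. (norm (jacobi_sum a N m))\<^sup>2) \<le> C * (real Y * real N * ln (real N) + real N ^ 3 * ln (real N))"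
    and C: "C > 0" and N: "N \<ge> 2" and MN: "N ^ 18 \<le> M" and adm: "admissible a"
  shows "(\<Sum>d\<in>{1..N ^ 16}. von_mangoldt d * (\<Sum>r\<in>{1..M div d}. if odd r then h r * (norm (jacobi_sum a N (d * r)))\<^sup>2 else 0))
    \<le> 152 * C * (real M * real N * (ln (real N))\<^sup>2)"
proof -
  have lnN: "ln (real N) \<ge> 1/2" using ln_ge_half N by simp
  have "(\<Sum>d\<in>{1..N ^ 16}. von_mangoldt d * (\<Sum>r\<in>{1..M div d}. if odd r then h r * (norm (jacobi_sum a N (d * r)))\<^sup>2 else 0))
    \<le> (\<Sum>d\<in>{1..N ^ 16}. von_mangoldt d * (C * ((real M / real d) * real N * ln (real N) + real N ^ 3 * ln (real N))))"
  proof (intro sum_mono mult_left_mono mangoldt_nonneg)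
    fix d assume d: "d \<in> {1..N ^ 16}"
    have "(\<Sum>r\<in>{1..M div d}. if odd r then h r * (norm (jacobi_sum a N (d * r)))\<^sup>2 else 0)
       = (\<Sum>r | r \<in> {1..M div d} \<and> odd r. h r * (norm (jacobi_sum a N (d * r)))\<^sup>2)"
      by (rule sum.inter_filter[symmetric]) simp
    also have "\<dots> \<le> (\<Sum>r | r \<in> {1..M div d} \<and> odd r. (norm (jacobi_sum (twist d a) N r))\<^sup>2)"
    proof (rule sum_mono)
      fix r assume r: "r \<in> {r. r \<in> {1..M div d} \<and> odd r}"
      have "h r * (norm (jacobi_sum a N (d * r)))\<^sup>2 \<le> 1 * (norm (jacobi_sum a N (d * r)))\<^sup>2"
        using h by (intro mult_right_mono) auto
      thus "h r * (norm (jacobi_sum a N (d * r)))\<^sup>2 \<le> (norm (jacobi_sum (twist d a) N r))\<^sup>2"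
        using jacobi_sum_mult[of d r a N] r d by simp
    qed
    also have "\<dots> \<le> C * (real (M div d) * real N * ln (real N) + real N ^ 3 * ln (real N))"
      by (rule ls) (rule admissible_twist[OF adm])
    also have "\<dots> \<le> C * ((real M / real d) * real N * ln (real N) + real N ^ 3 * ln (real N))"
      using C lnN by (intro mult_left_mono add_right_mono mult_right_mono of_nat_div_le_of_nat) auto
    finally show "(\<Sum>r\<in>{1..M div d}. if odd r then h r * (norm (jacobi_sum a N (d * r)))\<^sup>2 else 0)
      \<le> C * ((real M / real d) * real N * ln (real N) + real N ^ 3 * ln (real N))" .
  qed
  also have "\<dots> = (\<Sum>d\<in>{1..N ^ 16}. C * (real M * real N * ln (real N)) * (von_mangoldt d / real d) + C * (real N ^ 3 * ln (real N)) * von_mangoldt d)"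
    by (intro sum.cong refl) (simp add: field_simps)
  also have "\<dots> = C * (real M * real N * ln (real N)) * (\<Sum>d\<in>{1..N ^ 16}. von_mangoldt d / real d) + C * (real N ^ 3 * ln (real N)) * chebyshev_psi (N ^ 16)"
    by (simp only: sum.distrib sum_distrib_left chebyshev_psi_def)
  also have "\<dots> \<le> C * (real M * real N * ln (real N)) * (9 * (16 * ln (real N))) + C * (real N ^ 3 * ln (real N)) * (4 * real N ^ 16)"
  proof (intro add_mono mult_left_mono)
    have "N ^ 1 \<le> N ^ 16" using N by (intro power_increasing) auto
    hence "N ^ 16 \<ge> 2" using N by simp
    from mertens_upper[OF this]
    have "(\<Sum>d\<in>{1..N ^ 16}. von_mangoldt d / real d) \<le> 9 * ln (real N ^ 16)" by simp
    also have "ln (real N ^ 16) = 16 * ln (real N)" using N by (simp add: ln_realpow)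
    finally show "(\<Sum>d\<in>{1..N ^ 16}. von_mangoldt d / real d) \<le> 9 * (16 * ln (real N))" .
    show "chebyshev_psi (N ^ 16) \<le> 4 * real N ^ 16" using chebyshev_upper[of "N ^ 16"] by simp
  qed (use C lnN in auto)
  also have "\<dots> = 144 * C * (real M * real N * (ln (real N))\<^sup>2) + 4 * C * (real N ^ 18 * real N * ln (real N))"
    by (simp add: power2_eq_square eval_nat_numeral)
  also have "\<dots> \<le> 144 * C * (real M * real N * (ln (real N))\<^sup>2) + 4 * C * (real M * real N * (2 * (ln (real N))\<^sup>2))"
  proof (intro add_left_mono mult_left_mono mult_mono)
    show "real N ^ 18 \<le> real M" using MN by (metis of_nat_le_iff of_nat_power)
    have "1 * ln (real N) \<le> (2 * ln (real N)) * ln (real N)" using lnN by (intro mult_right_mono) auto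
    thus "ln (real N) \<le> 2 * (ln (real N))\<^sup>2" by (simp add: power2_eq_square)
  qed (use C lnN in auto)
  also have "\<dots> = 152 * C * (real M * real N * (ln (real N))\<^sup>2)" by (simp add: algebra_simps)
  finally show ?thesis .
qed

text \<open>
  Here \<open>\<bar>A\<bar>\<^sup>2 \<le> N\<^sup>2\<close> suffices, because \<open>N\<^sup>2 \<le> d powr (1/4)\<close>.
\<close>
lemma sum_nonprime_divisors_le:
  fixes C :: real
  assumes h: "\<And>r. 0 \<le> h r" "\<And>r. h r \<le> 1"
    and np: "(\<Sum>d | d \<in> {1..M} \<and> \<not> prime d. von_mangoldt d * real d powr (-3/4)) \<le> C"
    and N: "N \<ge> 2" and adm: "admissible a"
  shows "(\<Sum>d | d \<in> {1..M} \<and> \<not> prime d \<and> d > N ^ 16. von_mangoldt d * (\<Sum>r\<in>{1..M div d}. if odd r then h r * (norm (jacobi_sum a N (d * r)))\<^sup>2 else 0))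
    \<le> C * real M"
proof -
  have "(\<Sum>d | d \<in> {1..M} \<and> \<not> prime d \<and> d > N ^ 16. von_mangoldt d * (\<Sum>r\<in>{1..M div d}. if odd r then h r * (norm (jacobi_sum a N (d * r)))\<^sup>2 else 0))
    \<le> (\<Sum>d | d \<in> {1..M} \<and> \<not> prime d \<and> d > N ^ 16. von_mangoldt d * (real d powr (-3/4) * real M))"
  proof (intro sum_mono mult_left_mono mangoldt_nonneg)
    fix d assume "d \<in> {d. d \<in> {1..M} \<and> \<not> prime d \<and> d > N ^ 16}"
    hence d: "1 \<le> d" "d > N ^ 16" by auto
    have "(\<Sum>r\<in>{1..M div d}. if odd r then h r * (norm (jacobi_sum a N (d * r)))\<^sup>2 else 0) \<le> (\<Sum>r\<in>{1..M div d}. (real N)\<^sup>2)"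
    proof (rule sum_mono)
      fix r
      have "h r * (norm (jacobi_sum a N (d * r)))\<^sup>2 \<le> 1 * (real N)\<^sup>2"
        using h norm_jacobi_sum_le[OF adm] by (intro mult_mono power_mono) auto
      thus "(if odd r then h r * (norm (jacobi_sum a N (d * r)))\<^sup>2 else 0) \<le> (real N)\<^sup>2" by simp
    qed
    also have "\<dots> = real (M div d) * (real N)\<^sup>2" by simp
    also have "\<dots> \<le> (real M / real d) * (real N)\<^sup>2" by (intro mult_right_mono of_nat_div_le_of_nat) auto
    also have "\<dots> \<le> (real M / real d) * real d powr (1/4)"
    proof (intro mult_left_mono)
      have Np: "real N > 0" using N by simp
      have "(real N)\<^sup>2 \<le> real N ^ 4" using N by (intro power_increasing) auto
      also have "\<dots> = (real N powr 16) powr (1/4)" using Np by (subst powr_powr) (simp add: powr_numeral)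
      also have "\<dots> \<le> real d powr (1/4)"
      proof (rule powr_mono2)
        have "real N powr 16 = real (N ^ 16)" using Np by (simp add: powr_numeral)
        thus "real N powr 16 \<le> real d" using d(2) by (simp only: of_nat_le_iff)
      qed auto
      finally show "(real N)\<^sup>2 \<le> real d powr (1/4)" .
    qed simp
    also have "\<dots> = real d powr (-3/4) * real M"
    proof -
      have "real d powr (-3/4) = real d powr (1/4 - 1)" by simp
      also have "\<dots> = real d powr (1/4) / real d" using d(1) by (subst powr_diff) simp
      finally show ?thesis by simp
    qed
    finally show "(\<Sum>r\<in>{1..M div d}. if odd r then h r * (norm (jacobi_sum a N (d * r)))\<^sup>2 else 0) \<le> real d powr (-3/4) * real M" .
  qed
  also have "\<dots> \<le> (\<Sum>d | d \<in> {1..M} \<and> \<not> prime d. von_mangoldt d * (real d powr (-3/4) * real M))"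
    by (rule sum_mono2) (auto intro!: mult_nonneg_nonneg mangoldt_nonneg)
  also have "\<dots> = (\<Sum>d | d \<in> {1..M} \<and> \<not> prime d. von_mangoldt d * real d powr (-3/4)) * real M"
    by (simp only: sum_distrib_right mult.assoc)
  also have "\<dots> \<le> C * real M" by (intro mult_right_mono np) auto
  finally show ?thesis .
qed

text \<open>
  The decomposition of \<open>ln m\<close> over \<open>m = d * r\<close>. Since the weight of \<open>m\<close> is at most that
  of \<open>r\<close>, the weights no longer involve \<open>d\<close>.
\<close>
lemma weighted_log_sum_le:
  assumes f: "\<And>p. prime p \<Longrightarrow> 0 \<le> f p \<and> f p \<le> 1"
  defines "h \<equiv> prime_factor_product f"
  shows "(\<Sum>m\<in>{1..M}. (if odd m then h m * (norm (jacobi_sum a N m))\<^sup>2 else 0) * ln (real m))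
    \<le> (\<Sum>d\<in>{1..M}. von_mangoldt d * (\<Sum>r\<in>{1..M div d}. if odd r then h r * (norm (jacobi_sum a N (d * r)))\<^sup>2 else 0))"
proof -
  have h: "0 \<le> h m" for m unfolding h_def using prime_factor_product_bounds[of f] f by blast
  let ?F = "\<lambda>d r. von_mangoldt d * (if odd r then h r * (norm (jacobi_sum a N (d * r)))\<^sup>2 else 0)"
  have "(\<Sum>m\<in>{1..M}. (if odd m then h m * (norm (jacobi_sum a N m))\<^sup>2 else 0) * ln (real m))
    \<le> (\<Sum>m\<in>{1..M}. \<Sum>d | d dvd m. ?F d (m div d))"
  proof (rule sum_mono)
    fix m assume m: "m \<in> {1..M}"
    have "(if odd m then h m * (norm (jacobi_sum a N m))\<^sup>2 else 0) * ln (real m) =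
      (\<Sum>d | d dvd m. von_mangoldt d * (if odd m then h m * (norm (jacobi_sum a N m))\<^sup>2 else 0))"
      using mangoldt_sum[of m, where 'a = real] m by (simp add: sum_distrib_right[symmetric] mult.commute)
    also have "\<dots> \<le> (\<Sum>d | d dvd m. ?F d (m div d))"
    proof (intro sum_mono mult_left_mono mangoldt_nonneg)
      fix d assume "d \<in> {d. d dvd m}"
      then obtain r where r: "m = d * r" by blast
      have dr: "d > 0" "r > 0" using r m by (auto intro: Nat.gr0I)
      have md: "m div d = r" using r dr by simp
      have "h m \<le> h r" unfolding h_def r by (rule prime_factor_product_mult_le[OF f dr])
      hence "h m * (norm (jacobi_sum a N m))\<^sup>2 \<le> h r * (norm (jacobi_sum a N m))\<^sup>2"
        by (rule mult_right_mono) simp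
      moreover have "odd m \<Longrightarrow> odd r" using r by simp
      ultimately show "(if odd m then h m * (norm (jacobi_sum a N m))\<^sup>2 else 0)
        \<le> (if odd (m div d) then h (m div d) * (norm (jacobi_sum a N (d * (m div d))))\<^sup>2 else 0)"
        unfolding md r[symmetric] using h[of r] by auto
    qed
    finally show "(if odd m then h m * (norm (jacobi_sum a N m))\<^sup>2 else 0) * ln (real m) \<le> (\<Sum>d | d dvd m. ?F d (m div d))" .
  qed
  also have "\<dots> = (\<Sum>d\<in>{1..M}. \<Sum>r\<in>{1..M div d}. ?F d r)" by (rule sum_divisors_swap)
  also have "\<dots> = (\<Sum>d\<in>{1..M}. von_mangoldt d * (\<Sum>r\<in>{1..M div d}. if odd r then h r * (norm (jacobi_sum a N (d * r)))\<^sup>2 else 0))"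
    by (simp only: sum_distrib_left)
  finally show ?thesis .
qed

text \<open>
  If \<open>M < N ^ 18\<close>, the weight is dropped, and \<open>ln M \<le> 18 * ln N\<close> supplies the missing
  factor. Otherwise a logarithm is inserted and the three ranges of the prime power \<open>d\<close> are
  added up; the division by \<open>ln M\<close> produces \<open>ln M powr (\<alpha> - 1)\<close>, either directly or through
  \<open>inverse_le_powr\<close>.
\<close>
lemma weighted_second_moment_bound:
  fixes K :: real
  shows "\<exists>C>0. \<forall>f \<alpha> M N a. (\<forall>p. prime p \<longrightarrow> 0 \<le> f p \<and> f p \<le> 1) \<longrightarrow> M \<ge> 2 \<longrightarrow> N \<ge> 2 \<longrightarrow> 0 < \<alpha> \<longrightarrow> \<alpha> \<le> 1 \<longrightarrow>
     (\<Sum>p | prime p \<and> p \<le> M. f p / real p) \<le> \<alpha> * ln (ln (real M)) + K \<longrightarrow> admissible a \<longrightarrow>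
     (\<Sum>m | m \<in> {1..M} \<and> odd m. prime_factor_product f m * (norm (jacobi_sum a N m))\<^sup>2)
       \<le> C * (real M * real N * (ln (real N))\<^sup>2 * ln (real M) powr (\<alpha> - 1) + real N ^ 3 * ln (real N))"
proof -
  obtain C1 where C1: "C1 > 0" "\<And>N Y a. N \<ge> 2 \<Longrightarrow> admissible a \<Longrightarrow>
     (\<Sum>m | m \<in> {1..Y} \<and> odd m. (norm (jacobi_sum a N m))\<^sup>2) \<le> C1 * (real Y * real N * ln (real N) + real N ^ 3 * ln (real N))"
    using quadratic_large_sieve by blast
  obtain C2 where C2: "C2 > 0" "\<And>N Y a. N \<ge> 2 \<Longrightarrow> Y \<ge> N ^ 16 \<Longrightarrow> admissible a \<Longrightarrow>
     (\<Sum>p | p \<in> {1..Y} \<and> prime p \<and> odd p. ln (real p) * (norm (jacobi_sum a N p))\<^sup>2) \<le> C2 * (real Y * real N * ln (real N))"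
    using prime_second_moment by blast
  obtain C3 where C3: "C3 > 0" "\<And>N. (\<Sum>d | d \<in> {1..N} \<and> \<not> prime d. von_mangoldt d * real d powr (-3/4)) \<le> C3"
    using sum_nonprime_mangoldt_bound by blast
  define E where "E = exp (K + 4)"
  define C where "C = 644 * C1 + 8 * C3 + 4 * C2 * E + 16"
  have E: "E > 0" by (simp add: E_def)
  have Cpos: "C > 0" using C1(1) C2(1) C3(1) E by (simp add: C_def add_pos_pos)
  have "(\<Sum>m | m \<in> {1..M} \<and> odd m. prime_factor_product f m * (norm (jacobi_sum a N m))\<^sup>2)
       \<le> C * (real M * real N * (ln (real N))\<^sup>2 * ln (real M) powr (\<alpha> - 1) + real N ^ 3 * ln (real N))"
    if f: "\<forall>p. prime p \<longrightarrow> 0 \<le> f p \<and> f p \<le> 1" and M: "M \<ge> 2" and N: "N \<ge> 2" and \<alpha>: "0 < \<alpha>" "\<alpha> \<le> 1"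
      and mertens: "(\<Sum>p | prime p \<and> p \<le> M. f p / real p) \<le> \<alpha> * ln (ln (real M)) + K" and adm: "admissible a"
    for f \<alpha> M N a
  proof -
    have f': "\<And>p. prime p \<Longrightarrow> 0 \<le> f p \<and> f p \<le> 1" using f by blast
    let ?h = "prime_factor_product f"
    let ?A = "\<lambda>m. (norm (jacobi_sum a N m))\<^sup>2"
    let ?I = "\<lambda>d. \<Sum>r\<in>{1..M div d}. if odd r then ?h r * (norm (jacobi_sum a N (d * r)))\<^sup>2 else 0"
    define L where "L = ln (real M)"
    define P where "P = L powr (\<alpha> - 1)"
    define n where "n = ln (real N)"
    define R where "R = real M * real N * n\<^sup>2 * P"
    have L: "L \<ge> 1/2" unfolding L_def using ln_ge_half[of M] M by simp
    have n: "n \<ge> 1/2" unfolding n_def using ln_ge_half[of N] N by simp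
    have P: "P \<ge> 0" "1 / L \<le> 2 * P" unfolding P_def using inverse_le_powr[OF L \<alpha>] by auto
    have R0: "R \<ge> 0" unfolding R_def using P by simp
    have nn: "n \<le> 2 * n\<^sup>2" using mult_right_mono[of "1/2" n n] n by (simp add: power2_eq_square)
    have MPR: "real M * P \<le> 2 * R"
    proof -
      have "1/4 \<le> n\<^sup>2" using power_mono[OF n, of 2] by (simp add: power2_eq_square)
      hence "2 * (1/4) \<le> real N * n\<^sup>2" using N by (intro mult_mono) auto
      hence "(real M * P) * (1/2) \<le> (real M * P) * (real N * n\<^sup>2)" using P by (intro mult_left_mono) auto
      thus ?thesis by (simp add: R_def mult_ac)
    qed
    have MNnP: "real M * real N * n * P \<le> 2 * R"
    proof -
      have "(real M * real N * P) * n \<le> (real M * real N * P) * (2 * n\<^sup>2)" using P nn by (intro mult_left_mono) auto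
      thus ?thesis by (simp add: R_def mult_ac)
    qed
    have h: "0 \<le> ?h m" "?h m \<le> 1" for m using prime_factor_product_bounds[of f, OF f'] by blast+
    show ?thesis
    proof (cases "N ^ 18 \<le> M")
      case False
      have "real M \<le> real (N ^ 18)" using False by (simp only: of_nat_le_iff)
      hence "L \<le> ln (real N ^ 18)" unfolding L_def using M N by (subst ln_le_cancel_iff) auto
      also have "\<dots> = 18 * n" using N by (simp add: ln_realpow n_def)
      finally have Ln: "L \<le> 18 * n" .
      have "(\<Sum>m | m \<in> {1..M} \<and> odd m. ?h m * ?A m) \<le> (\<Sum>m | m \<in> {1..M} \<and> odd m. 1 * ?A m)"
        using h by (intro sum_mono mult_right_mono) auto
      also have "\<dots> \<le> C1 * (real M * real N * n + real N ^ 3 * n)"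
        using C1(2)[OF N adm, of M] by (simp add: n_def)
      also have "\<dots> \<le> C1 * (36 * R + real N ^ 3 * n)"
      proof (intro mult_left_mono add_right_mono)
        have "1 = L * (1 / L)" using L by simp
        also have "\<dots> \<le> (18 * n) * (2 * P)" using Ln P L n by (intro mult_mono) auto
        finally have "(real M * real N * n) * 1 \<le> (real M * real N * n) * ((18 * n) * (2 * P))"
          using n by (intro mult_left_mono) auto
        thus "real M * real N * n \<le> 36 * R" by (simp add: R_def power2_eq_square mult_ac)
      qed (use C1 in auto)
      also have "\<dots> = (36 * C1) * R + C1 * (real N ^ 3 * n)" by (simp add: algebra_simps)
      also have "\<dots> \<le> C * R + C * (real N ^ 3 * n)"
        using C1(1) C2(1) C3(1) E R0 n by (intro add_mono mult_right_mono) (auto simp: C_def)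
      finally show ?thesis unfolding R_def P_def L_def n_def by (simp only: distrib_left)
    next
      case True
      \<comment> \<open>the range of small N: a logarithm is inserted\<close>
      let ?g = "\<lambda>m. if odd m then ?h m * ?A m else 0"
      have hA: "0 \<le> ?h m * ?A m \<and> ?h m * ?A m \<le> (real N)\<^sup>2" for m
      proof -
        have "?h m * ?A m \<le> 1 * (real N)\<^sup>2"
          using h norm_jacobi_sum_le[OF adm] by (intro mult_mono power_mono) auto
        thus ?thesis using h by simp
      qed
      have "N ^ 16 \<le> N ^ 18" using N by (intro power_increasing) auto
      hence NM: "N ^ 16 \<le> M" using True by linarith
      have "(\<Sum>d\<in>{1..M}. von_mangoldt d * ?I d) = (\<Sum>d\<in>{1..N ^ 16}. von_mangoldt d * ?I d)
         + ((\<Sum>d | d \<in> {1..M} \<and> \<not> prime d \<and> d > N ^ 16. von_mangoldt d * ?I d) + (\<Sum>d | d \<in> {1..M} \<and> prime d \<and> d > N ^ 16. von_mangoldt d * ?I d))"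
      proof -
        have "{1..M} = {1..N ^ 16} \<union> ({d. d \<in> {1..M} \<and> \<not> prime d \<and> d > N ^ 16} \<union> {d. d \<in> {1..M} \<and> prime d \<and> d > N ^ 16})"
          using NM by auto
        hence "(\<Sum>d\<in>{1..M}. von_mangoldt d * ?I d) = (\<Sum>d\<in>{1..N ^ 16} \<union> ({d. d \<in> {1..M} \<and> \<not> prime d \<and> d > N ^ 16} \<union> {d. d \<in> {1..M} \<and> prime d \<and> d > N ^ 16}). von_mangoldt d * ?I d)"
          by (rule arg_cong)
        also have "\<dots> = (\<Sum>d\<in>{1..N ^ 16}. von_mangoldt d * ?I d) + (\<Sum>d\<in>{d. d \<in> {1..M} \<and> \<not> prime d \<and> d > N ^ 16} \<union> {d. d \<in> {1..M} \<and> prime d \<and> d > N ^ 16}. von_mangoldt d * ?I d)"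
          by (rule sum.union_disjoint) auto
        also have "(\<Sum>d\<in>{d. d \<in> {1..M} \<and> \<not> prime d \<and> d > N ^ 16} \<union> {d. d \<in> {1..M} \<and> prime d \<and> d > N ^ 16}. von_mangoldt d * ?I d)
          = (\<Sum>d | d \<in> {1..M} \<and> \<not> prime d \<and> d > N ^ 16. von_mangoldt d * ?I d) + (\<Sum>d | d \<in> {1..M} \<and> prime d \<and> d > N ^ 16. von_mangoldt d * ?I d)"
          by (rule sum.union_disjoint) auto
        finally show ?thesis .
      qed
      also have "(\<Sum>d\<in>{1..N ^ 16}. von_mangoldt d * ?I d) \<le> 152 * C1 * (real M * real N * n\<^sup>2)"
        unfolding n_def by (rule sum_small_divisors_le[OF h C1(2)[OF N] C1(1) N True adm])
      also have "(\<Sum>d | d \<in> {1..M} \<and> \<not> prime d \<and> d > N ^ 16. von_mangoldt d * ?I d) \<le> C3 * real M"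
        by (rule sum_nonprime_divisors_le[OF h C3(2) N adm])
      also have "(\<Sum>d | d \<in> {1..M} \<and> prime d \<and> d > N ^ 16. von_mangoldt d * ?I d)
          = (\<Sum>p | p \<in> {1..M} \<and> prime p \<and> p > N ^ 16. \<Sum>r\<in>{1..M div p}. ln (real p) * (if odd r then ?h r * (norm (jacobi_sum a N (p * r)))\<^sup>2 else 0))"
      proof (rule sum.cong[OF refl])
        fix p assume "p \<in> {d. d \<in> {1..M} \<and> prime d \<and> d > N ^ 16}"
        hence "von_mangoldt p = ln (real p)" by simp
        thus "von_mangoldt p * ?I p = (\<Sum>r\<in>{1..M div p}. ln (real p) * (if odd r then ?h r * (norm (jacobi_sum a N (p * r)))\<^sup>2 else 0))"
          by (simp only: sum_distrib_left)
      qed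
      also have "\<dots> \<le> C2 * (real M * real N * n) * (\<Sum>r\<in>{1..M}. ?h r / real r)"
        unfolding n_def by (rule sum_odd_prime_twisted_le[OF h(1) C2(2)[OF N] C2(1) N adm])
      also have "\<dots> \<le> C2 * (real M * real N * n) * (E * L powr \<alpha>)"
        unfolding E_def L_def using sum_prime_factor_product_over_n[where f = f, OF f' M mertens] C2(1) n
        by (intro mult_left_mono) auto
      finally have W: "(\<Sum>d\<in>{1..M}. von_mangoldt d * ?I d) \<le> 152 * C1 * (real M * real N * n\<^sup>2) + (C3 * real M + C2 * (real M * real N * n) * (E * L powr \<alpha>))"
        by simp
      have "(\<Sum>m | m \<in> {1..M} \<and> odd m. ?h m * ?A m) = (\<Sum>m\<in>{1..M}. ?g m)"
        by (rule sum.inter_filter) simp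
      also have "\<dots> \<le> sqrt (real M) * (real N)\<^sup>2 + 2 / L * (\<Sum>m\<in>{1..M}. ?g m * ln (real m))"
        unfolding L_def by (rule sum_le_sum_ln[OF M]) (use hA in auto)
      also have "\<dots> \<le> sqrt (real M) * (real N)\<^sup>2 + 2 / L * (152 * C1 * (real M * real N * n\<^sup>2) + (C3 * real M + C2 * (real M * real N * n) * (E * L powr \<alpha>)))"
        using order.trans[OF weighted_log_sum_le[where f = f and M = M and a = a and N = N, OF f'] W] L
        by (intro add_left_mono mult_left_mono) auto
      also have "\<dots> = sqrt (real M) * (real N)\<^sup>2 + (304 * C1 * (real M * real N * n\<^sup>2) * (1 / L) + 2 * C3 * real M * (1 / L)
          + 2 * C2 * E * (real M * real N * n * (L powr \<alpha> / L)))"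
        using L by (simp add: field_simps)
      also have "L powr \<alpha> / L = P" using L by (simp add: powr_diff P_def)
      also have "sqrt (real M) * (real N)\<^sup>2 + (304 * C1 * (real M * real N * n\<^sup>2) * (1 / L) + 2 * C3 * real M * (1 / L) + 2 * C2 * E * (real M * real N * n * P))
        \<le> 16 * R + (304 * C1 * (real M * real N * n\<^sup>2) * (2 * P) + 2 * C3 * real M * (2 * P) + 2 * C2 * E * (2 * R))"
      proof (intro add_mono mult_left_mono P(2) MNnP)
        \<comment> \<open>the values m up to sqrt M are negligible, as both \<open>N\<^sup>2\<close> and \<open>ln M / 4\<close> are at most the fourth root of M\<close>
        let ?x = "sqrt (sqrt (real M))"
        have x: "?x > 0" using M by simp
        have "N ^ 8 \<le> N ^ 18" using N by (intro power_increasing) auto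
        hence "N ^ 8 \<le> M" using True by linarith
        hence N8: "real N ^ 8 \<le> real M" by (metis of_nat_le_iff of_nat_power)
        have "(real N)\<^sup>2 \<le> ?x"
        proof (intro real_le_rsqrt)
          have "(((real N)\<^sup>2)\<^sup>2)\<^sup>2 = real N ^ 8" by (simp add: power_mult[symmetric])
          thus "(((real N)\<^sup>2)\<^sup>2)\<^sup>2 \<le> real M" using N8 by simp
        qed
        moreover have "L \<le> 4 * ?x"
        proof -
          have "L = 4 * ln ?x" unfolding L_def using M by (simp add: ln_sqrt)
          thus ?thesis using ln_le_minus_one[OF x] by simp
        qed
        ultimately have "(real N)\<^sup>2 * L \<le> ?x * (4 * ?x)" using L x by (intro mult_mono) auto
        also have "?x * (4 * ?x) = 4 * sqrt (real M)" by (simp add: mult.left_commute[of ?x])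
        finally have "(real N)\<^sup>2 * L \<le> 4 * sqrt (real M)" .
        hence "sqrt (real M) * ((real N)\<^sup>2 * L) \<le> sqrt (real M) * (4 * sqrt (real M))" by (intro mult_left_mono) auto
        also have "sqrt (real M) * (4 * sqrt (real M)) = 4 * real M" by (simp add: mult.left_commute[of "sqrt (real M)"])
        finally have "sqrt (real M) * (real N)\<^sup>2 \<le> 4 * real M * (1 / L)" using L by (simp add: field_simps)
        also have "\<dots> \<le> 4 * real M * (2 * P)" by (intro mult_left_mono P(2)) auto
        also have "\<dots> = 8 * (real M * P)" by simp
        also have "\<dots> \<le> 8 * (2 * R)" by (intro mult_left_mono MPR) auto
        finally show "sqrt (real M) * (real N)\<^sup>2 \<le> 16 * R" by simp
      qed (use C1 C2 C3 E in auto)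
      also have "\<dots> = 16 * R + 608 * C1 * R + 4 * C3 * (real M * P) + 4 * C2 * E * R"
        by (simp add: R_def algebra_simps)
      also have "\<dots> \<le> 16 * R + 608 * C1 * R + 4 * C3 * (2 * R) + 4 * C2 * E * R"
        using C3 by (intro add_mono mult_left_mono MPR order.refl) auto
      also have "\<dots> = (16 + 608 * C1 + 8 * C3 + 4 * C2 * E) * R" by (simp add: algebra_simps)
      also have "\<dots> \<le> C * R" using C1(1) R0 by (intro mult_right_mono) (auto simp: C_def)
      also have "\<dots> \<le> C * R + C * (real N ^ 3 * n)" using Cpos n by simp
      finally show ?thesis unfolding R_def P_def L_def n_def by (simp only: distrib_left)
    qed
  qed
  thus ?thesis using Cpos by (intro exI[of _ C]) blast
qed

section \<open>The bilinear form\<close>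

text \<open>
  Cauchy--Schwarz in \<open>m\<close>, with the majorant of \<open>f\<close> divided evenly between the two factors.
\<close>
lemma bilinear_sum_bound:
  fixes K :: real
  shows "\<exists>C>0. \<forall>f \<alpha> M N a b. multiplicative f \<longrightarrow> (\<forall>p. prime p \<longrightarrow> 0 \<le> f p \<and> f p \<le> 1) \<longrightarrow>
     (\<forall>p k. prime p \<longrightarrow> k \<ge> 2 \<longrightarrow> 0 \<le> f (p ^ k) \<and> f (p ^ k) \<le> f p) \<longrightarrow>
     M \<ge> 2 \<longrightarrow> N \<ge> 2 \<longrightarrow> 0 < \<alpha> \<longrightarrow> \<alpha> \<le> 1 \<longrightarrow>
     (\<Sum>p | prime p \<and> p \<le> M. f p / real p) \<le> \<alpha> * ln (ln (real M)) + K \<longrightarrow> admissible a \<longrightarrow> admissible b \<longrightarrow>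
     norm (\<Sum>n\<in>{1..N}. \<Sum>m\<in>{1..M}. a n * b m * of_real (f m) * of_int (jacobi_symbol (int n) m))
       \<le> C * (real M * real N powr (1/2) * ln (real N) * ln (real M) powr (\<alpha> - 1)
           + real M powr (1/2) * real N powr (3/2) * ln (real N) powr (1/2) * ln (real M) powr ((\<alpha> - 1) / 2))"
proof -
  obtain C1 where C1: "C1 > 0" and moment: "\<forall>f \<alpha> M N a. (\<forall>p. prime p \<longrightarrow> 0 \<le> f p \<and> f p \<le> 1) \<longrightarrow> M \<ge> 2 \<longrightarrow> N \<ge> 2 \<longrightarrow> 0 < \<alpha> \<longrightarrow> \<alpha> \<le> 1 \<longrightarrow>
     (\<Sum>p | prime p \<and> p \<le> M. f p / real p) \<le> \<alpha> * ln (ln (real M)) + K \<longrightarrow> admissible a \<longrightarrow>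
     (\<Sum>m | m \<in> {1..M} \<and> odd m. prime_factor_product f m * (norm (jacobi_sum a N m))\<^sup>2)
       \<le> C1 * (real M * real N * (ln (real N))\<^sup>2 * ln (real M) powr (\<alpha> - 1) + real N ^ 3 * ln (real N))"
    using weighted_second_moment_bound[of K] by (elim exE conjE) (rule that)
  define C2 where "C2 = 4 + 8 * exp (K + 4)"
  have C2: "C2 > 0" by (simp add: C2_def add_pos_pos)
  define C where "C = sqrt (C1 * C2)"
  have Cpos: "C > 0" using C1 C2 by (simp add: C_def)
  have "norm (\<Sum>n\<in>{1..N}. \<Sum>m\<in>{1..M}. a n * b m * of_real (f m) * of_int (jacobi_symbol (int n) m))
       \<le> C * (real M * real N powr (1/2) * ln (real N) * ln (real M) powr (\<alpha> - 1)
           + real M powr (1/2) * real N powr (3/2) * ln (real N) powr (1/2) * ln (real M) powr ((\<alpha> - 1) / 2))"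
    if mult: "multiplicative f" and f: "\<forall>p. prime p \<longrightarrow> 0 \<le> f p \<and> f p \<le> 1"
      and fk: "\<forall>p k. prime p \<longrightarrow> k \<ge> 2 \<longrightarrow> 0 \<le> f (p ^ k) \<and> f (p ^ k) \<le> f p"
      and M: "M \<ge> 2" and N: "N \<ge> 2" and \<alpha>: "0 < \<alpha>" "\<alpha> \<le> 1"
      and mertens: "(\<Sum>p | prime p \<and> p \<le> M. f p / real p) \<le> \<alpha> * ln (ln (real M)) + K"
      and a: "admissible a" and b: "admissible b" for f \<alpha> M N a b
  proof -
    let ?h = "prime_factor_product f"
    let ?O = "{m. m \<in> {1..M} \<and> odd m}"
    define P where "P = ln (real M) powr (\<alpha> - 1)"
    define n where "n = ln (real N)"
    have P: "P \<ge> 0" by (simp add: P_def)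
    have n: "n \<ge> 0" using N by (simp add: n_def)
    have f': "\<And>p. prime p \<Longrightarrow> 0 \<le> f p \<and> f p \<le> 1" using f by blast
    have h: "0 \<le> ?h m" for m using prime_factor_product_bounds(1)[of f m, OF f'] .
    have fh: "\<bar>f m\<bar> \<le> ?h m" if "m \<in> ?O" for m
      using multiplicative_le_prime_factor_product[OF mult, of m] f fk that by simp
    have "(\<Sum>n\<in>{1..N}. \<Sum>m\<in>{1..M}. a n * b m * of_real (f m) * of_int (jacobi_symbol (int n) m))
       = (\<Sum>m\<in>{1..M}. \<Sum>n\<in>{1..N}. a n * b m * of_real (f m) * of_int (jacobi_symbol (int n) m))"
      by (rule sum.swap)
    also have "\<dots> = (\<Sum>m\<in>{1..M}. b m * of_real (f m) * jacobi_sum a N m)"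
      unfolding jacobi_sum_def sum_distrib_left by (intro sum.cong refl) (simp add: mult_ac)
    also have "\<dots> = (\<Sum>m\<in>?O. b m * of_real (f m) * jacobi_sum a N m)"
    proof (rule sum.mono_neutral_right)
      show "\<forall>m\<in>{1..M} - ?O. b m * of_real (f m) * jacobi_sum a N m = 0"
      proof
        fix m assume "m \<in> {1..M} - ?O"
        hence "\<not> odd m" by blast
        hence "b m = 0" using b unfolding admissible_def by blast
        thus "b m * of_real (f m) * jacobi_sum a N m = 0" by simp
      qed
    qed auto
    finally have "norm (\<Sum>n\<in>{1..N}. \<Sum>m\<in>{1..M}. a n * b m * of_real (f m) * of_int (jacobi_symbol (int n) m))
       \<le> (\<Sum>m\<in>?O. sqrt (?h m) * (sqrt (?h m) * norm (jacobi_sum a N m)))"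
    proof (simp only:, intro sum_norm_le)
      fix m assume m: "m \<in> ?O"
      have "norm (b m) * \<bar>f m\<bar> * norm (jacobi_sum a N m) \<le> 1 * ?h m * norm (jacobi_sum a N m)"
        using b fh[OF m] by (intro mult_mono mult_right_mono) (auto simp: admissible_def h)
      also have "1 * ?h m * norm (jacobi_sum a N m) = sqrt (?h m) * (sqrt (?h m) * norm (jacobi_sum a N m))"
        using h[of m] by (simp add: mult.assoc[symmetric])
      finally show "norm (b m * of_real (f m) * jacobi_sum a N m) \<le> sqrt (?h m) * (sqrt (?h m) * norm (jacobi_sum a N m))"
        by (simp only: norm_mult norm_of_real)
    qed
    also have "\<dots> \<le> sqrt ((\<Sum>m\<in>?O. (sqrt (?h m))\<^sup>2) * (\<Sum>m\<in>?O. (sqrt (?h m) * norm (jacobi_sum a N m))\<^sup>2))"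
      by (rule real_le_rsqrt) (rule Cauchy_Schwarz_ineq_sum)
    also have "\<dots> = sqrt ((\<Sum>m\<in>?O. ?h m) * (\<Sum>m\<in>?O. ?h m * (norm (jacobi_sum a N m))\<^sup>2))"
      using h by (simp add: power_mult_distrib)
    also have "\<dots> \<le> sqrt ((C2 * (real M * P)) * (C1 * (real M * real N * n\<^sup>2 * P + real N ^ 3 * n)))"
    proof (intro real_sqrt_le_mono mult_mono)
      have "(\<Sum>m\<in>?O. ?h m) \<le> (\<Sum>m\<in>{1..M}. ?h m)" using h by (intro sum_mono2) auto
      also have "\<dots> \<le> C2 * (real M * P)"
        unfolding C2_def P_def by (rule sum_prime_factor_product_le[where f = f, OF f' M \<alpha> mertens])
      finally show "(\<Sum>m\<in>?O. ?h m) \<le> C2 * (real M * P)" .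
      show "(\<Sum>m\<in>?O. ?h m * (norm (jacobi_sum a N m))\<^sup>2) \<le> C1 * (real M * real N * n\<^sup>2 * P + real N ^ 3 * n)"
        unfolding P_def n_def using moment[THEN spec, of f, THEN spec, of \<alpha>, THEN spec, of M, THEN spec, of N, THEN spec, of a]
        f M N \<alpha> mertens a by (simp only: simp_thms)
      show "0 \<le> (\<Sum>m\<in>?O. ?h m * (norm (jacobi_sum a N m))\<^sup>2)" using h by (intro sum_nonneg) auto
    qed (use C2 P in auto)
    also have "\<dots> = C * sqrt ((real M)\<^sup>2 * real N * n\<^sup>2 * P\<^sup>2 + real M * real N ^ 3 * n * P)"
      unfolding C_def real_sqrt_mult[symmetric] by (intro arg_cong[where f = sqrt]) (simp add: algebra_simps power2_eq_square)
    also have "\<dots> \<le> C * (sqrt ((real M)\<^sup>2 * real N * n\<^sup>2 * P\<^sup>2) + sqrt (real M * real N ^ 3 * n * P))"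
      using Cpos n P by (intro mult_left_mono sqrt_add_le_add_sqrt) auto
    also have "sqrt ((real M)\<^sup>2 * real N * n\<^sup>2 * P\<^sup>2) = real M * real N powr (1/2) * n * P"
      using n P by (simp add: real_sqrt_mult powr_half_sqrt)
    also have "sqrt (real M * real N ^ 3 * n * P) = real M powr (1/2) * real N powr (3/2) * n powr (1/2) * ln (real M) powr ((\<alpha> - 1) / 2)"
    proof -
      have "sqrt (real N ^ 3) = (real N powr 3) powr (1/2)" using N by (simp add: powr_half_sqrt powr_numeral)
      also have "\<dots> = real N powr (3/2)" by (subst powr_powr) simp
      finally have 1: "sqrt (real N ^ 3) = real N powr (3/2)" .
      have "sqrt P = P powr (1/2)" using P by (simp add: powr_half_sqrt)
      also have "\<dots> = ln (real M) powr ((\<alpha> - 1) / 2)" unfolding P_def by (simp add: powr_powr)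
      finally have 2: "sqrt P = ln (real M) powr ((\<alpha> - 1) / 2)" .
      show ?thesis using n by (simp add: real_sqrt_mult 1 2 powr_half_sqrt)
    qed
    finally show ?thesis unfolding P_def n_def .
  qed
  thus ?thesis using Cpos by (intro exI[of _ C]) blast
qed

text \<open>
  Passing from integers to real \<open>M\<close> and \<open>N\<close> costs a factor 2: the powers of \<open>ln M\<close> have
  nonpositive exponents, so replacing the integer part of \<open>M\<close> by \<open>M\<close> in them needs that the
  two logarithms differ by at most this factor.
\<close>
theorem theorem1p1:
  fixes \<epsilon> K :: real
  assumes "\<epsilon> > 0"
  shows "\<exists>C>0. \<forall>(M::real) (N::real) (\<alpha>::real) (f :: nat \<Rightarrow> real)
           (a :: nat \<Rightarrow> complex) (b :: nat \<Rightarrow> complex).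
           M \<ge> 2 \<longrightarrow> N \<ge> 2 \<longrightarrow>
           multiplicative f \<longrightarrow>
           (\<forall>p. prime p \<longrightarrow> 0 \<le> f p \<and> f p \<le> 1) \<longrightarrow>
           (\<forall>p k. prime p \<longrightarrow> k \<ge> 2 \<longrightarrow> 0 \<le> f (p ^ k) \<and> f (p ^ k) \<le> f p) \<longrightarrow>
           0 < \<alpha> \<longrightarrow> \<alpha> \<le> 1 \<longrightarrow>
           (\<forall>X::real. X \<ge> 2 \<longrightarrow>
              \<bar>(\<Sum>p | prime p \<and> real p \<le> X. f p / real p) - \<alpha> * ln (ln X)\<bar> \<le> K) \<longrightarrow>
           (\<forall>n. a n \<noteq> 0 \<longrightarrow> odd n) \<longrightarrow> (\<forall>n. norm (a n) \<le> 1) \<longrightarrow>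
           (\<forall>m. b m \<noteq> 0 \<longrightarrow> odd m) \<longrightarrow> (\<forall>m. norm (b m) \<le> 1) \<longrightarrow>
           norm (\<Sum>n | 1 \<le> n \<and> real n \<le> N. \<Sum>m | 1 \<le> m \<and> real m \<le> M.
                   a n * b m * of_real (f m) * of_int (jacobi_symbol (int n) m))
           \<le> C * (M * N powr (1/2) * ln N / ln M powr (1 - \<alpha>)
                  + M powr (1/2 + \<epsilon>) * N powr (3/2) * ln N powr (1/2) / ln M powr ((1 - \<alpha>) / 2))"
proof -
  obtain C where C: "C > 0" and bound: "\<forall>f \<alpha> M N a b. multiplicative f \<longrightarrow> (\<forall>p. prime p \<longrightarrow> 0 \<le> f p \<and> f p \<le> 1) \<longrightarrow>
     (\<forall>p k. prime p \<longrightarrow> k \<ge> 2 \<longrightarrow> 0 \<le> f (p ^ k) \<and> f (p ^ k) \<le> f p) \<longrightarrow>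
     M \<ge> 2 \<longrightarrow> N \<ge> 2 \<longrightarrow> 0 < \<alpha> \<longrightarrow> \<alpha> \<le> 1 \<longrightarrow>
     (\<Sum>p | prime p \<and> p \<le> M. f p / real p) \<le> \<alpha> * ln (ln (real M)) + K \<longrightarrow> admissible a \<longrightarrow> admissible b \<longrightarrow>
     norm (\<Sum>n\<in>{1..N}. \<Sum>m\<in>{1..M}. a n * b m * of_real (f m) * of_int (jacobi_symbol (int n) m))
       \<le> C * (real M * real N powr (1/2) * ln (real N) * ln (real M) powr (\<alpha> - 1)
           + real M powr (1/2) * real N powr (3/2) * ln (real N) powr (1/2) * ln (real M) powr ((\<alpha> - 1) / 2))"
    using bilinear_sum_bound[of K] by (elim exE conjE) (rule that)
  show ?thesis
  proof (intro exI[of _ "2 * C"] conjI allI impI)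
    show "2 * C > 0" using C by simp
  next
    fix M N \<alpha> :: real and f :: "nat \<Rightarrow> real" and a b :: "nat \<Rightarrow> complex"
    assume M: "M \<ge> 2" and N: "N \<ge> 2" and mult: "multiplicative f"
      and f: "\<forall>p. prime p \<longrightarrow> 0 \<le> f p \<and> f p \<le> 1"
      and fk: "\<forall>p k. prime p \<longrightarrow> k \<ge> 2 \<longrightarrow> 0 \<le> f (p ^ k) \<and> f (p ^ k) \<le> f p"
      and \<alpha>: "0 < \<alpha>" "\<alpha> \<le> 1"
      and mertens: "\<forall>X::real. X \<ge> 2 \<longrightarrow> \<bar>(\<Sum>p | prime p \<and> real p \<le> X. f p / real p) - \<alpha> * ln (ln X)\<bar> \<le> K"
      and a: "\<forall>n. a n \<noteq> 0 \<longrightarrow> odd n" "\<forall>n. norm (a n) \<le> 1"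
      and b: "\<forall>m. b m \<noteq> 0 \<longrightarrow> odd m" "\<forall>m. norm (b m) \<le> 1"
    define M' where "M' = nat \<lfloor>M\<rfloor>"
    define N' where "N' = nat \<lfloor>N\<rfloor>"
    have M': "M' \<ge> 2" "real M' \<le> M" "M < real M' + 1"
      unfolding M'_def using M by (auto simp: le_nat_floor of_nat_floor)
    have N': "N' \<ge> 2" "real N' \<le> N"
      unfolding N'_def using N by (auto simp: le_nat_floor of_nat_floor)
    have sets: "{n. 1 \<le> n \<and> real n \<le> N} = {1..N'}" "{m. 1 \<le> m \<and> real m \<le> M} = {1..M'}"
      unfolding M'_def N'_def using M N by (auto simp: le_nat_floor nat_le_iff le_floor_iff) (use of_nat_floor in linarith)+
    have LM': "ln (real M') > 0" using M'(1) by simp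
    \<comment> \<open>M is below the successor of its integer part, hence below the square of it\<close>
    have LM: "ln M \<le> 2 * ln (real M')"
    proof -
      have "M \<le> (real M')\<^sup>2"
      proof -
        have "2 * real M' \<le> real M' * real M'" using M'(1) by (intro mult_right_mono) auto
        thus ?thesis using M' unfolding power2_eq_square by linarith
      qed
      hence "ln M \<le> ln ((real M')\<^sup>2)" using M M'(1) by (subst ln_le_cancel_iff) auto
      thus ?thesis using M'(1) by (simp add: ln_realpow)
    qed
    have LMpos: "ln M > 0" using M by simp
    have lnpow: "ln (real M') powr (- c) \<le> 2 * (1 / ln M powr c)" if "0 \<le> c" "c \<le> 1" for c
    proof -
      have "ln M powr c \<le> (2 * ln (real M')) powr c" using LM LMpos that by (intro powr_mono2) auto
      also have "\<dots> = 2 powr c * ln (real M') powr c" by (rule powr_mult)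
      also have "\<dots> \<le> 2 * ln (real M') powr c"
        using powr_mono[of c 1 2] that by (intro mult_right_mono) auto
      finally have le: "ln M powr c \<le> 2 * ln (real M') powr c" .
      have "ln (real M') powr (- c) = 1 / ln (real M') powr c" by (rule powr_minus_divide)
      also have "\<dots> \<le> 2 * (1 / ln M powr c)" using le LM' LMpos by (simp add: field_simps)
      finally show ?thesis .
    qed
    have N0: "real N' > 0" "ln (real N') \<ge> 0" "ln (real N') \<le> ln N" using N' by auto
    have admissible: "admissible a" "admissible b" using a b by (simp_all add: admissible_def)
    have mertens': "(\<Sum>p | prime p \<and> p \<le> M'. f p / real p) \<le> \<alpha> * ln (ln (real M')) + K"
    proof -
      have "real M' \<ge> 2" using M'(1) by simp
      hence "\<bar>(\<Sum>p | prime p \<and> real p \<le> real M'. f p / real p) - \<alpha> * ln (ln (real M'))\<bar> \<le> K"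
        using mertens by blast
      hence "(\<Sum>p | prime p \<and> real p \<le> real M'. f p / real p) \<le> \<alpha> * ln (ln (real M')) + K" by linarith
      thus ?thesis by (simp only: of_nat_le_iff)
    qed
    have "norm (\<Sum>n\<in>{1..N'}. \<Sum>m\<in>{1..M'}. a n * b m * of_real (f m) * of_int (jacobi_symbol (int n) m))
       \<le> C * (real M' * real N' powr (1/2) * ln (real N') * ln (real M') powr (\<alpha> - 1)
           + real M' powr (1/2) * real N' powr (3/2) * ln (real N') powr (1/2) * ln (real M') powr ((\<alpha> - 1) / 2))"
      using bound[THEN spec, of f, THEN spec, of \<alpha>, THEN spec, of M', THEN spec, of N', THEN spec, of a, THEN spec, of b]
        mult f fk M'(1) N'(1) \<alpha> mertens' admissible by (simp only: simp_thms)
    also have "\<dots> \<le> C * (M * N powr (1/2) * ln N * (2 * (1 / ln M powr (1 - \<alpha>)))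
           + M powr (1/2 + \<epsilon>) * N powr (3/2) * ln N powr (1/2) * (2 * (1 / ln M powr ((1 - \<alpha>) / 2))))"
    proof (intro mult_left_mono add_mono mult_mono)
      show "ln (real M') powr (\<alpha> - 1) \<le> 2 * (1 / ln M powr (1 - \<alpha>))"
        using lnpow[of "1 - \<alpha>"] \<alpha> by simp
      have neg: "- ((1 - \<alpha>) / 2) = (\<alpha> - 1) / 2" by (simp add: field_simps)
      show "ln (real M') powr ((\<alpha> - 1) / 2) \<le> 2 * (1 / ln M powr ((1 - \<alpha>) / 2))"
        using lnpow[of "(1 - \<alpha>) / 2"] \<alpha> unfolding neg by simp
      have "real M' powr (1/2) \<le> M powr (1/2)" using M' by (intro powr_mono2) auto
      also have "\<dots> \<le> M powr (1/2 + \<epsilon>)" using M assms by (intro powr_mono) auto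
      finally show "real M' powr (1/2) \<le> M powr (1/2 + \<epsilon>)" .
    qed (use M' N' N0 N M C in \<open>auto intro!: powr_mono2 mult_nonneg_nonneg\<close>)
    also have "\<dots> = 2 * C * (M * N powr (1/2) * ln N / ln M powr (1 - \<alpha>)
           + M powr (1/2 + \<epsilon>) * N powr (3/2) * ln N powr (1/2) / ln M powr ((1 - \<alpha>) / 2))"
      by (simp add: algebra_simps)
    finally show "norm (\<Sum>n | 1 \<le> n \<and> real n \<le> N. \<Sum>m | 1 \<le> m \<and> real m \<le> M.
                   a n * b m * of_real (f m) * of_int (jacobi_symbol (int n) m))
           \<le> 2 * C * (M * N powr (1/2) * ln N / ln M powr (1 - \<alpha>)
                  + M powr (1/2 + \<epsilon>) * N powr (3/2) * ln N powr (1/2) / ln M powr ((1 - \<alpha>) / 2))"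
      unfolding sets .
  qed
qed

end
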